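(* Let $\vec{\xi}:\mathbb{R}^2\to\mathbb{R}^3$ be the Gaussian random field described in the context and let $\gamma$ be the random closed curve parametrized by $\vec{\gamma}(t)=\vec{\xi}(\cos t,\sin t)$, $t\in[0,2\pi]$, i.e. the image under $\vec{\xi}$ of the unit circle in $\mathbb{R}^2$. Let $\vec{f}\in C^2([0,2\pi];\mathbb{R}^3)$ be a parametrization of a smooth closed curve in $\mathbb{R}^3$ without self-intersections. Then the set of $\omega\in\Omega$ for which the curve $\gamma(\omega)$ has the same topological (knot) type as the curve parametrized by $\vec{f}$ is a random event (i.e. is measurable) and has positive probability.
   Context: $\vec{\xi}=(\xi_1,\xi_2,\xi_3):\mathbb{R}^2\to\mathbb{R}^3$ is a centered Gaussian random field on a probability space $(\Omega,\mathcal{F},P)$ whose coordinates are independent and identically distributed with covariance $E\,\xi_1(\vec{u})\xi_1(\vec{v})=e^{-\|\vec{u}-\vec{v}\|^2}$, $\vec{u},\vec{v}\in\mathbb{R}^2$; the modification with infinitely differentiable sample paths is used throughout. A parametrization $\vec{f}\in C^2([0,2\pi];\mathbb{R}^3)$ of a smooth closed curve without self-intersections means: $\vec{f}(0)=\vec{f}(2\pi)$, $\vec{f}'(0)=\vec{f}'(2\pi)$, $\vec{f}'(t)\neq 0$ for all $t$, and $\vec{f}$ is injective on $[0,2\pi)$. Two closed curves in $\mathbb{R}^3$ have the same topological type (the paper also says "are homotopic") if both have no self-intersections and they define the same knot, i.e. there is an orientation-preserving homeomorphism of $\mathbb{R}^3$ carrying the image of one onto the image of the other (equivalently, they are ambient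 isotopic). *)

theory Defs
  imports "HOL-Probability.Probability" "HOL-Homology.Homology"
begin

section \<open>Gaussian random fields\<close>

text \<open>Point masses count as Gaussian (variance 0): a linear combination of the values of
  a Gaussian field may be degenerate.\<close>

definition gaussian_rv :: "'w measure \<Rightarrow> ('w \<Rightarrow> real) \<Rightarrow> bool" where
  "gaussian_rv M X \<longleftrightarrow>
     X \<in> borel_measurable M \<and>
     (\<exists>m. (AE \<omega> in M. X \<omega> = m) \<or> (\<exists>\<sigma>>0. distributed M lborel X (normal_density m \<sigma>)))"

text \<open>All finite-dimensional distributions are jointly Gaussian, i.e. every finite linear
  combination of the scalar variables (component \<open>i\<close> of the value at \<open>u\<close>) is Gaussian.\<close>

definition gaussian_field :: "'w measure \<Rightarrow> ('w \<Rightarrow> 'a \<Rightarrow> real ^ 'n) \<Rightarrow> bool" where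
  "gaussian_field M \<xi> \<longleftrightarrow>
     (\<forall>(A :: ('a \<times> 'n) set) (a :: 'a \<times> 'n \<Rightarrow> real). finite A \<longrightarrow>
        gaussian_rv M (\<lambda>\<omega>. \<Sum>p\<in>A. a p * \<xi> \<omega> (fst p) $ snd p))"

definition centered_field :: "'w measure \<Rightarrow> ('w \<Rightarrow> 'a \<Rightarrow> real ^ 'n) \<Rightarrow> bool" where
  "centered_field M \<xi> \<longleftrightarrow>
     (\<forall>u i. integrable M (\<lambda>\<omega>. \<xi> \<omega> u $ i) \<and> integral\<^sup>L M (\<lambda>\<omega>. \<xi> \<omega> u $ i) = 0)"

text \<open>Independence and identity of laws are those of the coordinates as scalar fields, that is,
  as random elements of the product space of all functions \<open>'a \<Rightarrow> real\<close>.\<close>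

definition coords_iid :: "'w measure \<Rightarrow> ('w \<Rightarrow> 'a \<Rightarrow> real ^ 'n) \<Rightarrow> bool" where
  "coords_iid M \<xi> \<longleftrightarrow>
     prob_space.indep_vars M (\<lambda>_. Pi\<^sub>M (UNIV :: 'a set) (\<lambda>_. borel))
       (\<lambda>i \<omega> u. \<xi> \<omega> u $ i) (UNIV :: 'n set) \<and>
     (\<forall>i j. distr M (Pi\<^sub>M (UNIV :: 'a set) (\<lambda>_. borel)) (\<lambda>\<omega> u. \<xi> \<omega> u $ i) =
            distr M (Pi\<^sub>M (UNIV :: 'a set) (\<lambda>_. borel)) (\<lambda>\<omega> u. \<xi> \<omega> u $ j))"

section \<open>Smoothness\<close>

primrec Ck :: "nat \<Rightarrow> ('a::real_normed_vector \<Rightarrow> 'b::real_normed_vector) \<Rightarrow> bool" where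
  "Ck 0 f \<longleftrightarrow> continuous_on UNIV f"
| "Ck (Suc k) f \<longleftrightarrow>
     (\<forall>x. f differentiable (at x)) \<and> (\<forall>v. Ck k (\<lambda>x. frechet_derivative f (at x) v))"

definition C_infinity :: "('a::real_normed_vector \<Rightarrow> 'b::real_normed_vector) \<Rightarrow> bool" where
  "C_infinity f \<longleftrightarrow> (\<forall>k. Ck k f)"

definition smooth_gaussian_field :: "'w measure \<Rightarrow> ('w \<Rightarrow> real ^ 2 \<Rightarrow> real ^ 3) \<Rightarrow> bool" where
  "smooth_gaussian_field M \<xi> \<longleftrightarrow>
     gaussian_field M \<xi> \<and> centered_field M \<xi> \<and> coords_iid M \<xi> \<and>
     (\<forall>u v. integral\<^sup>L M (\<lambda>\<omega>. \<xi> \<omega> u $ 1 * \<xi> \<omega> v $ 1) = exp (- (norm (u - v))\<^sup>2)) \<and>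
     (\<forall>\<omega>\<in>space M. C_infinity (\<xi> \<omega>))"

section \<open>Closed curves and knot type\<close>

text \<open>Curves are functions on \<open>real\<close> of which only the values on \<open>{0..2 * pi}\<close> matter;
  derivatives at the two end points are one-sided.\<close>

definition smooth_closed_param :: "(real \<Rightarrow> real ^ 3) \<Rightarrow> bool" where
  "smooth_closed_param f \<longleftrightarrow>
     (\<exists>f' f''.
        (\<forall>t\<in>{0..2 * pi}. (f has_vector_derivative f' t) (at t within {0..2 * pi})) \<and>
        (\<forall>t\<in>{0..2 * pi}. (f' has_vector_derivative f'' t) (at t within {0..2 * pi})) \<and>
        continuous_on {0..2 * pi} f'' \<and>
        f 0 = f (2 * pi) \<and> f' 0 = f' (2 * pi) \<and>
        (\<forall>t\<in>{0..2 * pi}. f' t \<noteq> 0) \<and>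
        inj_on f {0..<2 * pi})"

definition simple_closed_curve :: "(real \<Rightarrow> real ^ 3) \<Rightarrow> bool" where
  "simple_closed_curve c \<longleftrightarrow>
     continuous_on {0..2 * pi} c \<and> c 0 = c (2 * pi) \<and> inj_on c {0..<2 * pi}"

text \<open>A homeomorphism \<open>h\<close> of \<open>\<real>\<^sup>3\<close> preserves orientation iff it carries the local orientation at
  a point \<open>x\<close>, a generator of \<open>H\<^sub>3(\<real>\<^sup>3, \<real>\<^sup>3 - x)\<close>, to the local orientation at \<open>h x\<close>, where the
  local homology groups at different points are identified by translation. It does not matter
  which \<open>x\<close> is used; here \<open>x = 0\<close>, and composing \<open>h\<close> with the translation by \<open>- h 0\<close> gives a
  self-map of the pair \<open>(\<real>\<^sup>3, \<real>\<^sup>3 - 0)\<close>, which must induce the identity rather than \<open>-1\<close>.\<close>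

definition orientation_preserving_homeo :: "(real ^ 3 \<Rightarrow> real ^ 3) \<Rightarrow> bool" where
  "orientation_preserving_homeo h \<longleftrightarrow>
     (\<exists>g. homeomorphism UNIV UNIV h g) \<and>
     (\<forall>c \<in> carrier (relative_homology_group 3 (euclidean :: (real ^ 3) topology) (- {0})).
        hom_induced 3 euclidean (- {0}) euclidean (- {0}) (\<lambda>x. h x - h 0) c = c)"

definition same_knot_type :: "(real \<Rightarrow> real ^ 3) \<Rightarrow> (real \<Rightarrow> real ^ 3) \<Rightarrow> bool" where
  "same_knot_type c d \<longleftrightarrow>
     simple_closed_curve c \<and> simple_closed_curve d \<and>
     (\<exists>h. orientation_preserving_homeo h \<and> h ` c ` {0..2 * pi} = d ` {0..2 * pi})"

definition circle_curve :: "(real ^ 2 \<Rightarrow> real ^ 3) \<Rightarrow> real \<Rightarrow> real ^ 3" where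
  "circle_curve x t = x (vector [cos t, sin t])"

end

theory Submission
  imports Defs
begin

text \<open>
  Write \<open>\<gamma>\<close> for the random curve and \<open>F\<close> for the image of \<open>f\<close>. The two assertions of the theorem rest
  on different ideas.

  \<^bold>\<open>Measurability.\<close> Where its derivative vanishes, a simple curve \<open>\<gamma>\<close> may be wild or tame, so that the
  condition on the knot type is not an open one. That such curves have probability zero does not help,
  since subsets of null sets need not be measurable. But the compact sets that some orientation-preserving
  homeomorphism of \<open>\<real>\<^sup>3\<close> carries onto \<open>F\<close> form an orbit of the group of these homeomorphisms, and orbits
  of a Polish group are Borel sets. The abstract form of this fact is
  \<open>image_in_borel_if_fibres_homogeneous\<close>: the image of a complete separable space under a continuous
  map \<open>\<pi>\<close> is Borel if \<open>\<pi>\<close>-saturations of open sets are open. Its proof combines Lusin's separation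
  theorem with an approximation argument in the complete space. In the application, two
  homeomorphisms with the same image of \<open>F\<close> differ by an element of the stabilizer of \<open>F\<close>, which acts
  on the group by homeomorphisms, and this makes saturations of open sets open. The group is complete
  since a homeomorphism is recorded together with its inverse and since the property of preserving the
  orientation survives locally uniform limits (\<open>orientation_preserving_limit\<close>), as the action on local
  homology depends only on the restriction to a sphere up to homotopy.

  \<^bold>\<open>Positivity.\<close> If \<open>g - f\<close> has a small Lipschitz constant with respect to arc length, then \<open>g\<close> has
  the knot type of \<open>f\<close> (\<open>knot_type_stable\<close>). Indeed, chords of \<open>f\<close> are comparable to arcs, so the
  displacement from \<open>F\<close> to the image of \<open>g\<close> is a Lipschitz map with a small constant; it extends to
  \<open>\<real>\<^sup>3\<close>, and the identity plus the extension is a homeomorphism isotopic to the identity. In the same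
  Lipschitz sense \<open>f\<close> is a limit of trigonometric polynomials (\<open>trig_poly_Lipschitz_approx\<close>). It remains
  to see that \<open>\<gamma>\<close> is close to a given trigonometric polynomial with positive probability
  (\<open>close_to_trigonometric_polynomial\<close>). The covariance of \<open>\<gamma>\<close> at angles \<open>s\<close> and \<open>t\<close> is
  \<open>exp (2 * cos (s - t) - 2)\<close>, the characteristic function of the difference of two independent Poisson
  variables. Therefore the real Fourier coefficients of \<open>\<gamma>\<close> are uncorrelated centred Gaussian variables
  whose variances are the point masses of that difference; all of them are positive, and they decay
  exponentially. The finitely many coefficients of low frequency come close to any prescribed values
  with positive probability. Conditioning on this does not affect the high frequencies
  (\<open>blind_weight_insert\<close>), whose contribution to the Lipschitz constant is small in the mean.
\<close>

section \<open>Borel images of continuous maps with homogeneous fibres\<close>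

definition Borel_separated :: "'x::topological_space set \<Rightarrow> 'x set \<Rightarrow> bool" where
  "Borel_separated A B \<longleftrightarrow> (\<exists>S \<in> sets borel. A \<subseteq> S \<and> S \<inter> B = {})"

lemma Borel_separated_UN:
  assumes "countable I" "countable J"
    and "\<And>i j. i \<in> I \<Longrightarrow> j \<in> J \<Longrightarrow> Borel_separated (A i) (B j)"
  shows "Borel_separated (\<Union>i\<in>I. A i) (\<Union>j\<in>J. B j)"
proof -
  obtain S where S: "\<And>i j. i \<in> I \<Longrightarrow> j \<in> J \<Longrightarrow> S i j \<in> sets borel \<and> A i \<subseteq> S i j \<and> S i j \<inter> B j = {}"
    using assms(3) unfolding Borel_separated_def by metis
  have "UNIV - (\<Union>j\<in>J. UNIV - S i j) \<in> sets borel" if "i \<in> I" for i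
  proof -
    have "(\<Union>j\<in>J. UNIV - S i j) \<in> sets borel"
      using assms(2) S that by (intro sets.countable_UN') auto
    then show ?thesis by (metis sets.compl_sets space_borel)
  qed
  then have "(\<Union>i\<in>I. UNIV - (\<Union>j\<in>J. UNIV - S i j)) \<in> sets borel"
    using assms(1) by (intro sets.countable_UN') (blast+)
  moreover have "(\<Union>i\<in>I. A i) \<subseteq> (\<Union>i\<in>I. UNIV - (\<Union>j\<in>J. UNIV - S i j))"
    using S by blast
  moreover have "(\<Union>i\<in>I. UNIV - (\<Union>j\<in>J. UNIV - S i j)) \<inter> (\<Union>j\<in>J. B j) = {}"
    using S by blast
  ultimately show ?thesis
    unfolding Borel_separated_def by blast
qed

text \<open>Lusin's separation theorem. If the images could not be separated, then, since separability passes
to countable unions, some pair of small pieces of \<open>A\<close> and \<open>B\<close> could not be separated either.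
Iterating, the pieces shrink to points \<open>a \<in> A\<close> and \<open>b \<in> B\<close> with \<open>\<pi> a \<noteq> \<pi> b\<close>, and disjoint
neighbourhoods of \<open>\<pi> a\<close> and \<open>\<pi> b\<close> separate the images of all sufficiently small pieces.\<close>

lemma Borel_separated_images_closed:
  fixes \<pi> :: "'p::complete_space \<Rightarrow> 'x::metric_space"
  assumes P: "closed P" and D: "countable D" "P \<subseteq> closure D"
    and \<pi>: "continuous_on P \<pi>"
    and A: "closed A" "A \<subseteq> P" and B: "closed B" "B \<subseteq> P"
    and disj: "\<pi> ` A \<inter> \<pi> ` B = {}"
  shows "Borel_separated (\<pi> ` A) (\<pi> ` B)"
proof (rule ccontr)
  assume nsep: "\<not> Borel_separated (\<pi> ` A) (\<pi> ` B)"
  define bad where "bad = (\<lambda>(k::nat) (p::'p set \<times> 'p set). fst p \<subseteq> A \<and> snd p \<subseteq> B \<and>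
      \<not> Borel_separated (\<pi> ` fst p) (\<pi> ` snd p))"
  define small where "small = (\<lambda>(k::nat) (C::'p set). \<forall>x\<in>C. \<forall>y\<in>C. dist x y \<le> (1/2)^k)"
  have step: "\<exists>q. bad (Suc k) q \<and> (fst q \<subseteq> fst p \<and> snd q \<subseteq> snd p \<and> small k (fst q) \<and> small k (snd q))"
    if bp: "bad k p" for k p
  proof (rule ccontr)
    assume no: "\<not> ?thesis"
    define r :: real where "r = (1/2)^k / 2"
    have r: "r > 0" by (simp add: r_def)
    have small_ball: "small k (C \<inter> ball d r)" for C d
      unfolding small_def
    proof (intro ballI)
      fix x y assume "x \<in> C \<inter> ball d r" "y \<in> C \<inter> ball d r"
      then show "dist x y \<le> (1/2)^k"
        using dist_triangle_half_r[of d x "(1/2)^k" y] by (auto simp: r_def)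
    qed
    have cover: "(\<Union>d\<in>D. \<pi> ` (C \<inter> ball d r)) = \<pi> ` C" if "C \<subseteq> P" for C
    proof -
      have "\<exists>d\<in>D. x \<in> ball d r" if "x \<in> C" for x
        using D(2) \<open>C \<subseteq> P\<close> that r closure_approachable[of x D] by (auto simp: subset_iff)
      then show ?thesis by blast
    qed
    have "Borel_separated (\<pi> ` (fst p \<inter> ball d r)) (\<pi> ` (snd p \<inter> ball e r))" for d e
    proof (rule ccontr)
      assume "\<not> ?thesis"
      then have "bad (Suc k) (fst p \<inter> ball d r, snd p \<inter> ball e r)"
        using bp by (auto simp: bad_def)
      then show False
        using no small_ball by (metis fst_conv snd_conv inf_le1)
    qed
    then have "Borel_separated (\<Union>d\<in>D. \<pi> ` (fst p \<inter> ball d r)) (\<Union>e\<in>D. \<pi> ` (snd p \<inter> ball e r))"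
      using D by (intro Borel_separated_UN) auto
    then have "Borel_separated (\<pi> ` fst p) (\<pi> ` snd p)"
      using cover[of "fst p"] cover[of "snd p"] bp A B unfolding bad_def by auto
    then show False using bp by (simp add: bad_def)
  qed
  have "\<exists>F. \<forall>n. bad n (F n) \<and> (fst (F (Suc n)) \<subseteq> fst (F n) \<and> snd (F (Suc n)) \<subseteq> snd (F n) \<and>
      small n (fst (F (Suc n))) \<and> small n (snd (F (Suc n))))"
  proof (rule dependent_nat_choice)
    show "\<exists>p. bad 0 p"
      using nsep by (intro exI[of _ "(A, B)"]) (auto simp: bad_def)
    show "\<exists>q. bad (Suc n) q \<and> fst q \<subseteq> fst p \<and> snd q \<subseteq> snd p \<and> small n (fst q) \<and> small n (snd q)"
      if "bad n p" for p n using step[OF that] .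
  qed
  then obtain F where F: "\<And>n. bad n (F n)"
    and Fs: "\<And>n. fst (F (Suc n)) \<subseteq> fst (F n)" "\<And>n. snd (F (Suc n)) \<subseteq> snd (F n)"
      "\<And>n. small n (fst (F (Suc n)))" "\<And>n. small n (snd (F (Suc n)))"
    by blast
  have lim: "\<exists>a\<in>C. \<forall>n. \<forall>x\<in>G (Suc n). dist x a \<le> (1/2)^n"
    if C: "closed C" "\<And>n. G n \<subseteq> C" and ne: "\<And>n. G n \<noteq> {}" and dec: "\<And>n. G (Suc n) \<subseteq> G n"
      and sm: "\<And>n. small n (G (Suc n))" for C and G :: "nat \<Rightarrow> 'p set"
  proof -
    have "\<forall>n. \<exists>y. y \<in> G (Suc n)" using ne by blast
    then obtain x where x: "\<And>n. x n \<in> G (Suc n)" by metis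
    have mono: "G n \<subseteq> G m" if "m \<le> n" for m n
      using dec by (metis lift_Suc_antimono_le that)
    have dxy: "dist y (x m) \<le> (1/2)^n" if "n \<le> m" "y \<in> G (Suc n)" for n m y
    proof -
      have "x m \<in> G (Suc n)" using x[of m] mono[of "Suc n" "Suc m"] that by auto
      then show ?thesis using sm[of n] that by (auto simp: small_def)
    qed
    have "Cauchy x"
    proof (rule metric_CauchyI)
      fix e :: real assume "e > 0"
      then obtain N where N: "(1/2)^N < e" using real_arch_pow_inv[of e "1/2"] by auto
      have "dist (x m) (x n) < e" if "m \<ge> N" "n \<ge> N" for m n
      proof -
        have "x m \<in> G (Suc N)" using x[of m] mono[of "Suc N" "Suc m"] that by auto
        then show ?thesis using dxy[of N n "x m"] that N by linarith
      qed
      then show "\<exists>M. \<forall>m\<ge>M. \<forall>n\<ge>M. dist (x m) (x n) < e" by blast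
    qed
    then obtain a where a: "x \<longlonglongrightarrow> a" using convergent_def Cauchy_convergent by blast
    have "\<forall>n. x n \<in> C" using C(2) x by blast
    then have "a \<in> C" using C(1) a closed_sequentially by blast
    moreover have "dist y a \<le> (1/2)^n" if "y \<in> G (Suc n)" for n y
    proof (rule LIMSEQ_le_const2)
      show "(\<lambda>m. dist y (x m)) \<longlonglongrightarrow> dist y a" using a by (intro tendsto_intros)
      show "\<exists>N. \<forall>m\<ge>N. dist y (x m) \<le> (1/2)^n" using dxy that by blast
    qed
    ultimately show ?thesis by blast
  qed
  have "fst (F n) \<noteq> {}" "snd (F n) \<noteq> {}" for n
  proof -
    have "Borel_separated {} X" "Borel_separated X {}" for X :: "'x set"
      unfolding Borel_separated_def by (auto intro: bexI[of _ "{}"] bexI[of _ UNIV])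
    then show "fst (F n) \<noteq> {}" "snd (F n) \<noteq> {}"
      using F[of n] by (auto simp: bad_def)
  qed
  note ne = this
  obtain a where a: "a \<in> A" "\<And>n x. x \<in> fst (F (Suc n)) \<Longrightarrow> dist x a \<le> (1/2)^n"
    using lim[of A "\<lambda>n. fst (F n)", OF A(1) _ ne(1) Fs(1,3)] F unfolding bad_def by blast
  obtain b where b: "b \<in> B" "\<And>n x. x \<in> snd (F (Suc n)) \<Longrightarrow> dist x b \<le> (1/2)^n"
    using lim[of B "\<lambda>n. snd (F n)", OF B(1) _ ne(2) Fs(2,4)] F unfolding bad_def by blast
  have "\<pi> a \<noteq> \<pi> b" using a b disj by blast
  from hausdorff[OF this]
  obtain U V where UV: "open U" "open V" "\<pi> a \<in> U" "\<pi> b \<in> V" "U \<inter> V = {}"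
    by blast
  have nb: "\<exists>\<delta>>0. \<forall>x\<in>P. dist x c < \<delta> \<longrightarrow> \<pi> x \<in> W" if W: "open W" "\<pi> c \<in> W" "c \<in> P" for c W
  proof -
    obtain e where e: "e > 0" "ball (\<pi> c) e \<subseteq> W" by (rule openE[OF W(1,2)])
    obtain \<delta> where "\<delta> > 0" "\<And>x. x \<in> P \<Longrightarrow> dist x c < \<delta> \<Longrightarrow> dist (\<pi> x) (\<pi> c) < e"
      using \<pi>[unfolded continuous_on_iff, rule_format, OF \<open>c \<in> P\<close> e(1)] by blast
    then show ?thesis
      using e(2) by (intro exI[of _ \<delta>]) (auto simp: dist_commute subset_iff)
  qed
  obtain \<delta>1 \<delta>2 where \<delta>: "\<delta>1 > 0" "\<delta>2 > 0" "\<And>x. x \<in> P \<Longrightarrow> dist x a < \<delta>1 \<Longrightarrow> \<pi> x \<in> U"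
    "\<And>x. x \<in> P \<Longrightarrow> dist x b < \<delta>2 \<Longrightarrow> \<pi> x \<in> V"
    using nb[OF UV(1,3)] nb[OF UV(2,4)] a(1) b(1) A(2) B(2) by (meson subsetD)
  obtain n where n: "(1/2)^n < min \<delta>1 \<delta>2"
    using real_arch_pow_inv[of "min \<delta>1 \<delta>2" "1/2"] \<delta> by auto
  have "\<pi> ` fst (F (Suc n)) \<subseteq> U" "\<pi> ` snd (F (Suc n)) \<subseteq> V"
    using F[of "Suc n"] a(2)[of _ n] b(2)[of _ n] \<delta>(3,4) n A(2) B(2) unfolding bad_def
    by (auto simp: subset_iff) (meson le_less_trans)+
  then have "Borel_separated (\<pi> ` fst (F (Suc n))) (\<pi> ` snd (F (Suc n)))"
    unfolding Borel_separated_def using UV by (intro bexI[of _ U]) auto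
  then show False using F[of "Suc n"] by (simp add: bad_def)
qed

text \<open>The reason why orbits of Polish groups are Borel. The lifting hypothesis says that the
\<open>\<pi>\<close>-saturation of a relatively open set \<open>U\<close> is relatively open in \<open>P\<close>. Hence \<open>\<pi> ` U\<close> and
\<open>\<pi> ` P - \<pi> ` U\<close> are both images of countable unions of closed sets, and a Borel set between
\<open>\<pi> ` U\<close> and its closure has the trace \<open>\<pi> ` U\<close> on \<open>\<pi> ` P\<close>. Take \<open>U\<close> to be a ball
around a point of the dense set \<open>D\<close> with radius \<open>(1/2)^k\<close>, and call the Borel set \<open>B d k\<close>. Then
\<open>x \<in> \<pi> ` P\<close> iff \<open>x\<close> lies in some \<open>B d 0\<close> and each \<open>B d k\<close> containing \<open>x\<close> can be refined to a
nearby \<open>B d' (k + 1)\<close> containing \<open>x\<close>: by completeness the centres of an infinite refinement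
converge to a point that \<open>\<pi>\<close> maps to \<open>x\<close>.\<close>

theorem image_in_borel_if_fibres_homogeneous:
  fixes \<pi> :: "'p::complete_space \<Rightarrow> 'x::metric_space"
  assumes P: "closed P" and D: "countable D" "D \<subseteq> P" "P \<subseteq> closure D"
    and \<pi>: "continuous_on P \<pi>"
    and lift: "\<And>p q z. p \<in> P \<Longrightarrow> q \<in> P \<Longrightarrow> \<pi> p = \<pi> q \<Longrightarrow> (\<And>n::nat. z n \<in> P) \<Longrightarrow> z \<longlonglongrightarrow> q \<Longrightarrow>
        \<exists>w. (\<forall>n. w n \<in> P \<and> \<pi> (w n) = \<pi> (z n)) \<and> w \<longlonglongrightarrow> p"
  shows "\<pi> ` P \<in> sets borel"
proof -
  define U where "U = (\<lambda>d (k::nat). P \<inter> ball d ((1/2)^k))"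
  define good where "good = (\<lambda>d k S. S \<in> sets borel \<and> \<pi> ` U d k \<subseteq> S \<and>
      S \<subseteq> closure (\<pi> ` U d k) \<and> S \<inter> \<pi> ` P \<subseteq> \<pi> ` U d k)"
  have "\<exists>S. good d k S" for d k
  proof -
    define N where "N = {q \<in> P. \<pi> q \<notin> \<pi> ` U d k}"
    have "closed N"
      unfolding closed_sequential_limits
    proof (intro allI impI, elim conjE)
      fix z q assume z: "\<forall>n::nat. z n \<in> N" "z \<longlonglongrightarrow> q"
      have q: "q \<in> P" using P z unfolding closed_sequential_limits N_def by blast
      show "q \<in> N"
      proof (rule ccontr)
        assume "q \<notin> N"
        then obtain p where p: "p \<in> P" "p \<in> ball d ((1/2)^k)" "\<pi> p = \<pi> q"
          using q unfolding N_def U_def by (auto simp: image_iff)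
        obtain w where w: "\<And>n. w n \<in> P \<and> \<pi> (w n) = \<pi> (z n)" "w \<longlonglongrightarrow> p"
          using lift[OF p(1) q p(3) _ z(2)] z(1) unfolding N_def by force
        have "eventually (\<lambda>n. w n \<in> ball d ((1/2)^k)) sequentially"
          using topological_tendstoD[OF w(2) open_ball p(2)] .
        then obtain n where "w n \<in> ball d ((1/2)^k)" using eventually_sequentially by auto
        then have "\<pi> (z n) \<in> \<pi> ` U d k" using w(1)[of n] unfolding U_def by (metis IntI imageI)
        then show False using z unfolding N_def by blast
      qed
    qed
    \<comment> \<open>Separation is available for closed sets only, so the open ball is exhausted by closed ones.\<close>
    define C where "C = (\<lambda>m::nat. P \<inter> cball d ((1/2)^k - 1 / Suc m))"
    have UC: "U d k = (\<Union>m. C m)"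
    proof -
      have "\<exists>m. dist d x \<le> (1/2)^k - 1 / real (Suc m)" if "dist d x < (1/2)^k" for x
      proof -
        have "0 < (1/2)^k - dist d x" using that by simp
        then obtain m where "inverse (real (Suc m)) < (1/2)^k - dist d x"
          using reals_Archimedean by blast
        then show ?thesis by (intro exI[of _ m]) (simp add: inverse_eq_divide)
      qed
      moreover have "dist d x < (1/2)^k" if "dist d x \<le> (1/2)^k - 1 / real (Suc m)" for x m
      proof -
        have "1 / real (Suc m) > 0" by simp
        then show ?thesis using that by linarith
      qed
      ultimately show ?thesis unfolding U_def C_def by auto
    qed
    have "Borel_separated (\<Union>m\<in>UNIV. \<pi> ` C m) (\<Union>j\<in>{()}. \<pi> ` N)"
    proof (rule Borel_separated_UN)
      fix m :: nat
      show "Borel_separated (\<pi> ` C m) (\<pi> ` N)"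
      proof (rule Borel_separated_images_closed[OF P D(1) D(3) \<pi>])
        show "closed (C m)" unfolding C_def using P by (intro closed_Int closed_cball)
        have "\<pi> ` C m \<subseteq> \<pi> ` U d k" using UC by (intro image_mono) blast
        moreover have "y \<notin> \<pi> ` U d k" if "y \<in> \<pi> ` N" for y
          using that unfolding N_def by force
        ultimately show "\<pi> ` C m \<inter> \<pi> ` N = {}" by (meson disjoint_iff subsetD)
        show "C m \<subseteq> P" "N \<subseteq> P" by (auto simp: C_def N_def)
      qed (fact \<open>closed N\<close>)
    qed simp_all
    then obtain S where S: "S \<in> sets borel" "\<pi> ` U d k \<subseteq> S" "S \<inter> \<pi> ` N = {}"
      unfolding Borel_separated_def UC image_UN UN_insert UN_empty Un_empty_right by blast
    have "\<pi> ` P \<subseteq> \<pi> ` U d k \<union> \<pi> ` N" unfolding N_def by auto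
    moreover have "S \<inter> closure (\<pi> ` U d k) \<in> sets borel" using S(1) by simp
    moreover have "\<pi> ` U d k \<subseteq> S \<inter> closure (\<pi> ` U d k)"
      using S(2) closure_subset[of "\<pi> ` U d k"] by blast
    moreover have "(S \<inter> closure (\<pi> ` U d k)) \<inter> \<pi> ` P \<subseteq> \<pi> ` U d k"
      using S(3) \<open>\<pi> ` P \<subseteq> \<pi> ` U d k \<union> \<pi> ` N\<close> by blast
    ultimately have "good d k (S \<inter> closure (\<pi> ` U d k))"
      unfolding good_def by (intro conjI Int_lower2)
    then show ?thesis by (rule exI)
  qed
  then obtain B where good_B: "\<And>d k. good d k (B d k)" by metis
  have B: "\<And>d k. B d k \<in> sets borel" "\<And>d k. \<pi> ` U d k \<subseteq> B d k"
    "\<And>d k. B d k \<subseteq> closure (\<pi> ` U d k)" "\<And>d k. B d k \<inter> \<pi> ` P \<subseteq> \<pi> ` U d k"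
    using good_B unfolding good_def by simp_all
  define near where "near = (\<lambda>d (k::nat). {d'\<in>D. dist d d' < 2 * (1/2)^k})"
  define T where "T = (\<Union>d\<in>D. B d 0) \<inter> (UNIV - (\<Union>d\<in>D. \<Union>k. B d k - (\<Union>d'\<in>near d k. B d' (Suc k))))"
  have near: "(\<Union>d'\<in>near d k. B d' (Suc k)) \<in> sets borel" for d k
    using D(1) B(1) by (intro sets.countable_UN') (auto simp: near_def)
  have "B d k - (\<Union>d'\<in>near d k. B d' (Suc k)) \<in> sets borel" for d k
    using B(1) near by (rule sets.Diff)
  then have "(\<Union>k. B d k - (\<Union>d'\<in>near d k. B d' (Suc k))) \<in> sets borel" for d
    by (intro sets.countable_UN) auto
  then have "T \<in> sets borel"
    unfolding T_def
    using D(1) B(1) by (intro sets.Int sets.Diff sets.countable_UN' borel_open) auto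
  moreover have "\<pi> ` P \<subseteq> T"
  proof
    fix x assume x: "x \<in> \<pi> ` P"
    have cov: "\<exists>d'\<in>D. p \<in> U d' k \<and> dist p d' < (1/2)^k" if "p \<in> P" for p k
    proof -
      have "p \<in> closure D" using that D(3) by blast
      then obtain d' where "d' \<in> D" "dist d' p < (1/2)^k"
        unfolding closure_approachable by (metis half_gt_zero_iff zero_less_one zero_less_power)
      then show ?thesis using that by (intro bexI[of _ d']) (auto simp: U_def dist_commute)
    qed
    obtain p where p: "p \<in> P" "x = \<pi> p" using x by blast
    have "\<exists>d\<in>D. x \<in> B d 0" using cov[OF p(1), of 0] B(2) p by blast
    moreover have "\<exists>d'\<in>near d k. x \<in> B d' (Suc k)" if "d \<in> D" "x \<in> B d k" for d k
    proof -
      have "x \<in> \<pi> ` U d k" using B(4) that x by blast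
      then obtain p where p: "p \<in> U d k" "x = \<pi> p" by blast
      then obtain d' where d': "d' \<in> D" "p \<in> U d' (Suc k)" "dist p d' < (1/2)^(Suc k)"
        using cov[of p "Suc k"] unfolding U_def by blast
      have "dist d d' \<le> dist d p + dist p d'" by (rule dist_triangle)
      also have "\<dots> < (1/2)^k + (1/2)^(Suc k)"
        using p(1) d'(3) unfolding U_def by (intro add_strict_mono) auto
      finally have "dist d d' < 2 * (1/2)^k" by (simp add: field_simps)
      then show ?thesis using d' B(2)[of d' "Suc k"] p(2) unfolding near_def by auto
    qed
    ultimately show "x \<in> T" unfolding T_def by blast
  qed
  moreover have "T \<subseteq> \<pi> ` P"
  proof
    fix x assume x: "x \<in> T"
    have "\<exists>d. \<forall>n. (d n \<in> D \<and> x \<in> B (d n) n) \<and> d (Suc n) \<in> near (d n) n"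
    proof (rule dependent_nat_choice)
      show "\<exists>d. d \<in> D \<and> x \<in> B d 0" using x unfolding T_def by blast
      show "\<exists>d'. (d' \<in> D \<and> x \<in> B d' (Suc n)) \<and> d' \<in> near d n" if "d \<in> D \<and> x \<in> B d n" for d n
        using x that unfolding T_def near_def by blast
    qed
    then obtain d where d: "\<And>n. d n \<in> D" "\<And>n. x \<in> B (d n) n" "\<And>n. dist (d n) (d (Suc n)) < 2 * (1/2)^n"
      unfolding near_def by blast
    have far: "dist (d n) (d (n + m)) \<le> 4 * (1/2)^n - 4 * (1/2)^(n+m)" for n m
    proof (induction m)
      case (Suc m)
      have "dist (d n) (d (n + Suc m)) \<le> dist (d n) (d (n + m)) + dist (d (n + m)) (d (Suc (n + m)))"
        using dist_triangle by simp
      moreover have "4 * (1/2)^(n + Suc m) = 2 * (1/2 :: real)^(n+m)" by simp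
      ultimately show ?case using Suc d(3)[of "n + m"] by linarith
    qed auto
    then have far': "dist (d n) (d m) \<le> 4 * (1/2)^n" if "n \<le> m" for n m
    proof -
      obtain j where "m = n + j" using \<open>n \<le> m\<close> le_Suc_ex by auto
      then have m: "m = n + j" .
      have "(0::real) \<le> 4 * (1/2)^(n+j)" by simp
      then show ?thesis using far[of n j] unfolding m by linarith
    qed
    have "Cauchy d"
    proof (rule metric_CauchyI)
      fix e :: real assume "e > 0"
      then obtain N where N: "(1/2)^N < e/8" using real_arch_pow_inv[of "e/8" "1/2"] by auto
      have "dist (d m) (d n) < e" if "m \<ge> N" "n \<ge> N" for m n
        using far'[OF that(1)] far'[OF that(2)] dist_triangle3[of "d m" "d n" "d N"] N by linarith
      then show "\<exists>M. \<forall>m\<ge>M. \<forall>n\<ge>M. dist (d m) (d n) < e" by blast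
    qed
    then obtain g where g: "d \<longlonglongrightarrow> g" using convergent_def Cauchy_convergent by blast
    have "\<forall>n. d n \<in> P" using d(1) D(2) by blast
    then have gP: "g \<in> P" using P g closed_sequentially by blast
    have dg: "dist (d n) g \<le> 4 * (1/2)^n" for n
    proof (rule LIMSEQ_le_const2)
      show "(\<lambda>m. dist (d n) (d m)) \<longlonglongrightarrow> dist (d n) g" using g by (intro tendsto_intros)
      show "\<exists>N. \<forall>m\<ge>N. dist (d n) (d m) \<le> 4 * (1/2)^n" using far' by blast
    qed
    have "dist (\<pi> g) x \<le> e" if e: "e > 0" for e
    proof -
      obtain \<delta> where \<delta>: "\<delta> > 0" "\<And>y. y \<in> P \<Longrightarrow> dist y g < \<delta> \<Longrightarrow> dist (\<pi> y) (\<pi> g) < e"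
        using \<pi>[unfolded continuous_on_iff, rule_format, OF gP e] by blast
      obtain n where n: "(1/2)^n < \<delta>/8" using real_arch_pow_inv[of "\<delta>/8" "1/2"] \<delta> by auto
      have "\<pi> ` U (d n) n \<subseteq> cball (\<pi> g) e"
      proof safe
        fix y assume y: "y \<in> U (d n) n"
        then have "dist y (d n) < (1/2)^n" unfolding U_def by (simp add: dist_commute)
        moreover have "(0::real) < (1/2)^n" by simp
        ultimately have "dist y g < \<delta>"
          using dg[of n] n dist_triangle[of y g "d n"] by linarith
        then show "\<pi> y \<in> cball (\<pi> g) e" using \<delta>(2)[of y] y unfolding U_def by (auto simp: dist_commute)
      qed
      then have "closure (\<pi> ` U (d n) n) \<subseteq> cball (\<pi> g) e" using closure_minimal closed_cball by blast
      then show ?thesis using B(3) d(2) by fastforce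
    qed
    then have "\<not> dist (\<pi> g) x > 0" by (meson dense leD)
    then have "\<pi> g = x" by simp
    then show "x \<in> \<pi> ` P" using gP by blast
  qed
  ultimately show ?thesis by auto
qed

section \<open>Orientation-preserving homeomorphisms form a closed group\<close>

abbreviation local_degree_map :: "(real ^ 3 \<Rightarrow> real ^ 3) \<Rightarrow> _" where
  "local_degree_map \<equiv> hom_induced 3 (euclidean :: (real ^ 3) topology) (- {0}) euclidean (- {0})"

abbreviation local_homology :: "((real ^ 3) chain set) set" where
  "local_homology \<equiv> carrier (relative_homology_group 3 (euclidean :: (real ^ 3) topology) (- {0}))"

text \<open>All invariance properties of the orientation below are instances of this one: the homotopy has to
keep the complement of the origin inside itself.\<close>

lemma local_degree_map_homotopy:
  fixes k :: "real \<Rightarrow> real ^ 3 \<Rightarrow> real ^ 3"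
  assumes "continuous_on ({0..1} \<times> UNIV) (\<lambda>(t, x). k t x)"
    and "\<And>t x. t \<in> {0..1} \<Longrightarrow> x \<noteq> 0 \<Longrightarrow> k t x \<noteq> 0"
  shows "local_degree_map (k 0) = local_degree_map (k 1)"
proof (rule homology_homotopy_axiom)
  have "continuous_map (prod_topology (top_of_set {0..1}) (euclidean :: (real ^ 3) topology)) euclidean (\<lambda>(t, x). k t x)"
    using assms(1) prod_topology_subtopology_eu[of "{0..1::real}" "UNIV :: (real ^ 3) set"]
    by (simp add: subtopology_UNIV)
  then show "homotopic_with (\<lambda>h. h \<in> - {0} \<rightarrow> - {0}) euclidean euclidean (k 0) (k 1)"
    unfolding homotopic_with_def using assms(2)
    by (intro exI[of _ "\<lambda>(t, x). k t x"]) auto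
qed

text \<open>The homotopies used below are radial and are singular at the origin, where the factor \<open>norm x\<close>
restores continuity.\<close>

lemma continuous_on_cone:
  fixes F :: "real \<Rightarrow> real ^ 3 \<Rightarrow> real ^ 3"
  assumes cont: "continuous_on ({0..1} \<times> (- {0})) (\<lambda>(t, x). F t x)"
    and bound: "\<And>t x. t \<in> {0..1} \<Longrightarrow> norm x \<le> 1 \<Longrightarrow> norm (F t x) \<le> B"
  shows "continuous_on ({0..1} \<times> UNIV) (\<lambda>(t, x). norm x *\<^sub>R F t x)"
  unfolding continuous_on_def
proof safe
  fix t :: real and x :: "real ^ 3" assume t: "t \<in> {0..1}"
  let ?S = "{0..1} \<times> (UNIV :: (real ^ 3) set)"
  show "((\<lambda>(t, x). norm x *\<^sub>R F t x) \<longlongrightarrow> norm x *\<^sub>R F t x) (at (t, x) within ?S)"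
  proof (cases "x = 0")
    case True
    have "((\<lambda>p. norm (snd p) * B) \<longlongrightarrow> norm (snd (t, x)) * B) (at (t, x) within ?S)"
      by (intro tendsto_intros)
    then have l: "((\<lambda>p. norm (snd p) * B) \<longlongrightarrow> 0) (at (t, x) within ?S)"
      using True by simp
    have "eventually (\<lambda>p. p \<in> UNIV \<times> ball 0 1) (nhds (t, x))"
      using True by (intro eventually_nhds_in_open open_Times) auto
    then have "eventually (\<lambda>p. norm ((\<lambda>(t, x). norm x *\<^sub>R F t x) p) \<le> norm (snd p) * B) (at (t, x) within ?S)"
      unfolding eventually_at_filter
      by eventually_elim (auto intro!: mult_left_mono bound)
    from Lim_null_comparison[OF this l] show ?thesis using True by simp
  next
    case False
    have "continuous_on ({0..1} \<times> (- {0})) (\<lambda>(t, x). norm x *\<^sub>R F t x)"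
      using continuous_on_scaleR[OF continuous_on_norm[OF continuous_on_snd[OF continuous_on_id]] cont]
      by (simp add: case_prod_unfold)
    then have "((\<lambda>(t, x). norm x *\<^sub>R F t x) \<longlongrightarrow> norm x *\<^sub>R F t x) (at (t, x) within {0..1} \<times> (- {0}))"
      using t False unfolding continuous_on_def by force
    moreover have "at (t, x) within ({0..1} \<times> (- {0})) = at (t, x) within ?S"
      by (rule at_within_nhd[of _ "UNIV \<times> (- {0})"]) (use False in \<open>auto intro: open_Times\<close>)
    ultimately show ?thesis by simp
  qed
qed

definition pointed :: "(real ^ 3 \<Rightarrow> real ^ 3) \<Rightarrow> bool" where
  "pointed \<phi> \<longleftrightarrow> continuous_on UNIV \<phi> \<and> (\<forall>x. \<phi> x = 0 \<longleftrightarrow> x = 0)"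

lemma bounded_image_cball:
  assumes "continuous_on UNIV (\<phi> :: real ^ 3 \<Rightarrow> real ^ 3)"
  obtains B where "\<And>x. norm x \<le> r \<Longrightarrow> norm (\<phi> x) \<le> B"
proof -
  have "compact (\<phi> ` cball 0 r)"
    using assms continuous_on_subset by (intro compact_continuous_image) auto
  then obtain B where "\<forall>y\<in>\<phi> ` cball 0 r. norm y \<le> B"
    using compact_imp_bounded bounded_iff by blast
  then show ?thesis by (intro that[of B]) auto
qed

text \<open>The action on local homology depends on the restriction to the unit sphere only. The homotopy has
two stages, because both multiplying by \<open>norm x\<close> and pushing the argument to the sphere at the same
time would be discontinuous at the origin.\<close>

lemma local_degree_map_cone:
  assumes "pointed \<phi>"
  shows "local_degree_map \<phi> = local_degree_map (\<lambda>x. norm x *\<^sub>R \<phi> (sgn x))"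
proof -
  have c: "continuous_on UNIV \<phi>" and z: "\<And>x. \<phi> x = 0 \<longleftrightarrow> x = 0"
    using assms by (auto simp: pointed_def)
  note c' = continuous_on_compose2[OF c]
  have "local_degree_map (\<lambda>x. (1 - 0 + 0 * norm x) *\<^sub>R \<phi> x) = local_degree_map (\<lambda>x. (1 - 1 + 1 * norm x) *\<^sub>R \<phi> x)"
  proof (rule local_degree_map_homotopy[of "\<lambda>t x. (1 - t + t * norm x) *\<^sub>R \<phi> x"])
    show "continuous_on ({0..1} \<times> UNIV) (\<lambda>(t, x). (1 - t + t * norm x) *\<^sub>R \<phi> x)"
      unfolding case_prod_unfold by (intro continuous_intros c') auto
    fix t :: real and x :: "real ^ 3" assume "t \<in> {0..1}" "x \<noteq> 0"
    then have "1 - t + t * norm x > 0"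
      by (cases "t = 1") (auto intro: add_pos_nonneg)
    then show "(1 - t + t * norm x) *\<^sub>R \<phi> x \<noteq> 0" using z \<open>x \<noteq> 0\<close> by auto
  qed
  then have 1: "local_degree_map \<phi> = local_degree_map (\<lambda>x. norm x *\<^sub>R \<phi> x)" by simp
  obtain B where B: "\<And>x. norm x \<le> 1 \<Longrightarrow> norm (\<phi> x) \<le> B" using bounded_image_cball[OF c] by blast
  have "local_degree_map (\<lambda>x. norm x *\<^sub>R \<phi> ((1 - 0) *\<^sub>R x + 0 *\<^sub>R sgn x)) =
        local_degree_map (\<lambda>x. norm x *\<^sub>R \<phi> ((1 - 1) *\<^sub>R x + 1 *\<^sub>R sgn x))"
  proof (rule local_degree_map_homotopy[of "\<lambda>t x. norm x *\<^sub>R \<phi> ((1 - t) *\<^sub>R x + t *\<^sub>R sgn x)"])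
    show "continuous_on ({0..1} \<times> UNIV) (\<lambda>(t, x). norm x *\<^sub>R \<phi> ((1 - t) *\<^sub>R x + t *\<^sub>R sgn x))"
    proof (rule continuous_on_cone)
      show "continuous_on ({0..1} \<times> - {0}) (\<lambda>(t, x). \<phi> ((1 - t) *\<^sub>R x + t *\<^sub>R sgn x))"
        unfolding case_prod_unfold by (intro continuous_intros c') auto
      fix t :: real and x :: "real ^ 3" assume t: "t \<in> {0..1}" and x: "norm x \<le> 1"
      have "norm ((1 - t) *\<^sub>R x + t *\<^sub>R sgn x) \<le> (1 - t) * norm x + t * norm (sgn x)"
        using t by (intro norm_triangle_le) auto
      also have "\<dots> \<le> (1 - t) * 1 + t * 1"
        using t x by (intro add_mono mult_left_mono) (auto simp: norm_sgn)
      finally show "norm (\<phi> ((1 - t) *\<^sub>R x + t *\<^sub>R sgn x)) \<le> B" using B by simp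
    qed
    fix t :: real and x :: "real ^ 3" assume t: "t \<in> {0..1}" and x: "x \<noteq> 0"
    have "(1 - t) *\<^sub>R x + t *\<^sub>R sgn x = (1 - t + t / norm x) *\<^sub>R x"
      by (simp add: sgn_div_norm scaleR_add_left divide_inverse)
    moreover have "1 - t + t / norm x > 0"
      using t x by (cases "t = 1") (auto intro: add_pos_nonneg)
    ultimately have "(1 - t) *\<^sub>R x + t *\<^sub>R sgn x \<noteq> 0" using x by simp
    then show "norm x *\<^sub>R \<phi> ((1 - t) *\<^sub>R x + t *\<^sub>R sgn x) \<noteq> 0" using z x by auto
  qed
  then show ?thesis using 1 by simp
qed

text \<open>After passing to cones, the straight-line homotopy avoids the origin as soon as it does so on the
unit sphere.\<close>

lemma local_degree_map_eq_if_close_on_sphere: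
  assumes p: "pointed \<phi>" "pointed \<psi>"
    and close: "\<And>x. norm x = 1 \<Longrightarrow> norm (\<psi> x - \<phi> x) < norm (\<phi> x)"
  shows "local_degree_map \<phi> = local_degree_map \<psi>"
proof -
  have c: "continuous_on UNIV \<phi>" "continuous_on UNIV \<psi>" using p by (auto simp: pointed_def)
  note c' = continuous_on_compose2[OF c(1)] continuous_on_compose2[OF c(2)]
  obtain B where B: "\<And>x. norm x \<le> 1 \<Longrightarrow> norm (\<phi> x) \<le> B" using bounded_image_cball[OF c(1)] by blast
  obtain C where C: "\<And>x. norm x \<le> 1 \<Longrightarrow> norm (\<psi> x - \<phi> x) \<le> C"
    using bounded_image_cball[OF continuous_on_diff[OF c(2) c(1)]] by blast
  have "local_degree_map (\<lambda>x. norm x *\<^sub>R (\<phi> (sgn x) + 0 *\<^sub>R (\<psi> (sgn x) - \<phi> (sgn x)))) =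
        local_degree_map (\<lambda>x. norm x *\<^sub>R (\<phi> (sgn x) + 1 *\<^sub>R (\<psi> (sgn x) - \<phi> (sgn x))))"
  proof (rule local_degree_map_homotopy[of "\<lambda>t x. norm x *\<^sub>R (\<phi> (sgn x) + t *\<^sub>R (\<psi> (sgn x) - \<phi> (sgn x)))"])
    show "continuous_on ({0..1} \<times> UNIV) (\<lambda>(t, x). norm x *\<^sub>R (\<phi> (sgn x) + t *\<^sub>R (\<psi> (sgn x) - \<phi> (sgn x))))"
    proof (rule continuous_on_cone)
      show "continuous_on ({0..1} \<times> - {0}) (\<lambda>(t, x). \<phi> (sgn x) + t *\<^sub>R (\<psi> (sgn x) - \<phi> (sgn x)))"
        unfolding case_prod_unfold by (intro continuous_intros c') auto
      fix t :: real and x :: "real ^ 3" assume t: "t \<in> {0..1}" and x: "norm x \<le> 1"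
      have s: "norm (sgn x) \<le> 1" by (simp add: norm_sgn)
      have "norm (t *\<^sub>R (\<psi> (sgn x) - \<phi> (sgn x))) \<le> 1 * C"
        unfolding norm_scaleR using t C[OF s] by (intro mult_mono) auto
      then show "norm (\<phi> (sgn x) + t *\<^sub>R (\<psi> (sgn x) - \<phi> (sgn x))) \<le> B + C"
        using B[OF s] by (intro norm_triangle_mono) auto
    qed
    fix t :: real and x :: "real ^ 3" assume t: "t \<in> {0..1}" and x: "x \<noteq> 0"
    have "norm (t *\<^sub>R (\<psi> (sgn x) - \<phi> (sgn x))) \<le> 1 * norm (\<psi> (sgn x) - \<phi> (sgn x))"
      unfolding norm_scaleR using t by (intro mult_right_mono) auto
    then have "norm (t *\<^sub>R (\<psi> (sgn x) - \<phi> (sgn x))) < norm (\<phi> (sgn x))"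
      using close[of "sgn x"] x by (simp add: norm_sgn)
    then have "\<phi> (sgn x) + t *\<^sub>R (\<psi> (sgn x) - \<phi> (sgn x)) \<noteq> 0"
      by (metis add_eq_0_iff norm_minus_cancel order_less_irrefl)
    then show "norm x *\<^sub>R (\<phi> (sgn x) + t *\<^sub>R (\<psi> (sgn x) - \<phi> (sgn x))) \<noteq> 0" using x by simp
  qed
  then show ?thesis
    using local_degree_map_cone[OF p(1)] local_degree_map_cone[OF p(2)] by simp
qed

abbreviation homeo :: "(real ^ 3 \<Rightarrow> real ^ 3) \<Rightarrow> (real ^ 3 \<Rightarrow> real ^ 3) \<Rightarrow> bool" where
  "homeo h g \<equiv> homeomorphism UNIV UNIV h g"

lemma homeo_inj: "homeo h g \<Longrightarrow> h x = h y \<longleftrightarrow> x = y"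
  unfolding homeomorphism_def by (metis UNIV_I)

lemma homeo_cont: "homeo h g \<Longrightarrow> continuous_on UNIV h"
  unfolding homeomorphism_def by blast

lemma pointed_homeo: "homeo h g \<Longrightarrow> pointed (\<lambda>x. h (x + a) - h a)"
proof -
  assume h: "homeo h g"
  have "continuous_on UNIV (\<lambda>x. h (x + a) - h a)"
    by (intro continuous_intros continuous_on_compose2[OF homeo_cont[OF h]]) auto
  then show ?thesis unfolding pointed_def using homeo_inj[OF h] by simp
qed

lemma pointed_homeo0: "homeo h g \<Longrightarrow> pointed (\<lambda>x. h x - h 0)"
  using pointed_homeo[of h g 0] by simp

text \<open>The base point at which the orientation is compared can be moved along a segment. This is what
makes the orientation behaviour multiplicative under composition.\<close>

lemma local_degree_map_translate:
  assumes "homeo h g"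
  shows "local_degree_map (\<lambda>x. h (x + a) - h a) = local_degree_map (\<lambda>x. h x - h 0)"
proof -
  have "local_degree_map (\<lambda>x. h (x + 0 *\<^sub>R a) - h (0 *\<^sub>R a)) = local_degree_map (\<lambda>x. h (x + 1 *\<^sub>R a) - h (1 *\<^sub>R a))"
  proof (rule local_degree_map_homotopy[of "\<lambda>t x. h (x + t *\<^sub>R a) - h (t *\<^sub>R a)"])
    show "continuous_on ({0..1} \<times> UNIV) (\<lambda>(t, x). h (x + t *\<^sub>R a) - h (t *\<^sub>R a))"
      unfolding case_prod_unfold
      by (intro continuous_intros continuous_on_compose2[OF homeo_cont[OF assms]]) auto
    show "h (x + t *\<^sub>R a) - h (t *\<^sub>R a) \<noteq> 0" if "x \<noteq> 0" for t x
      using that homeo_inj[OF assms] by simp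
  qed
  then show ?thesis by simp
qed

lemma local_degree_map_compose:
  assumes h: "homeo h g" and k: "homeo k l"
  shows "local_degree_map (\<lambda>x. k (h x) - k (h 0)) c =
    local_degree_map (\<lambda>x. k x - k 0) (local_degree_map (\<lambda>x. h x - h 0) c)"
proof -
  have p: "pointed (\<lambda>x. h x - h 0)" "pointed (\<lambda>x. k (x + h 0) - k (h 0))"
    using pointed_homeo0[OF h] pointed_homeo[OF k] by auto
  have "local_degree_map ((\<lambda>x. k (x + h 0) - k (h 0)) \<circ> (\<lambda>x. h x - h 0)) c =
     local_degree_map (\<lambda>x. k (x + h 0) - k (h 0)) (local_degree_map (\<lambda>x. h x - h 0) c)"
    by (rule hom_induced_compose'[symmetric]) (use p in \<open>auto simp: pointed_def\<close>)
  moreover have "(\<lambda>x. k (x + h 0) - k (h 0)) \<circ> (\<lambda>x. h x - h 0) = (\<lambda>x. k (h x) - k (h 0))"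
    by (simp add: comp_def)
  ultimately show ?thesis using local_degree_map_translate[OF k] by metis
qed

lemma orientation_preserving_iff:
  "homeo h g \<Longrightarrow> orientation_preserving_homeo h \<longleftrightarrow>
     (\<forall>c\<in>local_homology. local_degree_map (\<lambda>x. h x - h 0) c = c)"
  unfolding orientation_preserving_homeo_def by blast

lemma orientation_preserving_compose:
  assumes "orientation_preserving_homeo h" "orientation_preserving_homeo k"
  shows "orientation_preserving_homeo (k \<circ> h)"
proof -
  obtain g l where g: "homeo h g" and l: "homeo k l"
    using assms unfolding orientation_preserving_homeo_def by blast
  have "homeo (k \<circ> h) (g \<circ> l)" using homeomorphism_compose[OF g l] .
  then show ?thesis
    using assms orientation_preserving_iff[OF g] orientation_preserving_iff[OF l]
    by (simp add: orientation_preserving_iff local_degree_map_compose[OF g l])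
qed

lemma orientation_preserving_inverse:
  assumes h: "orientation_preserving_homeo h" and g: "homeo h g"
  shows "orientation_preserving_homeo g"
proof -
  have g': "homeo g h" using g by (rule homeomorphism_symD)
  have hg: "h (g x) = x" for x using g unfolding homeomorphism_def by blast
  have "local_degree_map (\<lambda>x. g x - g 0) c = c" if c: "c \<in> local_homology" for c
  proof -
    have "local_degree_map (\<lambda>x. g x - g 0) c \<in> local_homology"
      by (rule hom_carrier[OF hom_induced_hom, THEN subsetD]) (use c in blast)
    then have "local_degree_map (\<lambda>x. g x - g 0) c =
        local_degree_map (\<lambda>x. h x - h 0) (local_degree_map (\<lambda>x. g x - g 0) c)"
      using h orientation_preserving_iff[OF g] by simp
    also have "\<dots> = local_degree_map (\<lambda>x. x) c"
      using local_degree_map_compose[OF g' g, of c] hg by simp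
    also have "\<dots> = c" using hom_induced_id[OF c] by (simp add: id_def)
    finally show ?thesis .
  qed
  then show ?thesis using orientation_preserving_iff[OF g'] by blast
qed

text \<open>A homeomorphism moves the unit sphere a positive distance away from the image of the origin, so
a uniformly close one agrees with it in local homology.\<close>

lemma orientation_preserving_limit:
  assumes h: "\<And>n::nat. orientation_preserving_homeo (h n)"
    and lim: "uniform_limit (cball 0 1) h k sequentially" and k: "homeo k l"
  shows "orientation_preserving_homeo k"
proof -
  let ?n = "\<lambda>x. norm (k x - k 0)"
  have pk: "pointed (\<lambda>x. k x - k 0)" by (rule pointed_homeo0[OF k])
  have ne: "compact (sphere (0::real ^ 3) 1)" "sphere (0::real ^ 3) 1 \<noteq> {}" by auto
  have cn: "continuous_on (sphere 0 1) ?n"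
    using pk unfolding pointed_def by (intro continuous_on_norm) (auto intro: continuous_on_subset)
  obtain x0 where x0: "x0 \<in> sphere 0 1" "\<And>x. x \<in> sphere 0 1 \<Longrightarrow> ?n x0 \<le> ?n x"
    using continuous_attains_inf[OF ne cn] by blast
  have "x0 \<noteq> 0" using x0(1) by auto
  then have pos: "?n x0 > 0" using homeo_inj[OF k, of x0 0] by simp
  have "eventually (\<lambda>n. \<forall>x\<in>cball 0 1. dist (h n x) (k x) < ?n x0 / 2) sequentially"
    using lim pos by (intro uniform_limitD) auto
  then obtain n where "\<forall>x\<in>cball 0 1. dist (h n x) (k x) < ?n x0 / 2"
    using eventually_happens'[OF sequentially_bot] by blast
  then have n: "norm x \<le> 1 \<Longrightarrow> dist (h n x) (k x) < ?n x0 / 2" for x by simp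
  obtain g where g: "homeo (h n) g" using h unfolding orientation_preserving_homeo_def by blast
  have "local_degree_map (\<lambda>x. k x - k 0) = local_degree_map (\<lambda>x. h n x - h n 0)"
  proof (rule local_degree_map_eq_if_close_on_sphere[OF pk pointed_homeo0[OF g]])
    fix x :: "real ^ 3" assume x: "norm x = 1"
    have "norm ((h n x - h n 0) - (k x - k 0)) = norm ((h n x - k x) - (h n 0 - k 0))"
      by (simp add: algebra_simps)
    also have "\<dots> \<le> norm (h n x - k x) + norm (h n 0 - k 0)" by (rule norm_triangle_ineq4)
    also have "\<dots> < ?n x0" using n[of x] n[of 0] x by (simp add: dist_norm)
    also have "\<dots> \<le> ?n x" using x0 x by simp
    finally show "norm ((h n x - h n 0) - (k x - k 0)) < norm (k x - k 0)" .
  qed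
  then show ?thesis using h[of n] orientation_preserving_iff[OF g] orientation_preserving_iff[OF k] by simp
qed

text \<open>A perturbation of the identity with Lipschitz constant below 1 never cancels the identity, so it
can be switched on continuously.\<close>

lemma orientation_preserving_if_homotopic_id:
  assumes h: "homeo h g"
    and L: "L < 1" "\<And>x y. norm ((h x - x) - (h y - y)) \<le> L * norm (x - y)"
  shows "orientation_preserving_homeo h"
proof -
  have "local_degree_map (\<lambda>x. x + 0 *\<^sub>R ((h x - x) - (h 0 - 0))) = local_degree_map (\<lambda>x. x + 1 *\<^sub>R ((h x - x) - (h 0 - 0)))"
  proof (rule local_degree_map_homotopy[of "\<lambda>t x. x + t *\<^sub>R ((h x - x) - (h 0 - 0))"])
    show "continuous_on ({0..1} \<times> UNIV) (\<lambda>(t, x). x + t *\<^sub>R ((h x - x) - (h 0 - 0)))"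
      unfolding case_prod_unfold
      by (intro continuous_intros continuous_on_compose2[OF homeo_cont[OF h]]) auto
    fix t :: real and x :: "real ^ 3" assume t: "t \<in> {0..1}" and x: "x \<noteq> 0"
    have "norm (t *\<^sub>R ((h x - x) - (h 0 - 0))) \<le> 1 * (L * norm x)"
      unfolding norm_scaleR using t L(2)[of x 0] by (intro mult_mono) auto
    also have "\<dots> < norm x" using L x by simp
    finally show "x + t *\<^sub>R ((h x - x) - (h 0 - 0)) \<noteq> 0"
      by (metis add_eq_0_iff norm_minus_cancel order_less_irrefl)
  qed
  then have "local_degree_map (\<lambda>x. h x - h 0) = local_degree_map (\<lambda>x. x)" by simp
  then show ?thesis using orientation_preserving_iff[OF h] hom_induced_id[unfolded id_def] by metis
qed

section \<open>The Polish space of orientation-preserving homeomorphisms\<close>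

text \<open>Separability in a form that is inherited by subsets, finite products and sequence spaces without
choosing dense sets: for every \<open>e\<close>, countably many labels suffice to make equally labelled points
\<open>e\<close>-close.\<close>

definition small_parts :: "'p::metric_space set \<Rightarrow> bool" where
  "small_parts S \<longleftrightarrow> (\<forall>e>0. \<exists>L :: 'p \<Rightarrow> nat. \<forall>p\<in>S. \<forall>q\<in>S. L p = L q \<longrightarrow> dist p q < e)"

lemma small_parts_imp_separable:
  assumes "small_parts S"
  shows "\<exists>D. countable D \<and> D \<subseteq> S \<and> S \<subseteq> closure D"
proof -
  have "\<forall>m::nat. \<exists>L :: 'a \<Rightarrow> nat. \<forall>p\<in>S. \<forall>q\<in>S. L p = L q \<longrightarrow> dist p q < 1 / Suc m"
    using assms unfolding small_parts_def by simp
  then obtain L :: "nat \<Rightarrow> 'a \<Rightarrow> nat" where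
    L: "\<And>m p q. p \<in> S \<Longrightarrow> q \<in> S \<Longrightarrow> L m p = L m q \<Longrightarrow> dist p q < 1 / Suc m"
    by metis
  define c where "c = (\<lambda>m l. SOME p. p \<in> S \<and> L m p = l)"
  have c: "c m (L m p) \<in> S \<and> L m (c m (L m p)) = L m p" if "p \<in> S" for m p
    unfolding c_def by (rule someI[of _ p]) (use that in simp)
  define D where "D = (\<Union>m. c m ` L m ` S)"
  have "countable D" unfolding D_def by (intro countable_UN countable_image[OF countableI_type] countableI_type)
  moreover have "D \<subseteq> S" unfolding D_def using c by auto
  moreover have "S \<subseteq> closure D"
  proof
    fix p assume p: "p \<in> S"
    show "p \<in> closure D"
      unfolding closure_approachable
    proof (intro allI impI)
      fix e :: real assume "e > 0"
      then obtain m where m: "1 / real (Suc m) < e" using nat_approx_posE by metis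
      have "dist (c m (L m p)) p < 1 / Suc m" using c[OF p, of m] p by (intro L) auto
      moreover have "c m (L m p) \<in> D" unfolding D_def using p by blast
      ultimately show "\<exists>y\<in>D. dist y p < e" using m by (intro bexI[of _ "c m (L m p)"]) auto
    qed
  qed
  ultimately show ?thesis by blast
qed

lemma small_parts_subset: "small_parts S \<Longrightarrow> T \<subseteq> S \<Longrightarrow> small_parts T"
  unfolding small_parts_def by (meson subsetD)

lemma small_parts_Times:
  assumes "small_parts S" "small_parts T"
  shows "small_parts (S \<times> T)"
  unfolding small_parts_def
proof (intro allI impI)
  fix e :: real assume "e > 0"
  then have e: "e / 2 > 0" by simp
  obtain L :: "'a \<Rightarrow> nat" where L: "\<And>p q. p \<in> S \<Longrightarrow> q \<in> S \<Longrightarrow> L p = L q \<Longrightarrow> dist p q < e / 2"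
    using assms(1) e unfolding small_parts_def by blast
  obtain K :: "'b \<Rightarrow> nat" where K: "\<And>p q. p \<in> T \<Longrightarrow> q \<in> T \<Longrightarrow> K p = K q \<Longrightarrow> dist p q < e / 2"
    using assms(2) e unfolding small_parts_def by blast
  have "dist p q < e" if "p \<in> S \<times> T" "q \<in> S \<times> T"
    "prod_encode (L (fst p), K (snd p)) = prod_encode (L (fst q), K (snd q))" for p q
  proof -
    have "dist (fst p) (fst q) < e / 2" "dist (snd p) (snd q) < e / 2"
      by (rule L; use that in \<open>simp add: mem_Times_iff\<close>) (rule K; use that in \<open>simp add: mem_Times_iff\<close>)
    moreover have "dist p q \<le> dist (fst p) (fst q) + dist (snd p) (snd q)"
      unfolding dist_prod_def by (rule sqrt_sum_squares_le_sum) auto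
    ultimately show ?thesis by simp
  qed
  then show "\<exists>L :: 'a \<times> 'b \<Rightarrow> nat. \<forall>p\<in>S \<times> T. \<forall>q\<in>S \<times> T. L p = L q \<longrightarrow> dist p q < e"
    by (intro exI[of _ "\<lambda>p. prod_encode (L (fst p), K (snd p))"]) blast
qed

lemma small_parts_sequences:
  fixes S :: "nat \<Rightarrow> 'p::metric_space set"
  assumes "\<And>n. small_parts (S n)"
  shows "small_parts {p. \<forall>n. p n \<in> S n}"
  unfolding small_parts_def
proof (intro allI impI)
  fix e :: real assume "e > 0"
  then obtain N where N: "(1/2)^N < e / 2" using real_arch_pow_inv[of "e/2" "1/2"] by auto
  have "\<forall>n. \<exists>L :: 'p \<Rightarrow> nat. \<forall>p\<in>S n. \<forall>q\<in>S n. L p = L q \<longrightarrow> dist p q < e / 4"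
    using assms[unfolded small_parts_def, rule_format, of "e / 4"] \<open>e > 0\<close> by simp
  then obtain L :: "nat \<Rightarrow> 'p \<Rightarrow> nat" where
    L: "\<And>n p q. p \<in> S n \<Longrightarrow> q \<in> S n \<Longrightarrow> L n p = L n q \<Longrightarrow> dist p q < e / 4"
    by metis
  \<comment> \<open>The metric of the sequence space enumerates the coordinates by \<open>from_nat\<close>, which need not be
    the identity on the natural numbers.\<close>
  define K :: "(nat \<Rightarrow> 'p) \<Rightarrow> nat" where "K = (\<lambda>p. list_encode (map (\<lambda>n. L (from_nat n) (p (from_nat n))) [0..<Suc N]))"
  have "dist p q < e" if "\<forall>n. p n \<in> S n" "\<forall>n. q n \<in> S n" "K p = K q" for p q :: "nat \<Rightarrow> 'p"
  proof -
    have "map (\<lambda>n. L (from_nat n) (p (from_nat n))) [0..<Suc N] = map (\<lambda>n. L (from_nat n) (q (from_nat n))) [0..<Suc N]"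
      using that(3) unfolding K_def list_encode_eq .
    then have "L (from_nat n) (p (from_nat n)) = L (from_nat n) (q (from_nat n))" if "n \<le> N" for n
      using that unfolding map_eq_conv by auto
    then have "dist (p (from_nat n)) (q (from_nat n)) < e / 4" if "n \<le> N" for n
      using L \<open>\<forall>n. p n \<in> S n\<close> \<open>\<forall>n. q n \<in> S n\<close> that by blast
    then have "Max {dist (p (from_nat n)) (q (from_nat n))|n. n \<le> N} < e / 4"
      by (subst Max_less_iff) auto
    then show ?thesis
      using dist_fun_le_dist_first_terms[of p q N] N by linarith
  qed
  then show "\<exists>K :: (nat \<Rightarrow> 'p) \<Rightarrow> nat. \<forall>p\<in>{p. \<forall>n. p n \<in> S n}. \<forall>q\<in>{p. \<forall>n. p n \<in> S n}. K p = K q \<longrightarrow> dist p q < e"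
    by (intro exI[of _ K]) auto
qed

text \<open>A continuous map is encoded by its restrictions to the balls of radius \<open>n\<close>, each extended to a
bounded continuous function by the nearest-point retraction. Convergence of the codes is locally
uniform convergence, and the metric of the sequence space is complete.\<close>

definition restrict_balls :: "(real ^ 3 \<Rightarrow> real ^ 3) \<Rightarrow> nat \<Rightarrow> ((real ^ 3) \<Rightarrow>\<^sub>C (real ^ 3))" where
  "restrict_balls h n = Bcontfun (\<lambda>x. h (closest_point (cball 0 (real n)) x))"

lemma closest_point_cball: "norm (closest_point (cball 0 (real n)) (x :: real ^ 3)) \<le> real n"
  using closest_point_in_set[of "cball 0 (real n)" x] by simp

lemma restrict_balls_apply:
  assumes "continuous_on UNIV h"
  shows "apply_bcontfun (restrict_balls h n) x = h (closest_point (cball 0 (real n)) x)"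
proof -
  have "continuous_on UNIV (\<lambda>x :: real ^ 3. closest_point (cball 0 (real n)) x)"
    by (intro continuous_on_closest_point) auto
  then have "continuous_on UNIV (\<lambda>x. h (closest_point (cball 0 (real n)) x))"
    by (rule continuous_on_compose2[OF assms]) auto
  moreover have "bounded (range (\<lambda>x. h (closest_point (cball 0 (real n)) x)))"
  proof -
    have "bounded (h ` cball 0 (real n))"
      using assms by (intro compact_imp_bounded compact_continuous_image) (auto intro: continuous_on_subset)
    then show ?thesis by (rule bounded_subset) (use closest_point_cball in auto)
  qed
  ultimately show ?thesis unfolding restrict_balls_def by (simp add: Bcontfun_inverse bcontfun_def)
qed

lemma restrict_balls_apply_inside:
  assumes "continuous_on UNIV h" "norm x \<le> real n"
  shows "apply_bcontfun (restrict_balls h n) x = h x"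
  using restrict_balls_apply[OF assms(1)] assms(2) by (simp add: closest_point_self)

text \<open>The label of a function consists of a mesh size that is fine enough for its modulus of continuity,
and of approximate values, chosen in a fixed countable dense set, on a finite net of that mesh.\<close>

lemma small_parts_restrict_balls: "small_parts {restrict_balls h n | h. continuous_on UNIV h}"
  unfolding small_parts_def
proof (intro allI impI)
  fix e :: real assume e: "e > 0"
  let ?B = "cball (0 :: real ^ 3) (real n)"
  have "\<forall>m. \<exists>ts. set ts \<subseteq> ?B \<and> ?B \<subseteq> (\<Union>t\<in>set ts. ball t (1 / Suc m))"
  proof
    fix m
    have "\<exists>k. finite k \<and> k \<subseteq> ?B \<and> ?B \<subseteq> (\<Union>t\<in>k. ball t (1 / Suc m))"
      using seq_compact_imp_totally_bounded[of ?B] by (simp add: compact_imp_seq_compact)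
    then show "\<exists>ts. set ts \<subseteq> ?B \<and> ?B \<subseteq> (\<Union>t\<in>set ts. ball t (1 / Suc m))"
      using finite_list by metis
  qed
  then obtain ts where ts: "\<And>m. set (ts m) \<subseteq> ?B" "\<And>m. ?B \<subseteq> (\<Union>t\<in>set (ts m). ball t (1 / Suc m))"
    by metis
  obtain D :: "(real ^ 3) set" where "countable D \<and> (\<forall>X. open X \<longrightarrow> X \<noteq> {} \<longrightarrow> (\<exists>d\<in>D. d \<in> X))"
    using countable_dense_exists by blast
  then have D: "countable D" "\<And>X. open X \<Longrightarrow> X \<noteq> {} \<Longrightarrow> \<exists>d\<in>D. d \<in> X" by auto
  have "D \<noteq> {}" using D(2)[of UNIV] by auto
  have near: "\<exists>i. dist (from_nat_into D i) y < e / 8" for y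
  proof -
    obtain d where "d \<in> D" "d \<in> ball y (e / 8)" using D(2)[of "ball y (e / 8)"] e by auto
    then show ?thesis using from_nat_into_surj[OF D(1)] by (metis dist_commute mem_ball)
  qed
  define idx where "idx = (\<lambda>y. SOME i. dist (from_nat_into D i) y < e / 8)"
  have idx: "dist (from_nat_into D (idx y)) y < e / 8" for y
    unfolding idx_def by (rule someI_ex[OF near])
  have idx_eq: "dist y z < e / 4" if "idx y = idx z" for y z
    using idx[of y] idx[of z] that dist_triangle3[of y z "from_nat_into D (idx y)"] by simp
  define unif :: "((real ^ 3) \<Rightarrow>\<^sub>C (real ^ 3)) \<Rightarrow> nat \<Rightarrow> bool" where "unif = (\<lambda>p m. \<forall>x\<in>?B. \<forall>y\<in>?B. dist x y < 1 / Suc m \<longrightarrow>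
      dist (apply_bcontfun p x) (apply_bcontfun p y) < e / 8)"
  define m where "m = (\<lambda>p. SOME m. unif p m)"
  have unif: "unif p (m p)" for p
  proof -
    have "uniformly_continuous_on ?B (apply_bcontfun p)"
      by (intro compact_uniformly_continuous) auto
    then obtain d where d: "d > 0" "\<And>x y. x \<in> ?B \<Longrightarrow> y \<in> ?B \<Longrightarrow> dist x y < d \<Longrightarrow>
        dist (apply_bcontfun p x) (apply_bcontfun p y) < e / 8"
      unfolding uniformly_continuous_on_def using e by (metis divide_pos_pos zero_less_numeral)
    obtain k where "1 / real (Suc k) < d" using nat_approx_posE[OF d(1)] by metis
    then have "unif p k" unfolding unif_def using d(2) by auto
    then show ?thesis unfolding m_def by (rule someI)
  qed
  define L :: "((real ^ 3) \<Rightarrow>\<^sub>C (real ^ 3)) \<Rightarrow> nat" where "L = (\<lambda>p. prod_encode (m p, list_encode (map (\<lambda>t. idx (apply_bcontfun p t)) (ts (m p)))))"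
  have "dist p q < e" if pq: "p = restrict_balls h n" "continuous_on UNIV h" "q = restrict_balls k n" "continuous_on UNIV k"
    and eq: "L p = L q" for p q h k
  proof -
    have m: "m q = m p" using eq unfolding L_def by simp
    have "map (\<lambda>t. idx (apply_bcontfun p t)) (ts (m p)) = map (\<lambda>t. idx (apply_bcontfun q t)) (ts (m p))"
      using eq m unfolding L_def by (simp add: list_encode_eq)
    then have i: "idx (apply_bcontfun p t) = idx (apply_bcontfun q t)" if "t \<in> set (ts (m p))" for t
      using that unfolding map_eq_conv by blast
    have ball: "dist (apply_bcontfun p x) (apply_bcontfun q x) \<le> e / 2" if x: "x \<in> ?B" for x
    proof -
      obtain t where t: "t \<in> set (ts (m p))" "dist x t < 1 / Suc (m p)"
        using ts(2)[of "m p"] x by (force simp: dist_commute)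
      then have "t \<in> ?B" using ts(1) by blast
      then have "dist (apply_bcontfun p x) (apply_bcontfun p t) < e / 8" "dist (apply_bcontfun q x) (apply_bcontfun q t) < e / 8"
        using unif[of p] unif[of q] t(2) x unfolding unif_def m by blast+
      moreover have "dist (apply_bcontfun p t) (apply_bcontfun q t) < e / 4" using idx_eq i t(1) by blast
      ultimately show ?thesis
        using dist_triangle[of "apply_bcontfun p x" "apply_bcontfun q x" "apply_bcontfun p t"]
          dist_triangle2[of "apply_bcontfun p t" "apply_bcontfun q x" "apply_bcontfun q t"] by linarith
    qed
    have "dist p q \<le> e / 2"
    proof (rule dist_bound)
      fix x
      have "dist (apply_bcontfun p (closest_point ?B x)) (apply_bcontfun q (closest_point ?B x)) \<le> e / 2"
        by (rule ball) (use closest_point_cball in simp)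
      then show "dist (apply_bcontfun p x) (apply_bcontfun q x) \<le> e / 2"
        unfolding pq(1,3) restrict_balls_apply[OF pq(2)] restrict_balls_apply[OF pq(4)]
        by (simp add: closest_point_self closest_point_cball)
    qed
    then show ?thesis using e by simp
  qed
  then show "\<exists>L :: ((real ^ 3) \<Rightarrow>\<^sub>C (real ^ 3)) \<Rightarrow> nat. \<forall>p\<in>{restrict_balls h n | h. continuous_on UNIV h}.
      \<forall>q\<in>{restrict_balls h n | h. continuous_on UNIV h}. L p = L q \<longrightarrow> dist p q < e"
    by (intro exI[of _ L]) blast
qed

definition loc_unif :: "(nat \<Rightarrow> real ^ 3 \<Rightarrow> real ^ 3) \<Rightarrow> (real ^ 3 \<Rightarrow> real ^ 3) \<Rightarrow> bool" where
  "loc_unif h k \<longleftrightarrow> (\<forall>n::nat. uniform_limit (cball 0 (real n)) h k sequentially)"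

lemma tendsto_sequence_iff:
  fixes z :: "nat \<Rightarrow> nat \<Rightarrow> 'p::metric_space"
  shows "z \<longlonglongrightarrow> a \<longleftrightarrow> (\<forall>n. (\<lambda>k. z k n) \<longlonglongrightarrow> a n)"
  using limitin_componentwise[of "\<lambda>_. euclidean" UNIV z a sequentially]
  by (simp add: euclidean_product_topology)

lemma restrict_balls_tendsto_iff:
  assumes h: "\<And>k. continuous_on UNIV (h k)" and l: "continuous_on UNIV l"
  shows "(\<lambda>k. restrict_balls (h k)) \<longlonglongrightarrow> restrict_balls l \<longleftrightarrow> loc_unif h l"
proof -
  have "(\<lambda>k. restrict_balls (h k) n) \<longlonglongrightarrow> restrict_balls l n \<longleftrightarrow>
      uniform_limit (cball 0 (real n)) h l sequentially" for n
  proof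
    assume "(\<lambda>k. restrict_balls (h k) n) \<longlonglongrightarrow> restrict_balls l n"
    then have "uniform_limit UNIV (\<lambda>k. apply_bcontfun (restrict_balls (h k) n)) (apply_bcontfun (restrict_balls l n)) sequentially"
      by (rule tendsto_bcontfun_uniform_limit)
    then have u: "uniform_limit (cball 0 (real n)) (\<lambda>k. apply_bcontfun (restrict_balls (h k) n)) (apply_bcontfun (restrict_balls l n)) sequentially"
      by (rule uniform_limit_on_subset) auto
    show "uniform_limit (cball 0 (real n)) h l sequentially"
      using u by (rule uniform_limit_cong'[THEN iffD1, rotated -1])
        (auto simp: restrict_balls_apply_inside[OF h] restrict_balls_apply_inside[OF l])
  next
    assume "uniform_limit (cball 0 (real n)) h l sequentially"
    then have "uniform_limit UNIV (\<lambda>k x. h k (closest_point (cball 0 (real n)) x))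
        (\<lambda>x. l (closest_point (cball 0 (real n)) x)) sequentially"
      by (rule uniform_limit_compose') (use closest_point_cball in auto)
    moreover have "apply_bcontfun (restrict_balls u n) = (\<lambda>x. u (closest_point (cball 0 (real n)) x))"
      if "continuous_on UNIV u" for u
      using restrict_balls_apply[OF that] by (rule ext)
    ultimately show "(\<lambda>k. restrict_balls (h k) n) \<longlonglongrightarrow> restrict_balls l n"
      using h l by (intro uniform_limit_tendsto_bcontfun) simp
  qed
  then show ?thesis unfolding loc_unif_def by (subst tendsto_sequence_iff) simp
qed

text \<open>The limits over the different balls are compatible, since they are pointwise limits of the same
maps; hence they glue to a continuous map.\<close>

lemma restrict_balls_limit:
  assumes h: "\<And>k. continuous_on UNIV (h k)" and lim: "(\<lambda>k. restrict_balls (h k)) \<longlonglongrightarrow> a"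
  shows "\<exists>l. continuous_on UNIV l \<and> a = restrict_balls l"
proof -
  have an: "(\<lambda>k. apply_bcontfun (restrict_balls (h k) n) x) \<longlonglongrightarrow> apply_bcontfun (a n) x" for n x
  proof -
    have "(\<lambda>k. restrict_balls (h k) n) \<longlonglongrightarrow> a n"
      using iffD1[OF tendsto_sequence_iff lim] by blast
    then have "uniform_limit UNIV (\<lambda>k. apply_bcontfun (restrict_balls (h k) n)) (apply_bcontfun (a n)) sequentially"
      by (rule tendsto_bcontfun_uniform_limit)
    then show ?thesis by (rule tendsto_uniform_limitI) simp
  qed
  define l where "l = (\<lambda>x :: real ^ 3. apply_bcontfun (a (nat \<lceil>norm x\<rceil>)) x)"
  have hl: "(\<lambda>k. h k x) \<longlonglongrightarrow> l x" for x
  proof -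
    have "norm x \<le> real (nat \<lceil>norm x\<rceil>)" by linarith
    then show ?thesis using an[of "nat \<lceil>norm x\<rceil>" x] unfolding l_def
      by (simp add: restrict_balls_apply_inside[OF h])
  qed
  have al: "apply_bcontfun (a n) x = l (closest_point (cball 0 (real n)) x)" for n x
  proof (rule LIMSEQ_unique[OF an])
    show "(\<lambda>k. apply_bcontfun (restrict_balls (h k) n) x) \<longlonglongrightarrow> l (closest_point (cball 0 (real n)) x)"
      using hl by (simp add: restrict_balls_apply[OF h])
  qed
  have cont: "continuous_on UNIV l"
  proof (rule continuous_at_imp_continuous_on, safe)
    fix x :: "real ^ 3"
    obtain n :: nat where n: "norm x < real n" using reals_Archimedean2 by blast
    have "continuous_on (ball 0 (real n)) l"
      by (rule continuous_on_cong[THEN iffD1, OF refl _ continuous_on_apply_bcontfun[of _ "a n"]])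
        (simp add: al closest_point_self)
    then show "isCont l x" using n by (auto simp: continuous_on_eq_continuous_at)
  qed
  moreover have "a = restrict_balls l"
    by (rule ext, rule bcontfun_eqI) (simp add: al restrict_balls_apply[OF cont])
  ultimately show ?thesis by blast
qed

text \<open>Locally uniform convergence is continuous convergence. It carries the identities \<open>h \<circ> g = id\<close> and
\<open>g \<circ> h = id\<close> over to limits.\<close>

lemma loc_unif_tendsto:
  assumes u: "loc_unif h l" and l: "continuous_on UNIV l" and y: "y \<longlonglongrightarrow> y0"
  shows "(\<lambda>k. h k (y k)) \<longlonglongrightarrow> l y0"
proof -
  obtain B where B: "\<And>k. norm (y k) \<le> B" using convergent_imp_Bseq[of y] y unfolding convergent_def Bseq_def by blast
  obtain n :: nat where n: "B \<le> real n" using real_arch_simple by blast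
  have "uniform_limit (cball 0 (real n)) h l sequentially" using u unfolding loc_unif_def by blast
  note un = this
  have ly: "(\<lambda>k. l (y k)) \<longlonglongrightarrow> l y0"
    by (rule continuous_on_tendsto_compose[OF l y]) auto
  show ?thesis
  proof (rule tendstoI)
    fix e :: real assume "e > 0"
    then have e: "e / 2 > 0" by simp
    show "eventually (\<lambda>k. dist (h k (y k)) (l y0) < e) sequentially"
      using uniform_limitD[OF un e] tendstoD[OF ly e]
    proof eventually_elim
      case (elim k)
      have "y k \<in> cball 0 (real n)" using order_trans[OF B n] by simp
      then show ?case using elim dist_triangle_half_l[of "h k (y k)" "l (y k)" e "l y0"]
        by (simp add: dist_commute)
    qed
  qed
qed

lemma loc_unif_compose_right:
  assumes "loc_unif h l" "continuous_on UNIV s"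
  shows "loc_unif (\<lambda>k. h k \<circ> s) (l \<circ> s)"
  unfolding loc_unif_def
proof
  fix n :: nat
  obtain B where B: "\<And>x. norm x \<le> real n \<Longrightarrow> norm (s x) \<le> B" using bounded_image_cball[OF assms(2)] by blast
  obtain m :: nat where m: "B \<le> real m" using real_arch_simple by blast
  have "s \<in> cball 0 (real n) \<rightarrow> cball 0 (real m)"
    using order_trans[OF B m] by auto
  from uniform_limit_compose'[OF _ this] show "uniform_limit (cball 0 (real n)) (\<lambda>k. h k \<circ> s) (l \<circ> s) sequentially"
    using assms(1) unfolding loc_unif_def comp_def by blast
qed

lemma loc_unif_compose_left:
  assumes "loc_unif h l" "continuous_on UNIV l" "continuous_on UNIV s"
  shows "loc_unif (\<lambda>k. s \<circ> h k) (s \<circ> l)"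
  unfolding loc_unif_def
proof
  fix n :: nat
  obtain B where B: "\<And>x. norm x \<le> real n \<Longrightarrow> norm (l x) \<le> B" using bounded_image_cball[OF assms(2)] by blast
  have u: "uniform_limit (cball 0 (real n)) h l sequentially" using assms(1) unfolding loc_unif_def by blast
  have "uniform_limit (cball 0 (real n)) (\<lambda>k x. s (h k x)) (\<lambda>x. s (l x)) sequentially"
  proof (rule uniform_limit_compose_uniformly_continuous_on[OF u])
    show "uniformly_continuous_on (cball 0 (B + 1)) s"
      using assms(3) by (intro compact_uniformly_continuous) (auto intro: continuous_on_subset)
    have "eventually (\<lambda>k. \<forall>x\<in>cball 0 (real n). dist (h k x) (l x) < 1) sequentially"
      using u by (rule uniform_limitD) auto
    then show "eventually (\<lambda>k. \<forall>y\<in>cball 0 (real n). h k y \<in> cball 0 (B + 1)) sequentially"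
    proof eventually_elim
      case (elim k)
      have "norm (h k y) \<le> B + 1" if "norm y \<le> real n" for y
      proof -
        have "norm (h k y - l y) < 1" using elim that by (simp add: dist_norm)
        then show ?thesis using B[OF that] norm_triangle_sub[of "h k y" "l y"] by linarith
      qed
      then show ?case by simp
    qed
  qed simp
  then show "uniform_limit (cball 0 (real n)) (\<lambda>k. s \<circ> h k) (s \<circ> l) sequentially"
    by (simp add: comp_def)
qed

type_synonym homeo_code = "(nat \<Rightarrow> ((real ^ 3) \<Rightarrow>\<^sub>C (real ^ 3))) \<times> (nat \<Rightarrow> ((real ^ 3) \<Rightarrow>\<^sub>C (real ^ 3)))"

text \<open>A homeomorphism is stored together with its inverse: a locally uniform limit of homeomorphisms
need not be injective, but if the inverses converge as well, then it is a homeomorphism.\<close>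

definition homeo_codes :: "homeo_code set" where
  "homeo_codes = {(restrict_balls h, restrict_balls g) | h g. homeo h g \<and> orientation_preserving_homeo h}"

lemma homeo_conts: assumes "homeo h g" shows "continuous_on UNIV h" "continuous_on UNIV g"
  using assms unfolding homeomorphism_def by blast+

lemma homeo_inverses: assumes "homeo h g" shows "h (g x) = x" "g (h x) = x"
  using assms unfolding homeomorphism_def by blast+

lemma homeoI:
  assumes "continuous_on UNIV h" "continuous_on UNIV g" "\<And>x. h (g x) = x" "\<And>x. g (h x) = x"
  shows "homeo h g"
  using assms by (intro homeomorphismI) auto

lemma separable_homeo_codes: "\<exists>D. countable D \<and> D \<subseteq> homeo_codes \<and> homeo_codes \<subseteq> closure D"
proof -
  let ?S = "{p. \<forall>n. p n \<in> {restrict_balls h n | h. continuous_on UNIV h}}"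
  have "small_parts (?S \<times> ?S)"
    by (intro small_parts_Times small_parts_sequences small_parts_restrict_balls)
  moreover have "homeo_codes \<subseteq> ?S \<times> ?S"
    unfolding homeo_codes_def using homeo_conts by blast
  ultimately show ?thesis by (rule small_parts_imp_separable[OF small_parts_subset])
qed

lemma closed_homeo_codes: "closed homeo_codes"
  unfolding closed_sequential_limits
proof (intro allI impI, elim conjE)
  fix z :: "nat \<Rightarrow> homeo_code" and c assume z: "\<forall>k. z k \<in> homeo_codes" and c: "z \<longlonglongrightarrow> c"
  have "\<forall>k. \<exists>h g. z k = (restrict_balls h, restrict_balls g) \<and> homeo h g \<and> orientation_preserving_homeo h"
    using z unfolding homeo_codes_def by blast
  then obtain h g where zk: "\<And>k. z k = (restrict_balls (h k), restrict_balls (g k))"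
    and hg: "\<And>k. homeo (h k) (g k)" and op: "\<And>k. orientation_preserving_homeo (h k)"
    by metis
  have ch: "continuous_on UNIV (h k)" and cg: "continuous_on UNIV (g k)" for k using homeo_conts[OF hg] by auto
  have lims: "(\<lambda>k. restrict_balls (h k)) \<longlonglongrightarrow> fst c" "(\<lambda>k. restrict_balls (g k)) \<longlonglongrightarrow> snd c"
    using tendsto_fst[OF c] tendsto_snd[OF c] zk by simp_all
  obtain h0 where h0: "continuous_on UNIV h0" "fst c = restrict_balls h0" using restrict_balls_limit[OF ch lims(1)] by blast
  obtain g0 where g0: "continuous_on UNIV g0" "snd c = restrict_balls g0" using restrict_balls_limit[OF cg lims(2)] by blast
  have uh: "loc_unif h h0" using lims(1) restrict_balls_tendsto_iff[OF ch h0(1)] h0(2) by simp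
  have ug: "loc_unif g g0" using lims(2) restrict_balls_tendsto_iff[OF cg g0(1)] g0(2) by simp
  have "h0 (g0 x) = x" for x
    using LIMSEQ_unique[OF loc_unif_tendsto[OF uh h0(1) loc_unif_tendsto[OF ug g0(1) tendsto_const[of x]]]]
      homeo_inverses[OF hg] by simp
  moreover have "g0 (h0 x) = x" for x
    using LIMSEQ_unique[OF loc_unif_tendsto[OF ug g0(1) loc_unif_tendsto[OF uh h0(1) tendsto_const[of x]]]]
      homeo_inverses[OF hg] by simp
  ultimately have hom: "homeo h0 g0" using h0 g0 by (intro homeoI) auto
  have "uniform_limit (cball 0 1) h h0 sequentially" using uh unfolding loc_unif_def by (metis of_nat_1)
  then have "orientation_preserving_homeo h0" by (rule orientation_preserving_limit[OF op _ hom])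
  then show "c \<in> homeo_codes" unfolding homeo_codes_def using hom h0(2) g0(2) by (metis (mono_tags, lifting) mem_Collect_eq prod.collapse)
qed

section \<open>Measurability of the knot type\<close>

lemma abs_infdist_image_le:
  fixes a b :: "real ^ 3 \<Rightarrow> real ^ 3"
  assumes "F \<noteq> {}" "\<And>x. x \<in> F \<Longrightarrow> dist (a x) (b x) \<le> e"
  shows "\<bar>infdist y (a ` F) - infdist y (b ` F)\<bar> \<le> e"
proof -
  have le: "infdist y (a ` F) \<le> infdist y (b ` F) + e"
    if d: "\<And>x. x \<in> F \<Longrightarrow> dist (a x) (b x) \<le> e" for a b :: "real ^ 3 \<Rightarrow> real ^ 3"
  proof -
    have "infdist y (a ` F) - e \<le> dist y z" if z: "z \<in> b ` F" for z
    proof -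
      obtain x where x: "x \<in> F" "z = b x" using z by blast
      have "infdist y (a ` F) \<le> dist y (a x)" using x(1) by (intro infdist_le) auto
      also have "\<dots> \<le> dist y z + dist (a x) z" by (rule dist_triangle2)
      finally show ?thesis using d[OF x(1)] x(2) by simp
    qed
    then have "infdist y (a ` F) - e \<le> infdist y (b ` F)"
      using assms(1) by (subst infdist_notempty) (auto intro: cINF_greatest)
    then show ?thesis by simp
  qed
  have "dist (b x) (a x) \<le> e" if "x \<in> F" for x using assms(2)[OF that] by (simp add: dist_commute)
  then show ?thesis using le[of a b] le[of b a] assms(2) by fastforce
qed

text \<open>A closed set is represented by its distances to a dense sequence of points. This makes the images
of a compact set points of a countable product of real lines, where the Borel sets are generated
by the coordinates.\<close>

definition distances :: "(nat \<Rightarrow> real ^ 3) \<Rightarrow> (real ^ 3) set \<Rightarrow> nat \<Rightarrow> real" where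
  "distances q K = (\<lambda>i. infdist (q i) K)"

lemma distances_inj:
  assumes q: "\<And>y e. e > 0 \<Longrightarrow> \<exists>i. dist (q i) y < e"
    and K: "closed K" "K \<noteq> {}" "closed L" "L \<noteq> {}" and eq: "distances q K = distances q L"
  shows "K = L"
proof -
  have le: "infdist y K \<le> infdist y L" if eq: "distances q K = distances q L" for y K L
  proof (rule field_le_epsilon)
    fix e :: real assume "e > 0"
    then obtain i where i: "dist (q i) y < e / 2" using q[of "e / 2"] by auto
    have "infdist (q i) K = infdist (q i) L" using eq unfolding distances_def by (rule fun_cong)
    then show "infdist y K \<le> infdist y L + e"
      using infdist_triangle[of y K "q i"] infdist_triangle[of "q i" L y] i by (simp add: dist_commute)
  qed
  have "infdist y K = infdist y L" for y using le[OF eq] le[OF eq[symmetric]] by (rule antisym)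
  then show ?thesis
    using in_closed_iff_infdist_zero[OF K(1,2)] in_closed_iff_infdist_zero[OF K(3,4)] by auto
qed

text \<open>The fibres of the map sending \<open>(h, g)\<close> to \<open>g ` F\<close> are cosets of the stabilizer of \<open>F\<close>. If
\<open>g1 ` F = g2 ` F\<close>, then \<open>s = h2 \<circ> g1\<close> maps \<open>F\<close> onto itself, and right translation by \<open>s\<close> is a
continuous self-map of the group that preserves the fibres and moves \<open>g2\<close> to \<open>g1\<close>. This gives the
lifting of convergent sequences that makes the image Borel.\<close>

theorem homeomorphic_copies_borel:
  fixes q :: "nat \<Rightarrow> real ^ 3"
  assumes F: "compact F" "F \<noteq> {}" and q: "\<And>y e. e > 0 \<Longrightarrow> \<exists>i. dist (q i) y < e"
  shows "{distances q (g ` F) | h g. homeo h g \<and> orientation_preserving_homeo h} \<in> sets borel"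
proof -
  obtain B where B: "\<And>x. x \<in> F \<Longrightarrow> norm x \<le> B" using compact_imp_bounded[OF F(1)] unfolding bounded_iff by blast
  obtain N :: nat where N: "B \<le> real N" using real_arch_simple by blast
  have FN: "norm x \<le> real N" if "x \<in> F" for x using order_trans[OF B[OF that] N] .
  define \<pi> where "\<pi> = (\<lambda>c :: homeo_code. distances q (apply_bcontfun (snd c N) ` F))"
  have \<pi>: "\<pi> (restrict_balls h, restrict_balls g) = distances q (g ` F)" if "homeo h g" for h g
  proof -
    have "apply_bcontfun (restrict_balls g N) ` F = g ` F"
      using FN restrict_balls_apply_inside[OF homeo_conts(2)[OF that]] by (auto simp: image_iff)
    then show ?thesis unfolding \<pi>_def by simp
  qed
  have "\<pi> ` homeo_codes \<in> sets borel"
  proof -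
    obtain D where D: "countable D" "D \<subseteq> homeo_codes" "homeo_codes \<subseteq> closure D"
      using separable_homeo_codes by blast
    show ?thesis
    proof (rule image_in_borel_if_fibres_homogeneous[OF closed_homeo_codes D])
      have "continuous_on homeo_codes (\<lambda>c. \<pi> c i)" for i
      proof (rule continuous_on_sequentiallyI)
        fix u :: "nat \<Rightarrow> homeo_code" and a assume u: "u \<longlonglongrightarrow> a"
        have "(\<lambda>k. snd (u k)) \<longlonglongrightarrow> snd a" using u by (rule tendsto_snd)
        then have l: "(\<lambda>k. snd (u k) N) \<longlonglongrightarrow> snd a N" using iffD1[OF tendsto_sequence_iff] by blast
        have "dist (\<pi> (u k) i) (\<pi> a i) \<le> dist (snd (u k) N) (snd a N)" for k
          unfolding \<pi>_def distances_def dist_real_def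
          by (rule abs_infdist_image_le[OF F(2)]) (rule dist_bounded)
        then show "(\<lambda>k. \<pi> (u k) i) \<longlonglongrightarrow> \<pi> a i"
          using l by (intro metric_tendsto_imp_tendsto[OF l]) auto
      qed
      then show "continuous_on homeo_codes \<pi>" by (rule continuous_on_coordinatewise_then_product)
    next
      fix c d and z :: "nat \<Rightarrow> homeo_code"
      assume c: "c \<in> homeo_codes" and d: "d \<in> homeo_codes" and cd: "\<pi> c = \<pi> d"
        and z: "\<And>n. z n \<in> homeo_codes" and lim: "z \<longlonglongrightarrow> d"
      obtain h1 g1 where 1: "c = (restrict_balls h1, restrict_balls g1)" "homeo h1 g1" "orientation_preserving_homeo h1"
        using c unfolding homeo_codes_def by blast
      obtain h2 g2 where 2: "d = (restrict_balls h2, restrict_balls g2)" "homeo h2 g2" "orientation_preserving_homeo h2"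
        using d unfolding homeo_codes_def by blast
      have "\<forall>k. \<exists>h g. z k = (restrict_balls h, restrict_balls g) \<and> homeo h g \<and> orientation_preserving_homeo h"
        using z unfolding homeo_codes_def by blast
      then obtain h g where zk: "\<And>k. z k = (restrict_balls (h k), restrict_balls (g k))"
        and hg: "\<And>k. homeo (h k) (g k)" and op: "\<And>k. orientation_preserving_homeo (h k)"
        by metis
      note conts = homeo_conts[OF hg] homeo_conts[OF 1(2)] homeo_conts[OF 2(2)]
      note invs = homeo_inverses[OF hg] homeo_inverses[OF 1(2)] homeo_inverses[OF 2(2)]
      have clim: "(\<lambda>k. restrict_balls (h k)) \<longlonglongrightarrow> restrict_balls h2" "(\<lambda>k. restrict_balls (g k)) \<longlonglongrightarrow> restrict_balls g2"
        using tendsto_fst[OF lim] tendsto_snd[OF lim] zk 2(1) by simp_all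
      have u: "loc_unif h h2" "loc_unif g g2"
        using clim restrict_balls_tendsto_iff[OF conts(1) conts(5)] restrict_balls_tendsto_iff[OF conts(2) conts(6)] by simp_all
      have img: "g1 ` F = g2 ` F"
      proof (rule distances_inj[OF q])
        show "distances q (g1 ` F) = distances q (g2 ` F)" using cd 1 2 \<pi> by simp
        show "closed (g1 ` F)" "closed (g2 ` F)"
          using F(1) conts by (auto intro!: compact_imp_closed compact_continuous_image intro: continuous_on_subset)
      qed (use F in auto)
      define s where "s = h2 \<circ> g1"
      define s' where "s' = h1 \<circ> g2"
      have ss: "s (s' x) = x" "s' (s x) = x" for x unfolding s_def s'_def using invs by simp_all
      have cs: "continuous_on UNIV s" "continuous_on UNIV s'"
        unfolding s_def s'_def comp_def
        by (rule continuous_on_compose2[OF conts(5) conts(4)], simp)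
          (rule continuous_on_compose2[OF conts(3) conts(6)], simp)
      have sF: "s ` F = F"
      proof -
        have "s ` F = h2 ` g2 ` F" unfolding s_def image_comp[symmetric] img ..
        then show ?thesis using invs by (simp add: image_image)
      qed
      define w where "w = (\<lambda>k. (restrict_balls (s' \<circ> h k), restrict_balls (g k \<circ> s)))"
      have hw: "homeo (s' \<circ> h k) (g k \<circ> s)" for k
      proof (rule homeoI)
        show "continuous_on UNIV (s' \<circ> h k)" "continuous_on UNIV (g k \<circ> s)"
          unfolding comp_def
          by (rule continuous_on_compose2[OF cs(2) conts(1)], simp)
            (rule continuous_on_compose2[OF conts(2) cs(1)], simp)
      qed (use ss invs in auto)
      have "orientation_preserving_homeo s'"
        unfolding s'_def by (intro orientation_preserving_compose orientation_preserving_inverse[OF 2(3,2)] 1)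
      then have "orientation_preserving_homeo (s' \<circ> h k)" for k
        using op by (intro orientation_preserving_compose)
      then have "w k \<in> homeo_codes" for k
        unfolding w_def homeo_codes_def using hw by blast
      moreover have "\<pi> (w k) = \<pi> (z k)" for k
        unfolding w_def zk \<pi>[OF hw] \<pi>[OF hg] using sF by (metis image_comp)
      moreover have "w \<longlonglongrightarrow> c"
      proof -
        have "loc_unif (\<lambda>k. s' \<circ> h k) (s' \<circ> h2)" by (rule loc_unif_compose_left[OF u(1) conts(5) cs(2)])
        moreover have "s' \<circ> h2 = h1" unfolding s'_def using invs by (auto simp: fun_eq_iff)
        ultimately have "(\<lambda>k. restrict_balls (s' \<circ> h k)) \<longlonglongrightarrow> restrict_balls h1"
          using restrict_balls_tendsto_iff[OF homeo_conts(1)[OF hw] conts(3)] by simp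
        moreover have "loc_unif (\<lambda>k. g k \<circ> s) (g2 \<circ> s)" by (rule loc_unif_compose_right[OF u(2) cs(1)])
        then have "(\<lambda>k. restrict_balls (g k \<circ> s)) \<longlonglongrightarrow> restrict_balls g1"
          using restrict_balls_tendsto_iff[OF homeo_conts(2)[OF hw] conts(4)] invs
          unfolding s_def by (simp add: fun_eq_iff comp_def)
        ultimately show ?thesis unfolding w_def 1(1) by (rule tendsto_Pair)
      qed
      ultimately show "\<exists>w. (\<forall>n. w n \<in> homeo_codes \<and> \<pi> (w n) = \<pi> (z n)) \<and> w \<longlonglongrightarrow> c" by blast
    qed
  qed
  also have "\<pi> ` homeo_codes = {distances q (g ` F) | h g. homeo h g \<and> orientation_preserving_homeo h}"
    unfolding homeo_codes_def using \<pi> by (auto simp: image_iff) (metis \<pi>)+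
  finally show ?thesis .
qed

lemma dense_sequence: "\<exists>q :: nat \<Rightarrow> real ^ 3. \<forall>y e. e > 0 \<longrightarrow> (\<exists>i. dist (q i) y < e)"
proof -
  obtain D :: "(real ^ 3) set" where "countable D \<and> (\<forall>X. open X \<longrightarrow> X \<noteq> {} \<longrightarrow> (\<exists>d\<in>D. d \<in> X))"
    using countable_dense_exists by blast
  then have D: "countable D" "\<And>X. open X \<Longrightarrow> X \<noteq> {} \<Longrightarrow> \<exists>d\<in>D. d \<in> X" by auto
  have "\<exists>i. dist (from_nat_into D i) y < e" if "e > 0" for y e
  proof -
    obtain d where "d \<in> D" "d \<in> ball y e" using D(2)[of "ball y e"] \<open>e > 0\<close> by auto
    then show ?thesis using from_nat_into_surj[OF D(1)] by (metis dist_commute mem_ball)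
  qed
  then show ?thesis by blast
qed

lemma dense_points_of_interval:
  obtains T where "countable T" "T \<subseteq> {0..2 * pi}" "{0..2 * pi} \<subseteq> closure T"
  using separable[of "{0..2 * pi}"] by metis

text \<open>By compactness, a closed curve is injective iff for each \<open>k\<close> the distance between its points is
bounded below on all pairs of parameters that are further than \<open>1/(k+1)\<close> apart modulo \<open>2 * pi\<close>. Such a
bound can be tested on a countable dense set of parameters.\<close>

lemma measurable_simple_curves:
  fixes \<gamma> :: "'w \<Rightarrow> real \<Rightarrow> real ^ 3"
  assumes meas: "\<And>t. (\<lambda>\<omega>. \<gamma> \<omega> t) \<in> borel_measurable M"
    and cont: "\<And>\<omega>. \<omega> \<in> space M \<Longrightarrow> continuous_on {0..2 * pi} (\<gamma> \<omega>)"
    and closed: "\<And>\<omega>. \<omega> \<in> space M \<Longrightarrow> \<gamma> \<omega> 0 = \<gamma> \<omega> (2 * pi)"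
  shows "{\<omega> \<in> space M. inj_on (\<gamma> \<omega>) {0..<2 * pi}} \<in> sets M"
proof -
  let ?I = "{0..2 * pi}"
  obtain T where T: "countable T" "T \<subseteq> ?I" "?I \<subseteq> closure T" by (rule dense_points_of_interval)
  define far where "far = (\<lambda>(k::nat) (s::real) t. 1 / Suc k < \<bar>s - t\<bar> \<and> \<bar>s - t\<bar> < 2 * pi - 1 / Suc k)"
  have "inj_on c {0..<2 * pi} \<longleftrightarrow>
      (\<forall>k. \<exists>m. \<forall>s\<in>T. \<forall>t\<in>T. far k s t \<longrightarrow> dist (c s) (c t) \<ge> 1 / Suc m)"
    if c: "continuous_on ?I c" "c 0 = c (2 * pi)" for c :: "real \<Rightarrow> real ^ 3"
  proof
    assume inj: "inj_on c {0..<2 * pi}"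
    show "\<forall>k. \<exists>m. \<forall>s\<in>T. \<forall>t\<in>T. far k s t \<longrightarrow> dist (c s) (c t) \<ge> 1 / Suc m"
    proof
      fix k
      define C where "C = (?I \<times> ?I) \<inter> {p. 1 / Suc k \<le> \<bar>fst p - snd p\<bar>} \<inter> {p. \<bar>fst p - snd p\<bar> \<le> 2 * pi - 1 / Suc k}"
      have "compact C"
        unfolding C_def
        by (intro compact_Int_closed compact_Times compact_Icc closed_Collect_le continuous_intros)
      have pos: "dist (c (fst p)) (c (snd p)) > 0" if p: "p \<in> C" for p
      proof -
        define r where "r = (\<lambda>s. if s = 2 * pi then 0 else s :: real)"
        have r: "c (r s) = c s" "s \<in> ?I \<Longrightarrow> r s \<in> {0..<2 * pi}" for s using c(2) by (auto simp: r_def)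
        have "1 / real (Suc k) > 0" by simp
        then have "r (fst p) \<noteq> r (snd p)" using p unfolding C_def r_def by (auto split: if_splits)
        moreover have "r (fst p) \<in> {0..<2 * pi}" "r (snd p) \<in> {0..<2 * pi}"
          using p by (auto simp: C_def intro!: r(2)[unfolded atLeastLessThan_iff])
        ultimately have "c (r (fst p)) \<noteq> c (r (snd p))" using inj by (meson inj_onD)
        then show ?thesis using r by simp
      qed
      have cC: "continuous_on C (\<lambda>p. dist (c (fst p)) (c (snd p)))"
        by (intro continuous_on_dist continuous_on_compose2[OF c(1)] continuous_intros) (auto simp: C_def)
      obtain d where d: "d > 0" "\<And>p. p \<in> C \<Longrightarrow> d \<le> dist (c (fst p)) (c (snd p))"
      proof (cases "C = {}")
        case False
        from continuous_attains_inf[OF \<open>compact C\<close> False cC] obtain p0 where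
          "p0 \<in> C" "\<And>p. p \<in> C \<Longrightarrow> dist (c (fst p0)) (c (snd p0)) \<le> dist (c (fst p)) (c (snd p))" by blast
        then show ?thesis using pos that by blast
      qed (use that[of 1] in auto)
      obtain m where m: "1 / real (Suc m) < d" using nat_approx_posE[OF d(1)] by metis
      have "1 / Suc m \<le> dist (c s) (c t)" if "s \<in> T" "t \<in> T" "far k s t" for s t
        using d(2)[of "(s, t)"] that T(2) m unfolding C_def far_def by (auto simp: subset_iff)
      then show "\<exists>m. \<forall>s\<in>T. \<forall>t\<in>T. far k s t \<longrightarrow> 1 / Suc m \<le> dist (c s) (c t)" by blast
    qed
  next
    assume *: "\<forall>k. \<exists>m. \<forall>s\<in>T. \<forall>t\<in>T. far k s t \<longrightarrow> dist (c s) (c t) \<ge> 1 / Suc m"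
    show "inj_on c {0..<2 * pi}"
    proof (rule inj_onI, rule ccontr)
      fix s t assume st: "s \<in> {0..<2 * pi}" "t \<in> {0..<2 * pi}" "c s = c t" "s \<noteq> t"
      then have "min \<bar>s - t\<bar> (2 * pi - \<bar>s - t\<bar>) > 0" by auto
      from nat_approx_posE[OF this] obtain k where "1 / real (Suc k) < min \<bar>s - t\<bar> (2 * pi - \<bar>s - t\<bar>)" by metis
      then have far: "far k s t" unfolding far_def by auto
      obtain m where m: "\<And>s t. s \<in> T \<Longrightarrow> t \<in> T \<Longrightarrow> far k s t \<Longrightarrow> dist (c s) (c t) \<ge> 1 / Suc m" using * by blast
      have "s \<in> closure T" "t \<in> closure T" using st T(3) by (auto simp: subset_iff)
      then obtain u v where u: "\<And>n. u n \<in> T" "u \<longlonglongrightarrow> s" and v: "\<And>n. v n \<in> T" "v \<longlonglongrightarrow> t"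
        unfolding closure_sequential by blast
      have diff: "(\<lambda>n. \<bar>u n - v n\<bar>) \<longlonglongrightarrow> \<bar>s - t\<bar>" using u v by (intro tendsto_intros)
      have "eventually (\<lambda>n. far k (u n) (v n)) sequentially"
        using order_tendstoD(1)[OF diff, of "1 / Suc k"] order_tendstoD(2)[OF diff, of "2 * pi - 1 / Suc k"] far
        unfolding far_def by (auto intro: eventually_conj)
      then have "eventually (\<lambda>n. 1 / Suc m \<le> dist (c (u n)) (c (v n))) sequentially"
        by (rule eventually_mono) (use m u v in blast)
      moreover have "(\<lambda>n. dist (c (u n)) (c (v n))) \<longlonglongrightarrow> dist (c s) (c t)"
      proof (intro tendsto_dist)
        have "u n \<in> ?I" "v n \<in> ?I" for n using u(1) v(1) T(2) by blast+
        then show "(\<lambda>n. c (u n)) \<longlonglongrightarrow> c s" "(\<lambda>n. c (v n)) \<longlonglongrightarrow> c t"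
          using continuous_on_tendsto_compose[OF c(1) u(2)] continuous_on_tendsto_compose[OF c(1) v(2)] st by auto
      qed
      ultimately have "1 / Suc m \<le> dist (c s) (c t)"
        by (intro tendsto_lowerbound[of "\<lambda>n. dist (c (u n)) (c (v n))" _ sequentially]) auto
      then show False using st(3) by (simp add: divide_simps split: if_splits)
    qed
  qed
  then have "{\<omega> \<in> space M. inj_on (\<gamma> \<omega>) {0..<2 * pi}} =
      {\<omega> \<in> space M. \<forall>k. \<exists>m. \<forall>s\<in>T. \<forall>t\<in>T. far k s t \<longrightarrow> dist (\<gamma> \<omega> s) (\<gamma> \<omega> t) \<ge> 1 / Suc m}"
    using cont closed by blast
  also have "\<dots> \<in> sets M"
  proof -
    have [measurable]: "(\<lambda>\<omega>. dist (\<gamma> \<omega> s) (\<gamma> \<omega> t)) \<in> borel_measurable M" for s t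
      using meas by (intro borel_measurable_dist)
    have "{\<omega> \<in> space M. far k s t \<longrightarrow> dist (\<gamma> \<omega> s) (\<gamma> \<omega> t) \<ge> 1 / Suc m} \<in> sets M" for k m s t
      by measurable
    then show ?thesis
      using T(1) by (intro sets.sets_Collect_countable_All sets.sets_Collect_countable_Ex sets.sets_Collect_countable_All')
  qed
  finally show ?thesis .
qed

lemma borel_measurable_infdist_curve:
  fixes \<gamma> :: "'w \<Rightarrow> real \<Rightarrow> real ^ 3"
  assumes meas: "\<And>t. (\<lambda>\<omega>. \<gamma> \<omega> t) \<in> borel_measurable M"
    and cont: "\<And>\<omega>. \<omega> \<in> space M \<Longrightarrow> continuous_on {0..2 * pi} (\<gamma> \<omega>)"
  shows "(\<lambda>\<omega>. infdist y (\<gamma> \<omega> ` {0..2 * pi})) \<in> borel_measurable M"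
proof (rule borel_measurableI_less)
  fix r
  obtain T where T: "countable T" "T \<subseteq> {0..2 * pi}" "{0..2 * pi} \<subseteq> closure T" by (rule dense_points_of_interval)
  have "infdist y (c ` {0..2 * pi}) < r \<longleftrightarrow> (\<exists>t\<in>T. dist y (c t) < r)"
    if c: "continuous_on {0..2 * pi} c" for c :: "real \<Rightarrow> real ^ 3"
  proof
    have ne: "c ` {0..2 * pi} \<noteq> {}" by auto
    assume "infdist y (c ` {0..2 * pi}) < r"
    then obtain t where t: "t \<in> {0..2 * pi}" "dist y (c t) < r"
      unfolding infdist_notempty[OF ne] using cINF_less_iff[OF ne, of "dist y" r] by auto
    then have "t \<in> closure T" using T(3) by blast
    then obtain u where u: "\<And>n. u n \<in> T" "u \<longlonglongrightarrow> t" unfolding closure_sequential by blast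
    have "u n \<in> {0..2 * pi}" for n using u(1) T(2) by blast
    then have "(\<lambda>n. dist y (c (u n))) \<longlonglongrightarrow> dist y (c t)"
      using continuous_on_tendsto_compose[OF c u(2) t(1)] by (intro tendsto_intros) auto
    then have "eventually (\<lambda>n. dist y (c (u n)) < r) sequentially" using t(2) by (rule order_tendstoD)
    then obtain n where "dist y (c (u n)) < r" using eventually_happens'[OF sequentially_bot] by blast
    then show "\<exists>t\<in>T. dist y (c t) < r" using u(1) by blast
  next
    assume "\<exists>t\<in>T. dist y (c t) < r"
    then obtain t where "t \<in> T" "dist y (c t) < r" by blast
    moreover then have "infdist y (c ` {0..2 * pi}) \<le> dist y (c t)" using T(2) by (intro infdist_le) auto
    ultimately show "infdist y (c ` {0..2 * pi}) < r" by simp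
  qed
  then have "{\<omega> \<in> space M. infdist y (\<gamma> \<omega> ` {0..2 * pi}) < r} = {\<omega> \<in> space M. \<exists>t\<in>T. dist y (\<gamma> \<omega> t) < r}"
    using cont by blast
  also have "\<dots> \<in> sets M"
  proof -
    have [measurable]: "(\<lambda>\<omega>. dist y (\<gamma> \<omega> t)) \<in> borel_measurable M" for t
      using meas by (intro borel_measurable_dist) auto
    have "{\<omega> \<in> space M. dist y (\<gamma> \<omega> t) < r} \<in> sets M" for t by measurable
    then show ?thesis using T(1) by (intro sets.sets_Collect_countable_Ex')
  qed
  finally show "{\<omega> \<in> space M. infdist y (\<gamma> \<omega> ` {0..2 * pi}) < r} \<in> sets M" .
qed

theorem measurable_knot_type:
  fixes \<gamma> :: "'w \<Rightarrow> real \<Rightarrow> real ^ 3"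
  assumes meas: "\<And>t. (\<lambda>\<omega>. \<gamma> \<omega> t) \<in> borel_measurable M"
    and cont: "\<And>\<omega>. \<omega> \<in> space M \<Longrightarrow> continuous_on {0..2 * pi} (\<gamma> \<omega>)"
    and closed: "\<And>\<omega>. \<omega> \<in> space M \<Longrightarrow> \<gamma> \<omega> 0 = \<gamma> \<omega> (2 * pi)"
    and f: "simple_closed_curve f"
  shows "{\<omega> \<in> space M. same_knot_type (\<gamma> \<omega>) f} \<in> sets M"
proof -
  let ?I = "{0..2 * pi}"
  obtain q :: "nat \<Rightarrow> real ^ 3" where q: "\<And>y e. e > 0 \<Longrightarrow> \<exists>i. dist (q i) y < e" using dense_sequence by blast
  define \<K> where "\<K> = {distances q (g ` f ` ?I) | h g. homeo h g \<and> orientation_preserving_homeo h}"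
  have cf: "compact (f ` ?I)" using f unfolding simple_closed_curve_def by (intro compact_continuous_image) auto
  have \<K>: "\<K> \<in> sets borel" unfolding \<K>_def by (rule homeomorphic_copies_borel[OF cf _ q]) auto
  have "same_knot_type (\<gamma> \<omega>) f \<longleftrightarrow> inj_on (\<gamma> \<omega>) {0..<2 * pi} \<and> distances q (\<gamma> \<omega> ` ?I) \<in> \<K>"
    if \<omega>: "\<omega> \<in> space M" for \<omega>
  proof -
    have "(\<exists>h. orientation_preserving_homeo h \<and> h ` \<gamma> \<omega> ` ?I = f ` ?I) \<longleftrightarrow> distances q (\<gamma> \<omega> ` ?I) \<in> \<K>"
    proof
      assume "\<exists>h. orientation_preserving_homeo h \<and> h ` \<gamma> \<omega> ` ?I = f ` ?I"
      then obtain h where h1: "orientation_preserving_homeo h" "h ` \<gamma> \<omega> ` ?I = f ` ?I" by blast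
      from h1(1) obtain g where g: "homeo h g" unfolding orientation_preserving_homeo_def by (elim conjE exE)
      note h = h1 g
      have "g ` h ` \<gamma> \<omega> ` ?I = \<gamma> \<omega> ` ?I" using homeo_inverses[OF h(3)] by (simp add: image_image)
      then show "distances q (\<gamma> \<omega> ` ?I) \<in> \<K>" unfolding \<K>_def using h by (metis (mono_tags, lifting) mem_Collect_eq)
    next
      assume "distances q (\<gamma> \<omega> ` ?I) \<in> \<K>"
      then obtain h g where h: "distances q (\<gamma> \<omega> ` ?I) = distances q (g ` f ` ?I)" "homeo h g" "orientation_preserving_homeo h"
        unfolding \<K>_def by blast
      have "\<gamma> \<omega> ` ?I = g ` f ` ?I"
      proof (rule distances_inj[OF q _ _ _ _ h(1)])
        show "closed (\<gamma> \<omega> ` ?I)" using cont[OF \<omega>] by (intro compact_imp_closed compact_continuous_image) auto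
        have "continuous_on (f ` ?I) g" using homeo_conts(2)[OF h(2)] by (rule continuous_on_subset) auto
        then show "closed (g ` f ` ?I)" by (rule compact_imp_closed[OF compact_continuous_image[OF _ cf]])
      qed auto
      then have "h ` \<gamma> \<omega> ` ?I = f ` ?I" using homeo_inverses[OF h(2)] by (simp add: image_image)
      then show "\<exists>h. orientation_preserving_homeo h \<and> h ` \<gamma> \<omega> ` ?I = f ` ?I" using h(3) by blast
    qed
    then show ?thesis
      using cont[OF \<omega>] closed[OF \<omega>] f unfolding same_knot_type_def simple_closed_curve_def by blast
  qed
  then have "{\<omega> \<in> space M. same_knot_type (\<gamma> \<omega>) f} = {\<omega> \<in> space M. inj_on (\<gamma> \<omega>) {0..<2 * pi}} \<inter>
      ((\<lambda>\<omega>. distances q (\<gamma> \<omega> ` ?I)) -` \<K> \<inter> space M)" by blast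
  also have "\<dots> \<in> sets M"
  proof (rule sets.Int)
    show "{\<omega> \<in> space M. inj_on (\<gamma> \<omega>) {0..<2 * pi}} \<in> sets M"
      by (rule measurable_simple_curves[OF meas cont closed])
    have "(\<lambda>\<omega>. distances q (\<gamma> \<omega> ` ?I)) \<in> borel_measurable M"
      unfolding distances_def
      by (intro measurable_coordinatewise_then_product borel_measurable_infdist_curve meas cont)
    then show "(\<lambda>\<omega>. distances q (\<gamma> \<omega> ` ?I)) -` \<K> \<inter> space M \<in> sets M"
      using \<K> by (rule measurable_sets)
  qed
  finally show ?thesis .
qed

section \<open>Stability of the knot type under Lipschitz-small perturbations\<close>

text \<open>Distance along the circle \<open>\<real> / 2 * pi\<close> for parameters in \<open>{0..2 * pi}\<close>.\<close>

definition arc_dist :: "real \<Rightarrow> real \<Rightarrow> real" where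
  "arc_dist s t = min \<bar>s - t\<bar> (2 * pi - \<bar>s - t\<bar>)"

lemma arc_dist_commute: "arc_dist s t = arc_dist t s"
  by (simp add: arc_dist_def abs_minus_commute)

lemma arc_dist_nonneg: "s \<in> {0..2 * pi} \<Longrightarrow> t \<in> {0..2 * pi} \<Longrightarrow> 0 \<le> arc_dist s t"
  by (auto simp: arc_dist_def)

text \<open>A continuously differentiable curve is strictly differentiable: the difference quotient of any two
points near \<open>t0\<close> is close to \<open>f' t0\<close>.\<close>

lemma strict_derivative:
  fixes f f' :: "real \<Rightarrow> real ^ 3"
  assumes f: "\<And>t. t \<in> {a..b} \<Longrightarrow> (f has_vector_derivative f' t) (at t within {a..b})"
    and f': "continuous_on {a..b} f'" and t0: "t0 \<in> {a..b}" and e: "e > 0"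
  shows "\<exists>d>0. \<forall>x\<in>{a..b}. \<forall>y\<in>{a..b}. \<bar>x - t0\<bar> < d \<longrightarrow> \<bar>y - t0\<bar> < d \<longrightarrow>
           norm (f x - f y - (x - y) *\<^sub>R f' t0) \<le> e * \<bar>x - y\<bar>"
proof -
  obtain d where d: "d > 0" "\<And>x. x \<in> {a..b} \<Longrightarrow> dist x t0 < d \<Longrightarrow> dist (f' x) (f' t0) < e"
    using f'[unfolded continuous_on_iff, rule_format, OF t0 e] by blast
  let ?S = "{a..b} \<inter> ball t0 d"
  have "norm (f x - f y - (x - y) *\<^sub>R f' t0) \<le> e * \<bar>x - y\<bar>" if "x \<in> ?S" "y \<in> ?S" for x y
  proof -
    have "norm ((f x - x *\<^sub>R f' t0) - (f y - y *\<^sub>R f' t0)) \<le> e * norm (x - y)"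
    proof (rule differentiable_bound[of ?S "\<lambda>x. f x - x *\<^sub>R f' t0" "\<lambda>x h. h *\<^sub>R (f' x - f' t0)"])
      show "convex ?S" by (intro convex_Int) auto
      fix z assume z: "z \<in> ?S"
      have "(f has_vector_derivative f' z) (at z within ?S)"
        using f z by (intro has_vector_derivative_within_subset[OF f]) auto
      then have "(f has_derivative (\<lambda>h. h *\<^sub>R f' z)) (at z within ?S)"
        unfolding has_vector_derivative_def .
      then show "((\<lambda>x. f x - x *\<^sub>R f' t0) has_derivative (\<lambda>h. h *\<^sub>R (f' z - f' t0))) (at z within ?S)"
        by (auto intro!: derivative_eq_intros simp: scaleR_diff_right)
      show "onorm (\<lambda>h. h *\<^sub>R (f' z - f' t0)) \<le> e"
      proof (rule onorm_le)
        fix h :: real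
        have "norm (f' z - f' t0) \<le> e" using d(2)[of z] z by (simp add: dist_norm abs_minus_commute)
        then show "norm (h *\<^sub>R (f' z - f' t0)) \<le> e * norm h"
          using mult_right_mono[of "norm (f' z - f' t0)" e "norm h"] by (simp add: mult.commute)
      qed
    qed (use that in auto)
    then show ?thesis by (simp add: algebra_simps)
  qed
  moreover have "x \<in> ?S" if "x \<in> {a..b}" "\<bar>x - t0\<bar> < d" for x
    using that by (auto simp: dist_real_def abs_minus_commute)
  ultimately show ?thesis using d(1) by (intro exI[of _ d]) blast
qed

text \<open>Otherwise there are pairs of points whose chord is arbitrarily short compared with their arc. A
limit of such pairs is a pair with equal images, hence equal parameters or the two end points; both
cases contradict strict differentiability and \<open>f' \<noteq> 0\<close>.\<close>

lemma smooth_closed_param_chord_arc: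
  assumes "smooth_closed_param f"
  shows "\<exists>c>0. \<forall>s\<in>{0..2 * pi}. \<forall>t\<in>{0..2 * pi}. c * arc_dist s t \<le> norm (f s - f t)"
proof (rule ccontr)
  let ?I = "{0..2 * pi}"
  assume neg: "\<not> ?thesis"
  obtain f' f'' where f: "\<And>t. t \<in> ?I \<Longrightarrow> (f has_vector_derivative f' t) (at t within ?I)"
    and f2: "\<And>t. t \<in> ?I \<Longrightarrow> (f' has_vector_derivative f'' t) (at t within ?I)"
    and ends: "f 0 = f (2 * pi)" "f' 0 = f' (2 * pi)" and nz: "\<And>t. t \<in> ?I \<Longrightarrow> f' t \<noteq> 0"
    and inj: "inj_on f {0..<2 * pi}"
    using assms unfolding smooth_closed_param_def by blast
  have cf: "continuous_on ?I f" and cf': "continuous_on ?I f'"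
    unfolding continuous_on_eq_continuous_within
    using has_vector_derivative_continuous[OF f] has_vector_derivative_continuous[OF f2] by blast+
  have strict: "\<exists>d>0. \<forall>x\<in>?I. \<forall>y\<in>?I. \<bar>x - t0\<bar> < d \<longrightarrow> \<bar>y - t0\<bar> < d \<longrightarrow>
      norm (f x - f y - (x - y) *\<^sub>R f' t0) \<le> e * \<bar>x - y\<bar>" if "t0 \<in> ?I" "e > 0" for t0 e
    by (rule strict_derivative[OF f cf' that])
  have "\<exists>s t. s \<in> ?I \<and> t \<in> ?I \<and> s \<le> t \<and> norm (f s - f t) < arc_dist s t / Suc n" for n :: nat
  proof -
    obtain s t where st: "s \<in> ?I" "t \<in> ?I" "norm (f s - f t) < 1 / Suc n * arc_dist s t"
      using neg by (meson not_le of_nat_0_less_iff zero_less_Suc zero_less_divide_1_iff)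
    show ?thesis
    proof (cases "s \<le> t")
      case True
      then show ?thesis using st by (intro exI[of _ s] exI[of _ t]) auto
    next
      case False
      then show ?thesis using st
        by (intro exI[of _ t] exI[of _ s]) (auto simp: norm_minus_commute arc_dist_commute)
    qed
  qed
  then obtain s t where s: "\<And>n. s n \<in> ?I" and t: "\<And>n. t n \<in> ?I" and st: "\<And>n. s n \<le> t n"
    and small: "\<And>n. norm (f (s n) - f (t n)) < arc_dist (s n) (t n) / Suc n"
    by metis
  have "seq_compact (?I \<times> ?I)" by (intro compact_imp_seq_compact compact_Times) auto
  moreover have "\<forall>n. (s n, t n) \<in> ?I \<times> ?I" using s t by auto
  ultimately obtain p r where p: "p \<in> ?I \<times> ?I" and r: "strict_mono (r :: nat \<Rightarrow> nat)" and lim: "((\<lambda>n. (s n, t n)) \<circ> r) \<longlonglongrightarrow> p"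
    by (rule seq_compactE)
  define a b where "a = fst p" and "b = snd p"
  have ab: "a \<in> ?I" "b \<in> ?I" using p by (auto simp: a_def b_def)
  have sa: "(\<lambda>n. s (r n)) \<longlonglongrightarrow> a" and tb: "(\<lambda>n. t (r n)) \<longlonglongrightarrow> b"
    using tendsto_fst[OF lim] tendsto_snd[OF lim] by (simp_all add: a_def b_def comp_def)
  have inv0: "(\<lambda>n. 1 / real (Suc (r n))) \<longlonglongrightarrow> 0"
    using LIMSEQ_subseq_LIMSEQ[OF lim_1_over_n[THEN LIMSEQ_Suc] r] by (simp add: comp_def)
  have arc_le: "arc_dist x y \<le> 2 * pi" for x y unfolding arc_dist_def min_def using pi_gt_zero by auto
  have fab: "f a = f b"
  proof -
    have "(\<lambda>n. f (s (r n)) - f (t (r n))) \<longlonglongrightarrow> f a - f b"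
      using continuous_on_tendsto_compose[OF cf sa ab(1)] continuous_on_tendsto_compose[OF cf tb ab(2)] s t
      by (intro tendsto_diff) auto
    moreover have "(\<lambda>n. f (s (r n)) - f (t (r n))) \<longlonglongrightarrow> 0"
    proof (rule Lim_null_comparison)
      show "eventually (\<lambda>n. norm (f (s (r n)) - f (t (r n))) \<le> 2 * pi * (1 / real (Suc (r n)))) sequentially"
      proof (intro always_eventually allI)
        fix n
        have "arc_dist (s (r n)) (t (r n)) / Suc (r n) \<le> 2 * pi / Suc (r n)"
          by (intro divide_right_mono arc_le) auto
        then show "norm (f (s (r n)) - f (t (r n))) \<le> 2 * pi * (1 / real (Suc (r n)))"
          using small[of "r n"] by simp
      qed
      show "(\<lambda>n. 2 * pi * (1 / real (Suc (r n)))) \<longlonglongrightarrow> 0"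
        using tendsto_mult_right_zero[OF inv0] by simp
    qed
    ultimately have "f a - f b = 0" by (rule LIMSEQ_unique)
    then show ?thesis by simp
  qed
  have "a \<le> b" using LIMSEQ_le[OF sa tb] st by blast
  have cases: "a = b \<or> a = 0 \<and> b = 2 * pi"
  proof (cases "b = 2 * pi")
    case True
    show ?thesis
    proof (cases "a = 2 * pi")
      case False
      then have "a = 0" using inj_onD[OF inj, of a 0] fab ends True ab by auto
      then show ?thesis using True by simp
    qed (use True in simp)
  next
    case False
    then show ?thesis using inj_onD[OF inj fab] ab \<open>a \<le> b\<close> by auto
  qed
  \<comment> \<open>Half of the speed at the limit point survives in the chords near it.\<close>
  define m where "m = norm (f' a)"
  have m: "m > 0" using nz[OF ab(1)] by (simp add: m_def)
  have mb: "f' b = f' a" using cases ends by auto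
  obtain d1 where d1: "d1 > 0" "\<And>x y. x \<in> ?I \<Longrightarrow> y \<in> ?I \<Longrightarrow> \<bar>x - a\<bar> < d1 \<Longrightarrow> \<bar>y - a\<bar> < d1 \<Longrightarrow>
      norm (f x - f y - (x - y) *\<^sub>R f' a) \<le> m / 2 * \<bar>x - y\<bar>"
    using strict[OF ab(1), of "m / 2"] m by auto
  obtain d2 where d2: "d2 > 0" "\<And>x y. x \<in> ?I \<Longrightarrow> y \<in> ?I \<Longrightarrow> \<bar>x - b\<bar> < d2 \<Longrightarrow> \<bar>y - b\<bar> < d2 \<Longrightarrow>
      norm (f x - f y - (x - y) *\<^sub>R f' a) \<le> m / 2 * \<bar>x - y\<bar>"
    using strict[OF ab(2), of "m / 2"] m unfolding mb by auto
  have "eventually (\<lambda>n. \<bar>s (r n) - a\<bar> < d1) sequentially"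
    using tendstoD[OF sa d1(1)] by (simp add: dist_real_def)
  moreover have "eventually (\<lambda>n. \<bar>t (r n) - b\<bar> < min d1 d2) sequentially"
    using tendstoD[OF tb, of "min d1 d2"] d1(1) d2(1) by (simp add: dist_real_def)
  moreover have "eventually (\<lambda>n. 1 / real (Suc (r n)) < m / 2) sequentially"
    using order_tendstoD(2)[OF inv0, of "m / 2"] m by simp
  ultimately have "eventually (\<lambda>n. \<bar>s (r n) - a\<bar> < d1 \<and> \<bar>t (r n) - b\<bar> < min d1 d2 \<and> 1 / real (Suc (r n)) < m / 2) sequentially"
    by (intro eventually_conj)
  then obtain n where n: "\<bar>s (r n) - a\<bar> < d1" "\<bar>t (r n) - b\<bar> < min d1 d2" "1 / real (Suc (r n)) < m / 2"
    using eventually_happens'[OF sequentially_bot] by blast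
  define x y where "x = s (r n)" and "y = t (r n)"
  have xy: "x \<in> ?I" "y \<in> ?I" "x \<le> y" using s t st by (auto simp: x_def y_def)
  have "\<exists>u. arc_dist x y \<le> u \<and> norm (f x - f y) \<ge> m / 2 * u"
  proof (cases "a = b")
    case True
    have "norm (f x - f y - (x - y) *\<^sub>R f' a) \<le> m / 2 * \<bar>x - y\<bar>"
      using n True xy by (intro d1(2)) (auto simp: x_def y_def)
    moreover have "norm ((x - y) *\<^sub>R f' a) = m * \<bar>x - y\<bar>" by (simp add: m_def)
    moreover have "norm ((x - y) *\<^sub>R f' a) - norm (f x - f y) \<le> norm (f x - f y - (x - y) *\<^sub>R f' a)"
      using norm_triangle_ineq2[of "(x - y) *\<^sub>R f' a" "f x - f y"] by (simp add: norm_minus_commute)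
    ultimately have "m / 2 * \<bar>x - y\<bar> \<le> norm (f x - f y)" by linarith
    then show ?thesis by (intro exI[of _ "\<bar>x - y\<bar>"]) (auto simp: arc_dist_def)
  next
    case False
    then have ab': "a = 0" "b = 2 * pi" using cases by auto
    let ?u = "x + (2 * pi - y)"
    have "norm (f x - f 0 - (x - 0) *\<^sub>R f' a) \<le> m / 2 * \<bar>x - 0\<bar>"
      using n ab' xy d1(1) by (intro d1(2)) (auto simp: x_def)
    moreover have "norm (f (2 * pi) - f y - (2 * pi - y) *\<^sub>R f' a) \<le> m / 2 * \<bar>2 * pi - y\<bar>"
      using n ab' xy d2(1) by (intro d2(2)) (auto simp: y_def)
    moreover have "norm (f x - f y - ?u *\<^sub>R f' a) \<le>
        norm (f x - f 0 - (x - 0) *\<^sub>R f' a) + norm (f (2 * pi) - f y - (2 * pi - y) *\<^sub>R f' a)"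
    proof -
      have eq: "f x - f y - ?u *\<^sub>R f' a =
          (f x - f 0 - (x - 0) *\<^sub>R f' a) + (f (2 * pi) - f y - (2 * pi - y) *\<^sub>R f' a)"
        using ends(1) by (simp add: scaleR_add_left)
      show ?thesis unfolding eq by (rule norm_triangle_ineq)
    qed
    ultimately have "norm (f x - f y - ?u *\<^sub>R f' a) \<le> m / 2 * ?u"
      using xy by (simp add: algebra_simps)
    moreover have "norm (?u *\<^sub>R f' a) = m * ?u" using xy by (simp add: m_def)
    moreover have "norm (?u *\<^sub>R f' a) - norm (f x - f y) \<le> norm (f x - f y - ?u *\<^sub>R f' a)"
      using norm_triangle_ineq2[of "?u *\<^sub>R f' a" "f x - f y"] by (simp add: norm_minus_commute)
    ultimately have "m / 2 * ?u \<le> norm (f x - f y)" by linarith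
    then show ?thesis using xy by (intro exI[of _ ?u]) (auto simp: arc_dist_def)
  qed
  then obtain u where u: "arc_dist x y \<le> u" "norm (f x - f y) \<ge> m / 2 * u" by blast
  have sm: "norm (f x - f y) < arc_dist x y * (1 / Suc (r n))" using small[of "r n"] by (simp add: x_def y_def)
  moreover have "arc_dist x y \<ge> 0"
    using xy by (auto simp: arc_dist_def)
  ultimately have "norm (f x - f y) < u * (1 / Suc (r n))"
    using mult_right_mono[OF u(1), of "1 / Suc (r n)"] by auto
  moreover have "u * (1 / Suc (r n)) \<le> u * (m / 2)"
    using n(3) u(1) \<open>arc_dist x y \<ge> 0\<close> by (intro mult_left_mono) auto
  ultimately show False using u(2) mult.commute[of u "m / 2"] by linarith
qed

text \<open>The McShane extension of the function that takes the value \<open>d t\<close> at the point \<open>p t\<close>.\<close>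

lemma Lipschitz_extension:
  fixes p :: "'i \<Rightarrow> 'a::metric_space" and d :: "'i \<Rightarrow> real"
  assumes ne: "T \<noteq> {}" and L: "\<And>s t. s \<in> T \<Longrightarrow> t \<in> T \<Longrightarrow> \<bar>d s - d t\<bar> \<le> L * dist (p s) (p t)" "L \<ge> 0"
  shows "\<exists>\<phi>. (\<forall>t\<in>T. \<phi> (p t) = d t) \<and> (\<forall>x y. \<bar>\<phi> x - \<phi> y\<bar> \<le> L * dist x y)"
proof -
  define \<phi> where "\<phi> = (\<lambda>x. INF t\<in>T. d t + L * dist x (p t))"
  obtain t0 where t0: "t0 \<in> T" using ne by blast
  have low: "d s - L * dist x (p s) \<le> d t + L * dist x (p t)" if "s \<in> T" "t \<in> T" for s t x
  proof -
    have "d s - d t \<le> L * dist (p s) (p t)" using L(1)[OF that] by linarith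
    also have "\<dots> \<le> L * (dist x (p s) + dist x (p t))"
      using L(2) dist_triangle3[of "p s" "p t" x] by (intro mult_left_mono) auto
    finally show ?thesis by (simp add: algebra_simps)
  qed
  have bdd: "bdd_below ((\<lambda>t. d t + L * dist x (p t)) ` T)" for x
    using low[OF t0] by (intro bdd_belowI2[of _ "d t0 - L * dist x (p t0)"])
  have le: "\<phi> x \<le> \<phi> y + L * dist x y" for x y
  proof -
    have "\<phi> x - L * dist x y \<le> d t + L * dist y (p t)" if "t \<in> T" for t
    proof -
      have "\<phi> x \<le> d t + L * dist x (p t)" unfolding \<phi>_def using bdd that by (intro cINF_lower)
      also have "\<dots> \<le> d t + L * (dist x y + dist y (p t))"
        using L(2) dist_triangle[of x "p t" y] by (intro add_left_mono mult_left_mono) auto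
      finally show ?thesis by (simp add: algebra_simps)
    qed
    then have "\<phi> x - L * dist x y \<le> \<phi> y" unfolding \<phi>_def[of] using ne by (intro cINF_greatest) auto
    then show ?thesis by simp
  qed
  have "\<bar>\<phi> x - \<phi> y\<bar> \<le> L * dist x y" for x y
    using le[of x y] le[of y x] by (simp add: dist_commute abs_le_iff)
  moreover have "\<phi> (p t) = d t" if "t \<in> T" for t
  proof (rule antisym)
    have "\<phi> (p t) \<le> d t + L * dist (p t) (p t)" unfolding \<phi>_def using bdd that by (intro cINF_lower)
    then show "\<phi> (p t) \<le> d t" by simp
    show "d t \<le> \<phi> (p t)" unfolding \<phi>_def
    proof (intro cINF_greatest ne)
      fix u assume "u \<in> T"
      then show "d t \<le> d u + L * dist (p t) (p u)" using low[OF that, of u "p t"] by simp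
    qed
  qed
  ultimately show ?thesis by blast
qed

text \<open>Surjectivity is Banach's fixed point theorem for \<open>x \<mapsto> y - \<Phi> x\<close>.\<close>

lemma homeo_id_plus_contraction:
  fixes \<Phi> :: "real ^ 3 \<Rightarrow> real ^ 3"
  assumes L: "L < 1" "\<And>x y. norm (\<Phi> x - \<Phi> y) \<le> L * norm (x - y)"
  shows "\<exists>g. homeo (\<lambda>x. x + \<Phi> x) g"
proof -
  let ?h = "\<lambda>x. x + \<Phi> x"
  have low: "(1 - L) * norm (x - y) \<le> norm (?h x - ?h y)" for x y
  proof -
    have "norm (x - y) = norm ((?h x - ?h y) - (\<Phi> x - \<Phi> y))" by (simp add: algebra_simps)
    also have "\<dots> \<le> norm (?h x - ?h y) + norm (\<Phi> x - \<Phi> y)" by (rule norm_triangle_ineq4)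
    finally show ?thesis using L(2)[of x y] by (simp add: algebra_simps)
  qed
  have L0: "0 \<le> L"
  proof -
    have "0 \<le> L * norm ((1 :: real ^ 3) - 0)" using L(2)[of 1 0] norm_ge_zero by (rule order_trans[rotated])
    then show ?thesis by (simp add: zero_le_mult_iff)
  qed
  have surj: "\<exists>x. ?h x = y" for y
  proof -
    have "\<exists>!x. y - \<Phi> x = x"
    proof (rule banach_fix_type[OF L0 L(1)])
      show "\<forall>x z. dist (y - \<Phi> x) (y - \<Phi> z) \<le> L * dist x z"
        using L(2) by (simp add: dist_norm norm_minus_commute)
    qed
    then obtain x where "y - \<Phi> x = x" by blast
    then have "?h x = y" by (metis add_diff_cancel_right' diff_add_cancel)
    then show ?thesis by blast
  qed
  define g where "g = (\<lambda>y. SOME x. ?h x = y)"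
  have hg: "?h (g y) = y" for y unfolding g_def by (rule someI_ex[OF surj])
  have gh: "g (?h x) = x" for x :: "real ^ 3"
  proof -
    have "(1 - L) * norm (g (?h x) - x) \<le> 0" using low[of "g (?h x)" x] hg[of "?h x"] by simp
    then show ?thesis using L(1) by (simp add: mult_le_0_iff)
  qed
  have "L-lipschitz_on UNIV \<Phi>"
    using L L0 by (intro lipschitz_onI) (simp_all add: dist_norm)
  then have "continuous_on UNIV \<Phi>" by (rule lipschitz_on_continuous_on)
  moreover have "(1 / (1 - L))-lipschitz_on UNIV g"
  proof (rule lipschitz_onI)
    fix x y
    have "(1 - L) * norm (g x - g y) \<le> norm (x - y)" using low[of "g x" "g y"] hg by simp
    then show "dist (g x) (g y) \<le> 1 / (1 - L) * dist x y"
      using L(1) by (simp add: dist_norm field_simps)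
  qed (use L in simp)
  then have "continuous_on UNIV g" by (rule lipschitz_on_continuous_on)
  ultimately have "homeo ?h g"
    using hg gh by (intro homeomorphismI continuous_intros) auto
  then show ?thesis by blast
qed

lemma smooth_closed_param_simple:
  assumes "smooth_closed_param f"
  shows "simple_closed_curve f"
  using assms has_vector_derivative_continuous
  unfolding smooth_closed_param_def simple_closed_curve_def continuous_on_eq_continuous_within by blast

text \<open>The displacement \<open>f t \<mapsto> g t - f t\<close> is a map on the image of \<open>f\<close>. By the chord-arc inequality its
Lipschitz constant is at most \<open>1/6\<close>, so that a coordinatewise extension \<open>\<Phi>\<close> to the whole space has
Lipschitz constant at most \<open>3 * 1/6 < 1\<close>. Then \<open>x \<mapsto> x + \<Phi> x\<close> is an orientation-preserving
homeomorphism that carries \<open>f\<close> to \<open>g\<close>. The size of \<open>g - f\<close> itself does not enter, because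
translations do not change the knot type.\<close>

theorem knot_type_stable:
  assumes f: "smooth_closed_param f"
  shows "\<exists>\<epsilon>>0. \<forall>g. g 0 = g (2 * pi) \<longrightarrow>
    (\<forall>s\<in>{0..2 * pi}. \<forall>t\<in>{0..2 * pi}. norm ((g s - f s) - (g t - f t)) \<le> \<epsilon> * arc_dist s t) \<longrightarrow>
    same_knot_type g f"
proof -
  let ?I = "{0..2 * pi}"
  obtain c where c: "c > 0" "\<And>s t. s \<in> ?I \<Longrightarrow> t \<in> ?I \<Longrightarrow> c * arc_dist s t \<le> norm (f s - f t)"
    using smooth_closed_param_chord_arc[OF f] by blast
  have sf: "simple_closed_curve f" using f by (rule smooth_closed_param_simple)
  have "same_knot_type g f" if g0: "g 0 = g (2 * pi)"
    and close: "\<And>s t. s \<in> ?I \<Longrightarrow> t \<in> ?I \<Longrightarrow> norm ((g s - f s) - (g t - f t)) \<le> c / 6 * arc_dist s t" for g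
  proof -
    have "\<exists>\<phi>. (\<forall>t\<in>?I. \<phi> (f t) = (g t - f t) $ i) \<and> (\<forall>x y. \<bar>\<phi> x - \<phi> y\<bar> \<le> 1 / 6 * dist x y)" for i
    proof (rule Lipschitz_extension)
      fix s t assume st: "s \<in> ?I" "t \<in> ?I"
      have "\<bar>(g s - f s) $ i - (g t - f t) $ i\<bar> \<le> norm ((g s - f s) - (g t - f t))"
        using component_le_norm_cart[of "(g s - f s) - (g t - f t)" i] by simp
      also have "\<dots> \<le> 1 / 6 * (c * arc_dist s t)" using close[OF st] by simp
      also have "\<dots> \<le> 1 / 6 * dist (f s) (f t)" using c(2)[OF st] by (simp add: dist_norm)
      finally show "\<bar>(g s - f s) $ i - (g t - f t) $ i\<bar> \<le> 1 / 6 * dist (f s) (f t)" .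
    qed auto
    then obtain \<phi> where \<phi>: "\<And>i t. t \<in> ?I \<Longrightarrow> \<phi> i (f t) = (g t - f t) $ i"
      "\<And>i x y. \<bar>\<phi> i x - \<phi> i y\<bar> \<le> 1 / 6 * dist x y" by metis
    define \<Phi> :: "real ^ 3 \<Rightarrow> real ^ 3" where "\<Phi> = (\<lambda>x. \<chi> i. \<phi> i x)"
    define h where "h = (\<lambda>x. x + \<Phi> x)"
    have \<Phi>L: "norm (\<Phi> x - \<Phi> y) \<le> 1 / 2 * norm (x - y)" for x y
    proof -
      have "norm (\<Phi> x - \<Phi> y) \<le> (\<Sum>i\<in>UNIV. \<bar>(\<Phi> x - \<Phi> y) $ i\<bar>)" by (rule norm_le_l1_cart)
      also have "\<dots> \<le> (\<Sum>i\<in>(UNIV :: 3 set). 1 / 6 * dist x y)"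
        unfolding \<Phi>_def by (intro sum_mono) (use \<phi>(2) in auto)
      also have "\<dots> = 1 / 2 * norm (x - y)" by (simp add: dist_norm)
      finally show ?thesis .
    qed
    obtain k where k: "homeo h k" using homeo_id_plus_contraction[OF _ \<Phi>L] unfolding h_def by auto
    have "orientation_preserving_homeo h"
      by (rule orientation_preserving_if_homotopic_id[OF k, of "1/2"]) (use \<Phi>L in \<open>simp_all add: h_def\<close>)
    then have op: "orientation_preserving_homeo k" using k by (rule orientation_preserving_inverse)
    have hf: "h (f t) = g t" if "t \<in> ?I" for t
      unfolding h_def \<Phi>_def using \<phi>(1)[OF that] by (simp add: vec_eq_iff)
    have kh: "k (h x) = x" for x using k unfolding homeomorphism_def by blast
    have "k ` g ` ?I = k ` h ` f ` ?I" using hf by (simp add: image_image)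
    also have "\<dots> = f ` ?I" using kh by (simp add: image_image)
    finally have img: "k ` g ` ?I = f ` ?I" .
    have "continuous_on ?I (\<lambda>t. h (f t))"
      using continuous_on_compose2[OF homeo_cont[OF k]] sf unfolding simple_closed_curve_def by blast
    then have "continuous_on ?I g" using hf by (rule continuous_on_eq)
    moreover have "inj_on g {0..<2 * pi}"
    proof (rule inj_onI)
      fix s t assume st: "s \<in> {0..<2 * pi}" "t \<in> {0..<2 * pi}" "g s = g t"
      then have "h (f s) = h (f t)" using hf by simp
      then have "f s = f t" using homeo_inj[OF k] by simp
      then show "s = t" using sf st unfolding simple_closed_curve_def inj_on_def by blast
    qed
    ultimately show ?thesis
      unfolding same_knot_type_def using sf g0 op img unfolding simple_closed_curve_def by blast
  qed
  then show ?thesis using c(1) by (intro exI[of _ "c / 6"]) auto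
qed

section \<open>Centred Gaussian variables through characteristic functions\<close>

context prob_space
begin

text \<open>Centred Gaussian with variance \<open>v\<close>, where \<open>v = 0\<close> is allowed. In this form the notion is closed
under pointwise limits.\<close>

definition char_gauss :: "('a \<Rightarrow> real) \<Rightarrow> real \<Rightarrow> bool" where
  "char_gauss X v \<longleftrightarrow> X \<in> borel_measurable M \<and> v \<ge> 0 \<and>
     (\<forall>s. (CLINT \<omega>|M. iexp (s * X \<omega>)) = exp (- v * s\<^sup>2 / 2))"

lemma char_distr_eq: "X \<in> borel_measurable M \<Longrightarrow> char (distr M borel X) s = (CLINT \<omega>|M. iexp (s * X \<omega>))"
  unfolding char_def by (subst integral_distr) auto

lemma char_normal:
  assumes "distributed M lborel X (normal_density 0 \<sigma>)" "\<sigma> > 0"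
  shows "(CLINT \<omega>|M. iexp (s * X \<omega>)) = exp (- \<sigma>\<^sup>2 * s\<^sup>2 / 2)"
proof -
  have X: "X \<in> borel_measurable M" using distributed_measurable[OF assms(1)] by simp
  have D: "distributed M lborel (\<lambda>x. (X x - 0) / \<sigma>) std_normal_density"
    using assms normal_standard_normal_convert by blast
  have d: "distr M borel (\<lambda>x. X x / \<sigma>) = std_normal_distribution"
    using distributed_distr_eq_density[OF D] by (simp cong: distr_cong)
  have "(CLINT \<omega>|M. iexp (s * X \<omega>)) = (CLINT \<omega>|M. iexp ((s * \<sigma>) * (X \<omega> / \<sigma>)))"
    using assms(2) by simp
  also have "\<dots> = char (distr M borel (\<lambda>x. X x / \<sigma>)) (s * \<sigma>)"
    using X by (subst char_distr_eq) auto
  also have "\<dots> = complex_of_real (exp (- ((s * \<sigma>)\<^sup>2) / 2))"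
    unfolding d char_std_normal_distribution ..
  also have "- ((s * \<sigma>)\<^sup>2) / 2 = - \<sigma>\<^sup>2 * s\<^sup>2 / 2" by (simp add: power_mult_distrib)
  finally show ?thesis by simp
qed

lemma gaussian_rv_imp_char_gauss:
  assumes X: "gaussian_rv M X" and 0: "expectation X = 0"
  shows "integrable M (\<lambda>\<omega>. (X \<omega>)\<^sup>2)" "char_gauss X (expectation (\<lambda>\<omega>. (X \<omega>)\<^sup>2))"
proof -
  have [measurable]: "X \<in> borel_measurable M" using X unfolding gaussian_rv_def by blast
  obtain m where "(AE \<omega> in M. X \<omega> = m) \<or> (\<exists>\<sigma>>0. distributed M lborel X (normal_density m \<sigma>))"
    using X unfolding gaussian_rv_def by blast
  then have "integrable M (\<lambda>\<omega>. (X \<omega>)\<^sup>2) \<and> char_gauss X (expectation (\<lambda>\<omega>. (X \<omega>)\<^sup>2))"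
  proof (elim disjE exE conjE)
    assume ae: "AE \<omega> in M. X \<omega> = m"
    have "expectation X = expectation (\<lambda>_. m)" by (rule integral_cong_AE) (use ae in auto)
    then have m: "m = 0" using 0 prob_space by simp
    have i: "integrable M (\<lambda>\<omega>. (X \<omega>)\<^sup>2) \<longleftrightarrow> integrable M (\<lambda>\<omega>. 0 :: real)"
      by (rule integrable_cong_AE) (use ae m in auto)
    have e: "expectation (\<lambda>\<omega>. (X \<omega>)\<^sup>2) = expectation (\<lambda>\<omega>. 0 :: real)"
      by (rule integral_cong_AE) (use ae m in auto)
    have c: "(CLINT \<omega>|M. iexp (s * X \<omega>)) = (CLINT \<omega>|M. 1)" for s
      by (rule integral_cong_AE) (use ae m in auto)
    show ?thesis unfolding char_gauss_def e c using i prob_space by simp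
  next
    fix \<sigma> :: real assume \<sigma>: "\<sigma> > 0" "distributed M lborel X (normal_density m \<sigma>)"
    have m: "m = 0" using normal_distributed_expectation[OF \<sigma>] 0 by simp
    have v: "expectation (\<lambda>\<omega>. (X \<omega>)\<^sup>2) = \<sigma>\<^sup>2"
      using normal_distributed_variance[OF \<sigma>] 0 by simp
    then have "integrable M (\<lambda>\<omega>. (X \<omega>)\<^sup>2)"
      using not_integrable_integral_eq \<sigma>(1) by fastforce
    moreover have "char_gauss X (expectation (\<lambda>\<omega>. (X \<omega>)\<^sup>2))"
      unfolding char_gauss_def v using char_normal[OF _ \<sigma>(1)] \<sigma>(2) m by simp
    ultimately show ?thesis ..
  qed
  then show "integrable M (\<lambda>\<omega>. (X \<omega>)\<^sup>2)" "char_gauss X (expectation (\<lambda>\<omega>. (X \<omega>)\<^sup>2))" by auto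
qed

lemma char_gauss_limit:
  assumes X: "\<And>n. char_gauss (X n) (v n)" and lim: "\<And>\<omega>. \<omega> \<in> space M \<Longrightarrow> (\<lambda>n. X n \<omega>) \<longlonglongrightarrow> Y \<omega>"
    and v: "v \<longlonglongrightarrow> w"
  shows "char_gauss Y w"
proof -
  have [measurable]: "X n \<in> borel_measurable M" for n using X unfolding char_gauss_def by blast
  have Y[measurable]: "Y \<in> borel_measurable M" by (rule borel_measurable_LIMSEQ_real[OF lim]) auto
  have "w \<ge> 0" using v X unfolding char_gauss_def by (intro LIMSEQ_le_const[OF v]) auto
  moreover have "(CLINT \<omega>|M. iexp (s * Y \<omega>)) = exp (- w * s\<^sup>2 / 2)" for s
  proof (rule LIMSEQ_unique)
    show "(\<lambda>n. CLINT \<omega>|M. iexp (s * X n \<omega>)) \<longlonglongrightarrow> (CLINT \<omega>|M. iexp (s * Y \<omega>))"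
    proof (rule integral_dominated_convergence[where w = "\<lambda>_. 1"])
      show "AE \<omega> in M. (\<lambda>n. iexp (s * X n \<omega>)) \<longlonglongrightarrow> iexp (s * Y \<omega>)"
        using lim by (intro AE_I2 tendsto_intros) auto
    qed auto
    have "(\<lambda>n. complex_of_real (exp (- v n * s\<^sup>2 / 2))) \<longlonglongrightarrow> complex_of_real (exp (- w * s\<^sup>2 / 2))"
      using v by (intro tendsto_intros) auto
    then show "(\<lambda>n. CLINT \<omega>|M. iexp (s * X n \<omega>)) \<longlonglongrightarrow> exp (- w * s\<^sup>2 / 2)"
      using X unfolding char_gauss_def by (simp add: exp_of_real)
  qed
  ultimately show ?thesis unfolding char_gauss_def using Y by blast
qed

lemma char_gauss_normal:
  assumes "char_gauss X v" "v > 0"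
  shows "distributed M lborel X (normal_density 0 (sqrt v))"
proof -
  have [measurable]: "X \<in> borel_measurable M" using assms unfolding char_gauss_def by blast
  let ?N = "density lborel (\<lambda>x. ennreal (normal_density 0 (sqrt v) x))"
  interpret N: prob_space ?N using assms(2) by (intro prob_space_normal_density) auto
  have N: "real_distribution ?N" by unfold_locales auto
  have "distributed ?N lborel (\<lambda>x. x) (normal_density 0 (sqrt v))"
    unfolding distributed_def by (auto simp: distr_id2)
  from N.char_normal[OF this] have "char ?N s = exp (- v * s\<^sup>2 / 2)" for s
    unfolding char_def using assms(2) by simp
  then have "char (distr M borel X) = char ?N"
    using assms(1) unfolding char_gauss_def by (auto simp: char_distr_eq)
  then have "distr M borel X = ?N" using N by (intro Levy_uniqueness real_distribution_distr) auto
  then show ?thesis unfolding distributed_def by (simp cong: distr_cong)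
qed

lemma char_gauss_zero:
  assumes "char_gauss X 0"
  shows "AE \<omega> in M. X \<omega> = 0"
proof -
  have [measurable]: "X \<in> borel_measurable M" using assms unfolding char_gauss_def by blast
  let ?N = "return borel (0 :: real)"
  interpret N: prob_space ?N by (rule prob_space_return) auto
  have N: "real_distribution ?N" by unfold_locales auto
  have "char ?N s = 1" for s unfolding char_def by (subst integral_return) auto
  then have "char (distr M borel X) = char ?N"
    using assms(1) unfolding char_gauss_def by (auto simp: char_distr_eq)
  then have d: "distr M borel X = ?N" using N by (intro Levy_uniqueness real_distribution_distr) auto
  have "AE x in ?N. x = 0" by (subst AE_return) auto
  then have "AE x in distr M borel X. x = 0" unfolding d .
  then show ?thesis by (subst (asm) AE_distr_iff) auto
qed

lemma char_gauss_nn_integral_abs_le: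
  assumes X: "char_gauss X v"
  shows "(\<integral>\<^sup>+\<omega>. ennreal \<bar>X \<omega>\<bar> \<partial>M) \<le> ennreal (sqrt v)"
proof (cases "v = 0")
  case True
  then have "(\<integral>\<^sup>+\<omega>. ennreal \<bar>X \<omega>\<bar> \<partial>M) = (\<integral>\<^sup>+\<omega>. 0 \<partial>M)"
    using char_gauss_zero X by (intro nn_integral_cong_AE) auto
  then show ?thesis by simp
next
  case False
  then have v: "v > 0" using X unfolding char_gauss_def by auto
  have [measurable]: "X \<in> borel_measurable M" using X unfolding char_gauss_def by blast
  have D: "distributed M lborel X (normal_density 0 (sqrt v))" by (rule char_gauss_normal[OF X v])
  have 0: "expectation X = 0" using normal_distributed_expectation[OF _ D] v by simp
  have "expectation (\<lambda>\<omega>. (X \<omega>)\<^sup>2) = v" using normal_distributed_variance[OF _ D] v 0 by simp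
  moreover then have "integrable M (\<lambda>\<omega>. (X \<omega>)\<^sup>2)" using not_integrable_integral_eq v by fastforce
  ultimately have sq: "(\<integral>\<^sup>+\<omega>. ennreal ((X \<omega>)\<^sup>2) \<partial>M) = ennreal v"
    by (subst nn_integral_eq_integral) auto
  let ?a = "sqrt v"
  have "\<bar>X \<omega>\<bar> \<le> ?a / 2 + 1 / (2 * ?a) * (X \<omega>)\<^sup>2" for \<omega>
  proof -
    have "0 \<le> (?a - \<bar>X \<omega>\<bar>)\<^sup>2" by simp
    then show ?thesis using v by (simp add: power2_eq_square field_simps)
  qed
  then have "(\<integral>\<^sup>+\<omega>. ennreal \<bar>X \<omega>\<bar> \<partial>M) \<le> (\<integral>\<^sup>+\<omega>. ennreal (?a / 2) + ennreal (1 / (2 * ?a)) * ennreal ((X \<omega>)\<^sup>2) \<partial>M)"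
    using v by (intro nn_integral_mono) (simp add: ennreal_mult[symmetric] ennreal_plus[symmetric] del: ennreal_plus)
  also have "\<dots> = ennreal (?a / 2) + ennreal (1 / (2 * ?a)) * ennreal v"
    by (subst nn_integral_add) (auto simp: nn_integral_cmult sq emeasure_space_1)
  also have "\<dots> = ennreal (?a / 2 + 1 / (2 * ?a) * v)"
    using v by (simp add: ennreal_mult[symmetric] ennreal_plus[symmetric] del: ennreal_plus)
  also have "?a / 2 + 1 / (2 * ?a) * v = ?a"
    using v by (simp add: field_simps)
  finally show ?thesis .
qed

lemma char_gauss_interval_pos:
  assumes X: "char_gauss X v" and v: "v > 0" and d: "d > 0"
  shows "prob {\<omega> \<in> space M. X \<omega> \<in> {a - d<..<a + d}} > 0"
proof -
  have [measurable]: "X \<in> borel_measurable M" using X unfolding char_gauss_def by blast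
  have D: "distributed M lborel X (normal_density 0 (sqrt v))" by (rule char_gauss_normal[OF X v])
  have "emeasure M (X -` {a - d<..<a + d} \<inter> space M) =
      (\<integral>\<^sup>+x. ennreal (normal_density 0 (sqrt v) x) * indicator {a - d<..<a + d} x \<partial>lborel)"
    by (rule distributed_emeasure[OF D]) auto
  moreover have "(\<integral>\<^sup>+x. ennreal (normal_density 0 (sqrt v) x) * indicator {a - d<..<a + d} x \<partial>lborel) \<noteq> 0"
  proof
    assume "(\<integral>\<^sup>+x. ennreal (normal_density 0 (sqrt v) x) * indicator {a - d<..<a + d} x \<partial>lborel) = 0"
    then have "AE x in lborel. ennreal (normal_density 0 (sqrt v) x) * indicator {a - d<..<a + d} x = 0"
      by (subst (asm) nn_integral_0_iff_AE) auto
    then have "AE x in lborel. x \<notin> {a - d<..<a + d}"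
    proof (rule AE_mp, intro AE_I2 impI)
      fix x assume "ennreal (normal_density 0 (sqrt v) x) * indicator {a - d<..<a + d} x = 0"
      moreover have "normal_density 0 (sqrt v) x > 0" using v by (intro normal_density_pos) auto
      ultimately show "x \<notin> {a - d<..<a + d}" by (auto simp: indicator_def split: if_splits)
    qed
    then have "emeasure lborel {x \<in> space lborel. \<not> x \<notin> {a - d<..<a + d}} = 0"
      by (subst (asm) AE_iff_measurable[OF _ refl]) auto
    also have "{x \<in> space lborel. \<not> x \<notin> {a - d<..<a + d}} = {a - d<..<a + d}" by auto
    finally have "emeasure lborel {a - d<..<a + d} = 0" .
    moreover have "emeasure lborel {a - d<..<a + d} = ennreal (a + d - (a - d))"
      by (rule emeasure_lborel_Ioo) (use d in simp)
    ultimately show False using d by simp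
  qed
  moreover have "X -` {a - d<..<a + d} \<inter> space M = {\<omega> \<in> space M. X \<omega> \<in> {a - d<..<a + d}}" by auto
  ultimately have "emeasure M {\<omega> \<in> space M. X \<omega> \<in> {a - d<..<a + d}} \<noteq> 0" by simp
  then show ?thesis by (simp add: emeasure_eq_measure zero_less_measure_iff)
qed

text \<open>If weighting by \<open>W\<close> multiplies the characteristic function of \<open>X\<close> by a constant, then it
multiplies the law of \<open>X\<close> by that constant: apply Levy's uniqueness theorem to the normalized
weighted measure. With \<open>W\<close> depending on another variable, this is how independence is derived from
one-dimensional characteristic functions.\<close>

lemma weighted_law:
  fixes W X :: "'a \<Rightarrow> real" and \<phi> :: "real \<Rightarrow> ennreal"
  assumes [measurable]: "W \<in> borel_measurable M" "X \<in> borel_measurable M" "\<phi> \<in> borel_measurable borel"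
    and W: "\<And>\<omega>. 0 \<le> W \<omega>" "\<And>\<omega>. W \<omega> \<le> B"
    and char: "\<And>s. (CLINT \<omega>|M. W \<omega> * iexp (s * X \<omega>)) = k * (CLINT \<omega>|M. iexp (s * X \<omega>))"
  shows "(\<integral>\<^sup>+\<omega>. ennreal (W \<omega>) * \<phi> (X \<omega>) \<partial>M) = ennreal k * (\<integral>\<^sup>+\<omega>. \<phi> (X \<omega>) \<partial>M)"
proof -
  have iW: "integrable M W" using W by (intro integrable_const_bound[of _ B]) auto
  have "complex_of_real (expectation W) = complex_of_real k" using char[of 0] prob_space by simp
  then have k: "expectation W = k" using of_real_eq_iff by blast
  have nnW: "(\<integral>\<^sup>+\<omega>. ennreal (W \<omega>) \<partial>M) = ennreal k"
    using nn_integral_eq_integral[OF iW] W k by simp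
  have k0: "k \<ge> 0" unfolding k[symmetric] using W by (intro Bochner_Integration.integral_nonneg) auto
  show ?thesis
  proof (cases "k = 0")
    case True
    then have "(\<integral>\<^sup>+\<omega>. ennreal (W \<omega>) \<partial>M) = 0" using nnW by simp
    then have "AE \<omega> in M. ennreal (W \<omega>) = 0" by (subst (asm) nn_integral_0_iff_AE) auto
    then have "(\<integral>\<^sup>+\<omega>. ennreal (W \<omega>) * \<phi> (X \<omega>) \<partial>M) = (\<integral>\<^sup>+\<omega>. 0 \<partial>M)"
      by (intro nn_integral_cong_AE) auto
    then show ?thesis using True by simp
  next
    case False
    then have kp: "k > 0" using k0 by simp
    let ?D = "density M (\<lambda>\<omega>. ennreal (W \<omega> / k))"
    have "emeasure ?D (space ?D) = 1"
    proof -
      have "emeasure ?D (space ?D) = (\<integral>\<^sup>+\<omega>. ennreal (W \<omega> / k) \<partial>M)"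
        by (subst emeasure_density) (auto intro!: nn_integral_cong)
      also have "\<dots> = (\<integral>\<^sup>+\<omega>. ennreal (1 / k) * ennreal (W \<omega>) \<partial>M)"
        using kp W by (intro nn_integral_cong) (simp add: ennreal_mult[symmetric])
      also have "\<dots> = 1" using kp by (subst nn_integral_cmult) (auto simp: nnW ennreal_mult[symmetric])
      finally show ?thesis .
    qed
    then interpret D: prob_space ?D by (rule prob_spaceI)
    have XD: "X \<in> borel_measurable ?D" by simp
    have "char (distr ?D borel X) s = char (distr M borel X) s" for s
    proof -
      have "char (distr ?D borel X) s = (CLINT \<omega>|?D. iexp (s * X \<omega>))"
        by (rule D.char_distr_eq[OF XD])
      also have "\<dots> = (CLINT \<omega>|M. (W \<omega> / k) *\<^sub>R iexp (s * X \<omega>))"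
        by (subst integral_density) (use W kp in auto)
      also have "\<dots> = (CLINT \<omega>|M. (1 / complex_of_real k) * (W \<omega> * iexp (s * X \<omega>)))"
        by (intro Bochner_Integration.integral_cong) (auto simp: scaleR_conv_of_real)
      also have "\<dots> = (1 / complex_of_real k) * (k * (CLINT \<omega>|M. iexp (s * X \<omega>)))"
        unfolding char[symmetric] by (rule integral_mult_right_zero)
      also have "\<dots> = char (distr M borel X) s"
        using kp by (subst char_distr_eq) auto
      finally show ?thesis .
    qed
    then have "distr ?D borel X = distr M borel X"
      by (intro Levy_uniqueness real_distribution_distr D.real_distribution_distr) auto
    then have "(\<integral>\<^sup>+x. \<phi> x \<partial>distr ?D borel X) = (\<integral>\<^sup>+x. \<phi> x \<partial>distr M borel X)" by simp
    then have "(\<integral>\<^sup>+\<omega>. \<phi> (X \<omega>) \<partial>?D) = (\<integral>\<^sup>+\<omega>. \<phi> (X \<omega>) \<partial>M)"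
      by (simp add: nn_integral_distr)
    then have "(\<integral>\<^sup>+\<omega>. ennreal (W \<omega> / k) * \<phi> (X \<omega>) \<partial>M) = (\<integral>\<^sup>+\<omega>. \<phi> (X \<omega>) \<partial>M)"
      by (simp add: nn_integral_density)
    then have "ennreal k * (\<integral>\<^sup>+\<omega>. \<phi> (X \<omega>) \<partial>M) = (\<integral>\<^sup>+\<omega>. ennreal k * (ennreal (W \<omega> / k) * \<phi> (X \<omega>)) \<partial>M)"
      by (subst nn_integral_cmult) auto
    also have "\<dots> = (\<integral>\<^sup>+\<omega>. ennreal (W \<omega>) * \<phi> (X \<omega>) \<partial>M)"
      using kp W by (intro nn_integral_cong) (simp add: mult.assoc[symmetric] ennreal_mult[symmetric])
    finally show ?thesis ..
  qed
qed

end

section \<open>The covariance on the circle as a mixture of trigonometric functions\<close>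

text \<open>The functions \<open>t \<mapsto> cas (n * t)\<close> for integers \<open>n\<close> form a real orthonormal system for the normalized
Lebesgue measure on the circle (the Hartley system). It has one function per integer, so that sine and
cosine need not be treated separately.\<close>

definition cas :: "real \<Rightarrow> real" where "cas x = cos x + sin x"

text \<open>The Skellam law of \<open>N = P - P'\<close> for independent Poisson variables \<open>P\<close> and \<open>P'\<close> of mean 1. Its
characteristic function is \<open>exp (cis x - 1) * exp (cis (- x) - 1) = exp (2 * cos x - 2)\<close>, which is
the covariance of the field at two points of the unit circle at angle \<open>x\<close>. So its point masses are
the variances of the Fourier coefficients.\<close>

definition difference_pmf :: "int pmf" where
  "difference_pmf = map_pmf (\<lambda>(p, q). int p - int q) (pair_pmf (poisson_pmf 1) (poisson_pmf 1))"

lemma abs_cas_le: "\<bar>cas x\<bar> \<le> 2"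
  unfolding cas_def using abs_cos_le_one[of x] abs_sin_le_one[of x] by linarith

lemma cas_mult: "cas x * cas y = cos (x - y) + sin (x + y)"
  unfolding cas_def cos_diff sin_add by (simp add: algebra_simps)

lemma integrable_pmf_bounded:
  fixes f :: "'a \<Rightarrow> 'b::{banach, second_countable_topology}"
  assumes "\<And>x. norm (f x) \<le> B"
  shows "integrable (measure_pmf p) f"
  using assms by (intro measure_pmf.integrable_const_bound[of _ B]) auto

lemma expectation_pair_pmf_bounded:
  fixes f :: "'a \<times> 'b \<Rightarrow> real"
  assumes "\<And>x. \<bar>f x\<bar> \<le> B"
  shows "measure_pmf.expectation (pair_pmf p q) f =
    measure_pmf.expectation p (\<lambda>x. measure_pmf.expectation q (\<lambda>y. f (x, y)))"
proof -
  have "pair_pmf p q = bind_pmf p (\<lambda>x. map_pmf (Pair x) q)"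
    by (simp add: pair_pmf_def map_pmf_def)
  then have "measure_pmf.expectation (pair_pmf p q) f =
      integral\<^sup>L (measure_pmf p \<bind> (\<lambda>x. measure_pmf (map_pmf (Pair x) q))) f"
    by (simp add: measure_pmf_bind)
  also have "\<dots> = measure_pmf.expectation p (\<lambda>x. measure_pmf.expectation (map_pmf (Pair x) q) f)"
    by (rule integral_bind[where K = "count_space UNIV" and B = B and B' = 1])
      (use assms in \<open>auto simp: measure_pmf.emeasure_space_1 measurable_def intro!: measure_pmf.finite_measure_axioms measure_pmf_in_subprob_algebra\<close>)
  finally show ?thesis by simp
qed

lemma poisson_cis:
  "measure_pmf.expectation (poisson_pmf 1) (\<lambda>p. cis (real p * x)) = exp (cis x - 1)"
proof -
  have eq: "pmf (poisson_pmf 1) p *\<^sub>R cis (real p * x) = exp (- 1) * ((cis x) ^ p /\<^sub>R fact p)" for p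
    by (simp add: Complex.DeMoivre scaleR_conv_of_real field_simps exp_of_real[symmetric])
  have s: "(\<lambda>p. exp (- 1) * ((cis x) ^ p /\<^sub>R fact p)) sums (exp (- 1) * exp (cis x))"
    by (intro sums_mult exp_converges)
  have "integrable (measure_pmf (poisson_pmf 1)) (\<lambda>p. cis (real p * x))"
    by (rule integrable_pmf_bounded[of _ 1]) simp
  then have i: "integrable (count_space UNIV) (\<lambda>p. pmf (poisson_pmf 1) p *\<^sub>R cis (real p * x))"
    unfolding measure_pmf_eq_density by (subst (asm) integrable_density) (auto simp: AE_count_space)
  have "measure_pmf.expectation (poisson_pmf 1) (\<lambda>p. cis (real p * x)) =
      (\<integral>p. pmf (poisson_pmf 1) p *\<^sub>R cis (real p * x) \<partial>count_space UNIV)"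
    unfolding measure_pmf_eq_density by (subst integral_density) (auto simp: AE_count_space)
  also have "\<dots> = suminf (\<lambda>p. pmf (poisson_pmf 1) p *\<^sub>R cis (real p * x))"
    by (rule integral_count_space_nat[OF i])
  also have "\<dots> = exp (- 1) * exp (cis x)" unfolding eq using s by (simp add: sums_iff)
  also have "\<dots> = exp (cis x - 1)" by (simp add: exp_add[symmetric])
  finally show ?thesis .
qed

lemma poisson_cos_sin:
  fixes x :: real
  defines "E \<equiv> measure_pmf.expectation (poisson_pmf 1)"
  shows "E (\<lambda>p. cos (real p * x)) = exp (cos x - 1) * cos (sin x)"
    and "E (\<lambda>p. sin (real p * x)) = exp (cos x - 1) * sin (sin x)"
proof -
  have i: "integrable (measure_pmf (poisson_pmf 1)) (\<lambda>p. cis (real p * x))"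
    by (rule integrable_pmf_bounded[of _ 1]) simp
  have "Re (measure_pmf.expectation (poisson_pmf 1) (\<lambda>p. cis (real p * x))) = E (\<lambda>p. cos (real p * x))"
    unfolding E_def using i by (simp flip: integral_Re)
  then show "E (\<lambda>p. cos (real p * x)) = exp (cos x - 1) * cos (sin x)"
    unfolding poisson_cis by (simp add: Re_exp)
  have "Im (measure_pmf.expectation (poisson_pmf 1) (\<lambda>p. cis (real p * x))) = E (\<lambda>p. sin (real p * x))"
    unfolding E_def using i by (simp flip: integral_Im)
  then show "E (\<lambda>p. sin (real p * x)) = exp (cos x - 1) * sin (sin x)"
    unfolding poisson_cis by (simp add: Im_exp)
qed

lemma integrable_trig_poisson:
  fixes x :: real
  shows
  "integrable (measure_pmf (poisson_pmf 1)) (\<lambda>p. cos (real p * x))"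
  "integrable (measure_pmf (poisson_pmf 1)) (\<lambda>p. sin (real p * x))"
  by (rule integrable_pmf_bounded[of _ 1], simp)+

lemma difference_cos_sin:
  fixes x :: real
  defines "E \<equiv> measure_pmf.expectation difference_pmf"
  shows "E (\<lambda>n. cos (of_int n * x)) = exp (2 * cos x - 2)" and "E (\<lambda>n. sin (of_int n * x)) = 0"
proof -
  let ?P = "measure_pmf.expectation (poisson_pmf 1)"
  let ?c = "exp (cos x - 1) * cos (sin x)" and ?s = "exp (cos x - 1) * sin (sin x)"
  have "E (\<lambda>n. cos (of_int n * x)) =
      measure_pmf.expectation (pair_pmf (poisson_pmf 1) (poisson_pmf 1)) (\<lambda>z. cos (of_int (int (fst z) - int (snd z)) * x))"
    unfolding E_def difference_pmf_def by (simp add: case_prod_unfold)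
  also have "\<dots> = ?P (\<lambda>p. ?P (\<lambda>q. cos (real p * x) * cos (real q * x) + sin (real p * x) * sin (real q * x)))"
    by (subst expectation_pair_pmf_bounded[of _ 1], simp) (simp add: left_diff_distrib cos_diff)
  also have "\<dots> = ?P (\<lambda>p. cos (real p * x) * ?c + sin (real p * x) * ?s)"
    by (simp add: integrable_trig_poisson poisson_cos_sin)
  also have "\<dots> = ?c * ?c + ?s * ?s"
    by (simp add: integrable_trig_poisson poisson_cos_sin)
  also have "\<dots> = (exp (cos x - 1) * exp (cos x - 1)) * ((cos (sin x))\<^sup>2 + (sin (sin x))\<^sup>2)"
    by (simp only: power2_eq_square algebra_simps)
  also have "\<dots> = exp (2 * cos x - 2)" by (simp add: exp_add[symmetric])
  finally show "E (\<lambda>n. cos (of_int n * x)) = exp (2 * cos x - 2)" .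
  have "E (\<lambda>n. sin (of_int n * x)) =
      measure_pmf.expectation (pair_pmf (poisson_pmf 1) (poisson_pmf 1)) (\<lambda>z. sin (of_int (int (fst z) - int (snd z)) * x))"
    unfolding E_def difference_pmf_def by (simp add: case_prod_unfold)
  also have "\<dots> = ?P (\<lambda>p. ?P (\<lambda>q. sin (real p * x) * cos (real q * x) - cos (real p * x) * sin (real q * x)))"
    by (subst expectation_pair_pmf_bounded[of _ 1], simp) (simp add: left_diff_distrib sin_diff)
  also have "\<dots> = ?P (\<lambda>p. sin (real p * x) * ?c - cos (real p * x) * ?s)"
    by (simp add: integrable_trig_poisson poisson_cos_sin)
  also have "\<dots> = 0"
    by (simp add: integrable_trig_poisson poisson_cos_sin)
  finally show "E (\<lambda>n. sin (of_int n * x)) = 0" .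
qed

text \<open>The product of two values of \<open>cas\<close> is \<open>cos (n * (s - t)) + sin (n * (s + t))\<close>, and the second term is
odd in \<open>n\<close>, hence has mean zero.\<close>

lemma difference_cas:
  "measure_pmf.expectation difference_pmf (\<lambda>n. cas (of_int n * s) * cas (of_int n * t)) = exp (2 * cos (s - t) - 2)"
proof -
  have eq: "cas (of_int n * s) * cas (of_int n * t) = cos (of_int n * (s - t)) + sin (of_int n * (s + t))" for n :: int
    by (simp only: cas_mult right_diff_distrib distrib_left)
  have "integrable (measure_pmf difference_pmf) (\<lambda>n. cos (of_int n * (s - t)))"
    "integrable (measure_pmf difference_pmf) (\<lambda>n. sin (of_int n * (s + t)))"
    by (rule integrable_pmf_bounded[of _ 1], simp)+
  then show ?thesis unfolding eq by (simp add: difference_cos_sin)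
qed

lemma pmf_difference_pos: "pmf difference_pmf n > 0"
proof -
  have "n \<in> set_pmf difference_pmf"
    unfolding difference_pmf_def
    by (simp, rule image_eqI[of _ _ "(nat n, nat (- n))"]) auto
  then show ?thesis by (simp add: pmf_positive)
qed

lemma difference_exponential_moment:
  "(\<integral>\<^sup>+n. ennreal (16 ^ nat \<bar>n\<bar>) \<partial>measure_pmf difference_pmf) \<le> ennreal (exp 30)"
proof -
  let ?I = "\<integral>\<^sup>+p. ennreal (16 ^ p) \<partial>measure_pmf (poisson_pmf 1)"
  have "?I = (\<integral>\<^sup>+p. ennreal (pmf (poisson_pmf 1) p) * ennreal (16 ^ p) \<partial>count_space UNIV)"
    by (rule nn_integral_measure_pmf)
  also have "\<dots> = suminf (\<lambda>p. ennreal (pmf (poisson_pmf 1) p) * ennreal (16 ^ p))"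
    by (rule nn_integral_count_space_nat)
  also have "\<dots> = suminf (\<lambda>p. ennreal (exp (- 1) * (16 ^ p /\<^sub>R fact p)))"
    by (intro suminf_cong) (simp add: ennreal_mult[symmetric] field_simps)
  also have "\<dots> = ennreal (exp (- 1) * exp 16)"
    by (intro suminf_ennreal_eq sums_mult exp_converges) auto
  finally have I: "?I = ennreal (exp 15)" by (simp add: exp_add[symmetric])
  have "(\<integral>\<^sup>+n. ennreal (16 ^ nat \<bar>n\<bar>) \<partial>measure_pmf difference_pmf) \<le>
      (\<integral>\<^sup>+z. ennreal (16 ^ fst z) * ennreal (16 ^ snd z) \<partial>measure_pmf (pair_pmf (poisson_pmf 1) (poisson_pmf 1)))"
    unfolding difference_pmf_def nn_integral_map_pmf
    by (intro nn_integral_mono) (auto simp: case_prod_unfold ennreal_mult[symmetric] power_add[symmetric] intro!: ennreal_leI power_increasing)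
  also have "\<dots> = ?I * ?I"
    by (subst nn_integral_pair_pmf') (simp add: nn_integral_cmult nn_integral_multc)
  also have "\<dots> = ennreal (exp 30)" unfolding I by (simp add: ennreal_mult[symmetric] exp_add[symmetric])
  finally show ?thesis .
qed

text \<open>Markov's inequality for the exponential moment \<open>16 ^ \<bar>N\<bar>\<close>. The rate is chosen such that the
standard deviations of the Fourier coefficients, of order \<open>(1/4) ^ \<bar>n\<bar>\<close>, still beat the factor \<open>\<bar>n\<bar>\<close> that a
derivative costs.\<close>

lemma difference_prob_le:
  assumes "\<And>n. n \<in> A \<Longrightarrow> m \<le> nat \<bar>n\<bar>"
  shows "measure_pmf.prob difference_pmf A \<le> exp 30 * (1/16) ^ m"
proof -
  have "ennreal (16 ^ m * measure_pmf.prob difference_pmf A) = (\<integral>\<^sup>+k. ennreal (16 ^ m) * indicator A k \<partial>measure_pmf difference_pmf)"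
    by (subst nn_integral_cmult_indicator) (auto simp: measure_pmf.emeasure_eq_measure ennreal_mult)
  also have "\<dots> \<le> (\<integral>\<^sup>+k. ennreal (16 ^ nat \<bar>k\<bar>) \<partial>measure_pmf difference_pmf)"
    using assms by (intro nn_integral_mono) (auto simp: indicator_def intro!: ennreal_leI power_increasing)
  also note difference_exponential_moment
  finally have "16 ^ m * measure_pmf.prob difference_pmf A \<le> exp 30" by simp
  then show ?thesis by (simp add: field_simps)
qed

section \<open>Fourier coefficients of the Gaussian process on the circle\<close>

lemma abs_cas_mult_le: "\<bar>cas x * cas y\<bar> \<le> 4"
  using mult_mono[OF abs_cas_le[of x] abs_cas_le[of y]] by (simp add: abs_mult)

lemma square_le_if_abs_le: "\<bar>x\<bar> \<le> B \<Longrightarrow> x\<^sup>2 \<le> B\<^sup>2" for x B :: real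
  by (metis abs_ge_zero power2_abs power_mono)

text \<open>By the mean value theorem, each increment of the antiderivative \<open>G\<close> over a cell is a value of \<open>g\<close> in
the cell times the mesh.\<close>

lemma Riemann_sums_converge:
  fixes g G :: "real \<Rightarrow> real"
  assumes g: "continuous_on {0..b} g" and b: "b > 0"
    and G: "\<And>x. x \<in> {0..b} \<Longrightarrow> (G has_real_derivative g x) (at x within {0..b})"
  shows "(\<lambda>m. (\<Sum>k<m. g (b * real k / real m)) / real m) \<longlonglongrightarrow> (G b - G 0) / b"
proof (rule LIMSEQ_I)
  fix e :: real assume e: "e > 0"
  have "uniformly_continuous_on {0..b} g" using g by (intro compact_uniformly_continuous) auto
  then obtain d where d: "d > 0" "\<And>x y. x \<in> {0..b} \<Longrightarrow> y \<in> {0..b} \<Longrightarrow> dist y x < d \<Longrightarrow> dist (g y) (g x) < e / 2"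
    unfolding uniformly_continuous_on_def using e by (meson half_gt_zero)
  obtain m0 :: nat where m0: "b / d < real m0" using reals_Archimedean2 by blast
  have m0p: "m0 > 0" using m0 b d(1) by (metis divide_pos_pos gr0I less_trans of_nat_0 order_less_irrefl)
  have "norm ((\<Sum>k<m. g (b * real k / real m)) / real m - (G b - G 0) / b) < e" if m: "m \<ge> m0" for m
  proof -
    have mp: "real m > 0" using m m0p by simp
    have bm: "b / real m < d"
    proof -
      have "b / d < real m" using m0 m by linarith
      then show ?thesis using d(1) mp by (simp add: field_simps)
    qed
    define \<tau> where "\<tau> = (\<lambda>k. b * real k / real m)"
    have \<tau>: "\<tau> k \<in> {0..b}" if "k \<le> m" for k using that mp b by (auto simp: \<tau>_def field_simps)
    have \<tau>Suc: "\<tau> (Suc k) - \<tau> k = b / m" for k by (simp add: \<tau>_def algebra_simps add_divide_distrib)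
    have "\<exists>x. x \<in> {\<tau> k..\<tau> (Suc k)} \<and> G (\<tau> (Suc k)) - G (\<tau> k) = g x * (b / m)" if k: "k < m" for k
    proof -
      have sub: "{\<tau> k..\<tau> (Suc k)} \<subseteq> {0..b}" using \<tau>[of k] \<tau>[of "Suc k"] k by auto
      have "\<exists>x\<in>{\<tau> k..\<tau> (Suc k)}. G (\<tau> (Suc k)) - G (\<tau> k) = (\<lambda>h. g x * h) (\<tau> (Suc k) - \<tau> k)"
      proof (rule mvt_very_simple)
        show "\<tau> k \<le> \<tau> (Suc k)" using \<tau>Suc[of k] b mp by (smt (verit) divide_pos_pos)
        fix x assume "\<tau> k \<le> x" "x \<le> \<tau> (Suc k)"
        then have "(G has_real_derivative g x) (at x within {\<tau> k..\<tau> (Suc k)})"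
          using sub by (intro DERIV_subset[OF G]) auto
        then show "(G has_derivative (\<lambda>h. g x * h)) (at x within {\<tau> k..\<tau> (Suc k)})"
          unfolding has_field_derivative_def .
      qed
      then show ?thesis unfolding \<tau>Suc by blast
    qed
    then obtain \<xi> where \<xi>: "\<And>k. k < m \<Longrightarrow> \<xi> k \<in> {\<tau> k..\<tau> (Suc k)}"
      "\<And>k. k < m \<Longrightarrow> G (\<tau> (Suc k)) - G (\<tau> k) = g (\<xi> k) * (b / m)" by metis
    have "G b - G 0 = G (\<tau> m) - G (\<tau> 0)" using mp by (simp add: \<tau>_def)
    also have "\<dots> = (\<Sum>k<m. G (\<tau> (Suc k)) - G (\<tau> k))" by (rule sum_lessThan_telescope[symmetric])
    also have "\<dots> = (\<Sum>k<m. g (\<xi> k) * (b / m))" using \<xi>(2) by (intro sum.cong) auto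
    also have "\<dots> = (\<Sum>k<m. g (\<xi> k)) * (b / m)" by (simp only: sum_distrib_right)
    finally have "(G b - G 0) / b = (\<Sum>k<m. g (\<xi> k)) / m"
      using b by simp
    then have "(\<Sum>k<m. g (\<tau> k)) / m - (G b - G 0) / b = (\<Sum>k<m. g (\<tau> k) - g (\<xi> k)) / m"
      by (simp add: sum_subtractf diff_divide_distrib)
    moreover have "\<bar>\<Sum>k<m. g (\<tau> k) - g (\<xi> k)\<bar> \<le> (\<Sum>k<m. e / 2)"
    proof (rule order_trans[OF sum_abs], rule sum_mono)
      fix k assume k: "k \<in> {..<m}"
      then have i: "\<tau> k \<in> {0..b}" "\<xi> k \<in> {0..b}"
        using \<tau>[of k] \<tau>[of "Suc k"] \<xi>(1)[of k] by auto
      have "dist (\<tau> k) (\<xi> k) < d" using \<xi>(1)[of k] \<tau>Suc[of k] bm k by (auto simp: dist_real_def)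
      then show "\<bar>g (\<tau> k) - g (\<xi> k)\<bar> \<le> e / 2" using d(2)[OF i(2) i(1)] by (simp add: dist_real_def)
    qed
    ultimately have "\<bar>(\<Sum>k<m. g (\<tau> k)) / m - (G b - G 0) / b\<bar> \<le> e / 2"
      using mp by (simp add: field_simps)
    then show ?thesis using e unfolding \<tau>_def by simp
  qed
  then show "\<exists>m0. \<forall>m\<ge>m0. norm ((\<Sum>k<m. g (b * real k / real m)) / real m - (G b - G 0) / b) < e" by blast
qed

lemma cas_orthonormal:
  "(\<lambda>m. (\<Sum>k<m. cas (of_int n * (2 * pi * real k / real m)) * cas (of_int n' * (2 * pi * real k / real m))) / real m)
     \<longlonglongrightarrow> (if n = n' then 1 else 0)"
proof -
  define A :: "int \<Rightarrow> real \<Rightarrow> real" where "A = (\<lambda>j t. if j = 0 then t else sin (of_int j * t) / of_int j)"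
  define B :: "int \<Rightarrow> real \<Rightarrow> real" where "B = (\<lambda>j t. if j = 0 then 0 else - cos (of_int j * t) / of_int j)"
  have A: "(A j has_real_derivative cos (of_int j * t)) (at t within S)" for j t S
    unfolding A_def by (cases "j = 0") (auto intro!: derivative_eq_intros)
  have B: "(B j has_real_derivative sin (of_int j * t)) (at t within S)" for j t S
    unfolding B_def by (cases "j = 0") (auto intro!: derivative_eq_intros)
  have eq: "cas (of_int n * t) * cas (of_int n' * t) = cos (of_int (n - n') * t) + sin (of_int (n + n') * t)" for t
    by (simp only: cas_mult of_int_diff of_int_add left_diff_distrib distrib_right)
  have c4: "cos (4 * (real_of_int n' * pi)) = 1" using cos_int_2pin[of "2 * n'"] by (simp add: mult_ac)
  have "(\<lambda>m. (\<Sum>k<m. cas (of_int n * (2 * pi * real k / real m)) * cas (of_int n' * (2 * pi * real k / real m))) / real m)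
     \<longlonglongrightarrow> ((A (n - n') (2 * pi) + B (n + n') (2 * pi)) - (A (n - n') 0 + B (n + n') 0)) / (2 * pi)"
  proof (rule Riemann_sums_converge)
    show "continuous_on {0..2 * pi} (\<lambda>t. cas (of_int n * t) * cas (of_int n' * t))"
      unfolding cas_def by (intro continuous_intros)
    show "((\<lambda>t. A (n - n') t + B (n + n') t) has_real_derivative cas (of_int n * t) * cas (of_int n' * t)) (at t within {0..2 * pi})" for t
      unfolding eq by (intro DERIV_add A B)
  qed simp
  moreover have "sin (of_int j * (2 * pi)) = 0" "cos (of_int j * (2 * pi)) = 1" for j :: int
    using sin_int_2pin[of j] cos_int_2pin[of j] by (simp_all add: mult.commute)
  then have "((A (n - n') (2 * pi) + B (n + n') (2 * pi)) - (A (n - n') 0 + B (n + n') 0)) / (2 * pi) = (if n = n' then 1 else 0)"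
    unfolding A_def B_def using c4 by (simp del: of_int_diff of_int_add)
  ultimately show ?thesis by simp
qed

type_synonym spectrum = "3 \<Rightarrow> int \<Rightarrow> real"

text \<open>The variance of a linear functional of the process in terms of its action \<open>c i n\<close> on the function
\<open>t \<mapsto> cas (n * t)\<close> in the coordinate \<open>i\<close>.\<close>

definition spectral_energy :: "spectrum \<Rightarrow> real" where
  "spectral_energy c = (\<Sum>i\<in>UNIV. measure_pmf.expectation difference_pmf (\<lambda>n. (c i n)\<^sup>2))"

locale circle_process = prob_space M for M :: "'w measure" +
  fixes X :: "3 \<Rightarrow> real \<Rightarrow> 'w \<Rightarrow> real"
  assumes meas[measurable]: "\<And>i t. X i t \<in> borel_measurable M"
    and gaussian: "\<And>l. gaussian_rv M (\<lambda>\<omega>. \<Sum>(a, i, t)\<leftarrow>l. a * X i t \<omega>)"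
    and integrable_X: "\<And>i t. integrable M (X i t)"
    and centered: "\<And>i t. expectation (X i t) = 0"
    and integrable_XX: "\<And>i s j t. integrable M (\<lambda>\<omega>. X i s \<omega> * X j t \<omega>)"
    and cov: "\<And>i s j t. expectation (\<lambda>\<omega>. X i s \<omega> * X j t \<omega>) = (if i = j then exp (2 * cos (s - t) - 2) else 0)"
    and cont: "\<And>i \<omega>. \<omega> \<in> space M \<Longrightarrow> continuous_on UNIV (\<lambda>t. X i t \<omega>)"
begin

definition comb :: "(real \<times> 3 \<times> real) list \<Rightarrow> 'w \<Rightarrow> real" where
  "comb l \<omega> = (\<Sum>(a, i, t)\<leftarrow>l. a * X i t \<omega>)"

definition spec :: "(real \<times> 3 \<times> real) list \<Rightarrow> spectrum" where
  "spec l i n = (\<Sum>(a, j, t)\<leftarrow>l. if j = i then a * cas (of_int n * t) else 0)"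

lemma comb_simps [simp]: "comb [] \<omega> = 0" "comb ((a, i, t) # l) \<omega> = a * X i t \<omega> + comb l \<omega>"
  "comb (l @ l') \<omega> = comb l \<omega> + comb l' \<omega>"
  by (simp_all add: comb_def)

lemma spec_simps [simp]: "spec [] i n = 0"
  "spec ((a, j, t) # l) i n = (if j = i then a * cas (of_int n * t) else 0) + spec l i n"
  "spec (l @ l') i n = spec l i n + spec l' i n"
  by (simp_all add: spec_def)

lemma spec_bounded: "\<exists>B. \<forall>i n. \<bar>spec l i n\<bar> \<le> B"
proof (induction l)
  case (Cons p l)
  obtain a j t where p: "p = (a, j, t)" by (cases p)
  obtain B where B: "\<And>i n. \<bar>spec l i n\<bar> \<le> B" using Cons by blast
  have "\<bar>spec (p # l) i n\<bar> \<le> \<bar>a\<bar> * 2 + B" for i n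
  proof -
    have "\<bar>if j = i then a * cas (of_int n * t) else 0\<bar> \<le> \<bar>a\<bar> * 2"
      using abs_cas_le by (auto simp: abs_mult intro: mult_left_mono)
    then show ?thesis unfolding p spec_simps using B[of i n] abs_triangle_ineq by (smt (verit))
  qed
  then show ?case by blast
qed (auto intro: exI[of _ 0])

lemma integrable_spec_mult:
  fixes f :: "int \<Rightarrow> real"
  assumes "\<And>n. \<bar>f n\<bar> \<le> C"
  shows "integrable (measure_pmf difference_pmf) (\<lambda>n. spec l i n * f n)"
proof -
  obtain B where B: "\<And>i n. \<bar>spec l i n\<bar> \<le> B" using spec_bounded by blast
  show ?thesis
  proof (rule integrable_pmf_bounded)
    fix n
    show "norm (spec l i n * f n) \<le> B * C" using B[of i n] assms[of n]
      by (auto simp: abs_mult intro!: mult_mono order_trans[OF abs_ge_zero])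
  qed
qed

lemma comb_X:
  "integrable M (\<lambda>\<omega>. comb l \<omega> * X j t \<omega>) \<and>
   expectation (\<lambda>\<omega>. comb l \<omega> * X j t \<omega>) = measure_pmf.expectation difference_pmf (\<lambda>n. spec l j n * cas (of_int n * t))"
proof (induction l)
  case (Cons p l)
  obtain a i s where p: "p = (a, i, s)" by (cases p)
  have e1: "comb (p # l) \<omega> * X j t \<omega> = a * (X i s \<omega> * X j t \<omega>) + comb l \<omega> * X j t \<omega>" for \<omega>
    unfolding p by (simp add: algebra_simps)
  have e2: "spec (p # l) j n * cas (of_int n * t) =
      (if i = j then a else 0) * (cas (of_int n * s) * cas (of_int n * t)) + spec l j n * cas (of_int n * t)" for n
    unfolding p by (simp add: algebra_simps)
  have i1: "integrable (measure_pmf difference_pmf) (\<lambda>n. cas (of_int n * s) * cas (of_int n * t))"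
    by (rule integrable_pmf_bounded[of _ 4]) (simp add: abs_cas_mult_le)
  have i2: "integrable (measure_pmf difference_pmf) (\<lambda>n. spec l j n * cas (of_int n * t))"
    by (rule integrable_spec_mult[OF abs_cas_le])
  show ?case unfolding e1 e2 using Cons integrable_XX i1 i2 by (simp add: cov difference_cas)
qed simp

text \<open>The covariance of two finite linear combinations of the process is the mean, with respect to the
Skellam law, of the product of their spectra. This is the mixture representation of the covariance
function.\<close>

lemma comb_comb:
  "integrable M (\<lambda>\<omega>. comb l \<omega> * comb m \<omega>) \<and>
   expectation (\<lambda>\<omega>. comb l \<omega> * comb m \<omega>) = (\<Sum>i\<in>UNIV. measure_pmf.expectation difference_pmf (\<lambda>n. spec l i n * spec m i n))"
proof (induction m)
  case (Cons p m)
  obtain a j t where p: "p = (a, j, t)" by (cases p)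
  have e1: "comb l \<omega> * comb (p # m) \<omega> = a * (comb l \<omega> * X j t \<omega>) + comb l \<omega> * comb m \<omega>" for \<omega>
    unfolding p by (simp add: algebra_simps)
  have e2: "spec l i n * spec (p # m) i n =
      (if j = i then a else 0) * (spec l i n * cas (of_int n * t)) + spec l i n * spec m i n" for i n
    unfolding p by (simp add: algebra_simps)
  have i1: "integrable (measure_pmf difference_pmf) (\<lambda>n. spec l i n * cas (of_int n * t))" for i
    by (rule integrable_spec_mult[OF abs_cas_le])
  obtain B where B: "\<And>i n. \<bar>spec m i n\<bar> \<le> B" using spec_bounded by blast
  have i2: "integrable (measure_pmf difference_pmf) (\<lambda>n. spec l i n * spec m i n)" for i
    by (rule integrable_spec_mult[OF B])
  have "(\<Sum>i\<in>UNIV. measure_pmf.expectation difference_pmf (\<lambda>n. spec l i n * spec (p # m) i n)) =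
      (\<Sum>i\<in>UNIV. (if j = i then a * measure_pmf.expectation difference_pmf (\<lambda>n. spec l i n * cas (of_int n * t)) else 0)) +
      (\<Sum>i\<in>UNIV. measure_pmf.expectation difference_pmf (\<lambda>n. spec l i n * spec m i n))"
    unfolding e2 sum.distrib[symmetric] using i1 i2 by (intro sum.cong) auto
  also have "(\<Sum>i\<in>UNIV. (if j = i then a * measure_pmf.expectation difference_pmf (\<lambda>n. spec l i n * cas (of_int n * t)) else 0)) =
      a * measure_pmf.expectation difference_pmf (\<lambda>n. spec l j n * cas (of_int n * t))"
    by simp
  finally show ?case unfolding e1 using Cons comb_X[of l j t] by simp
qed simp

lemma comb_centered: "integrable M (comb l) \<and> expectation (comb l) = 0"
proof (induction l)
  case (Cons p l)
  obtain a i t where p: "p = (a, i, t)" by (cases p)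
  have "comb (p # l) = (\<lambda>\<omega>. a * X i t \<omega> + comb l \<omega>)" unfolding p by (rule ext) simp
  then show ?case using Cons integrable_X by (simp add: centered)
qed (simp add: comb_def[abs_def])

lemma char_gauss_comb: "char_gauss (comb l) (spectral_energy (spec l))"
proof -
  have "gaussian_rv M (comb l)" using gaussian[of l] unfolding comb_def[abs_def] .
  from gaussian_rv_imp_char_gauss(2)[OF this] have "char_gauss (comb l) (expectation (\<lambda>\<omega>. comb l \<omega> * comb l \<omega>))"
    using comb_centered by (simp add: power2_eq_square)
  then show ?thesis using comb_comb[of l l] unfolding spectral_energy_def by (simp add: power2_eq_square)
qed

text \<open>The linear functionals of the process that are pointwise limits of finite combinations with
uniformly bounded spectra. Evaluations and Fourier coefficients belong to this class, the class is
a vector space, and the spectrum determines the law.\<close>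

definition has_spectrum :: "('w \<Rightarrow> real) \<Rightarrow> spectrum \<Rightarrow> bool" where
  "has_spectrum S c \<longleftrightarrow> (\<exists>ls B. (\<forall>\<omega>\<in>space M. (\<lambda>m. comb (ls m) \<omega>) \<longlonglongrightarrow> S \<omega>) \<and>
     (\<forall>i n. (\<lambda>m. spec (ls m) i n) \<longlonglongrightarrow> c i n) \<and> (\<forall>m i n. \<bar>spec (ls m) i n\<bar> \<le> B))"

lemma has_spectrum_bounded: "has_spectrum S c \<Longrightarrow> \<exists>B. \<forall>i n. \<bar>c i n\<bar> \<le> B"
proof -
  assume "has_spectrum S c"
  then obtain ls B where "\<And>i n. (\<lambda>m. spec (ls m) i n) \<longlonglongrightarrow> c i n" "\<And>m i n. \<bar>spec (ls m) i n\<bar> \<le> B"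
    unfolding has_spectrum_def by blast
  then have "\<bar>c i n\<bar> \<le> B" for i n
    using LIMSEQ_le_const2[OF tendsto_rabs] by blast
  then show ?thesis by blast
qed

lemma has_spectrum_add:
  assumes "has_spectrum S c" "has_spectrum S' c'"
  shows "has_spectrum (\<lambda>\<omega>. S \<omega> + S' \<omega>) (\<lambda>i n. c i n + c' i n)"
proof -
  obtain ls B where 1: "\<And>\<omega>. \<omega> \<in> space M \<Longrightarrow> (\<lambda>m. comb (ls m) \<omega>) \<longlonglongrightarrow> S \<omega>"
    "\<And>i n. (\<lambda>m. spec (ls m) i n) \<longlonglongrightarrow> c i n" "\<And>m i n. \<bar>spec (ls m) i n\<bar> \<le> B"
    using assms(1) unfolding has_spectrum_def by blast
  obtain ls' B' where 2: "\<And>\<omega>. \<omega> \<in> space M \<Longrightarrow> (\<lambda>m. comb (ls' m) \<omega>) \<longlonglongrightarrow> S' \<omega>"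
    "\<And>i n. (\<lambda>m. spec (ls' m) i n) \<longlonglongrightarrow> c' i n" "\<And>m i n. \<bar>spec (ls' m) i n\<bar> \<le> B'"
    using assms(2) unfolding has_spectrum_def by blast
  show ?thesis unfolding has_spectrum_def
  proof (intro exI[of _ "\<lambda>m. ls m @ ls' m"] exI[of _ "B + B'"] conjI ballI allI)
    fix m i n show "\<bar>spec (ls m @ ls' m) i n\<bar> \<le> B + B'"
      using 1(3)[of m i n] 2(3)[of m i n] by simp
  qed (auto intro!: tendsto_add 1 2)
qed

lemma has_spectrum_scale:
  assumes "has_spectrum S c"
  shows "has_spectrum (\<lambda>\<omega>. r * S \<omega>) (\<lambda>i n. r * c i n)"
proof -
  obtain ls B where 1: "\<And>\<omega>. \<omega> \<in> space M \<Longrightarrow> (\<lambda>m. comb (ls m) \<omega>) \<longlonglongrightarrow> S \<omega>"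
    "\<And>i n. (\<lambda>m. spec (ls m) i n) \<longlonglongrightarrow> c i n" "\<And>m i n. \<bar>spec (ls m) i n\<bar> \<le> B"
    using assms(1) unfolding has_spectrum_def by blast
  define sc where "sc = map (\<lambda>(a, i :: 3, t :: real). (r * a, i, t))"
  have c: "comb (sc l) \<omega> = r * comb l \<omega>" for l \<omega>
    by (induction l) (auto simp: sc_def algebra_simps)
  have s: "spec (sc l) i n = r * spec l i n" for l i n
    by (induction l) (auto simp: sc_def algebra_simps)
  show ?thesis unfolding has_spectrum_def
  proof (intro exI[of _ "\<lambda>m. sc (ls m)"] exI[of _ "\<bar>r\<bar> * B"] conjI ballI allI)
    fix m i n show "\<bar>spec (sc (ls m)) i n\<bar> \<le> \<bar>r\<bar> * B"
      using 1(3)[of m i n] unfolding s abs_mult by (intro mult_left_mono) auto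
  qed (auto simp: c s intro!: tendsto_mult_left 1)
qed

lemma has_spectrum_zero: "has_spectrum (\<lambda>\<omega>. 0) (\<lambda>i n. 0)"
  unfolding has_spectrum_def by (intro exI[of _ "\<lambda>_. []"] exI[of _ 0]) auto

lemma has_spectrum_sum:
  assumes "finite K" "\<And>k. k \<in> K \<Longrightarrow> has_spectrum (S k) (c k)"
  shows "has_spectrum (\<lambda>\<omega>. \<Sum>k\<in>K. S k \<omega>) (\<lambda>i n. \<Sum>k\<in>K. c k i n)"
  using assms
proof (induction K rule: finite_induct)
  case empty then show ?case using has_spectrum_zero by simp
next
  case (insert k K)
  then show ?case using has_spectrum_add[of "S k" "c k"] by simp
qed

lemma has_spectrum_X: "has_spectrum (X i t) (\<lambda>j n. if j = i then cas (of_int n * t) else 0)"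
  unfolding has_spectrum_def
  by (intro exI[of _ "\<lambda>_. [(1, i, t)]"] exI[of _ 2]) (auto simp: abs_cas_le)

lemma has_spectrum_imp_char_gauss:
  assumes "has_spectrum S c"
  shows "char_gauss S (spectral_energy c)"
proof -
  obtain ls B where 1: "\<And>\<omega>. \<omega> \<in> space M \<Longrightarrow> (\<lambda>m. comb (ls m) \<omega>) \<longlonglongrightarrow> S \<omega>"
    "\<And>i n. (\<lambda>m. spec (ls m) i n) \<longlonglongrightarrow> c i n" "\<And>m i n. \<bar>spec (ls m) i n\<bar> \<le> B"
    using assms(1) unfolding has_spectrum_def by blast
  have lim: "(\<lambda>m. spectral_energy (spec (ls m))) \<longlonglongrightarrow> spectral_energy c"
    unfolding spectral_energy_def
  proof (intro tendsto_sum integral_dominated_convergence[where w = "\<lambda>_. B\<^sup>2"])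
    fix i
    show "AE n in measure_pmf difference_pmf. (\<lambda>m. (spec (ls m) i n)\<^sup>2) \<longlonglongrightarrow> (c i n)\<^sup>2"
      by (intro AE_I2 tendsto_power 1)
    fix m show "AE n in measure_pmf difference_pmf. norm ((spec (ls m) i n)\<^sup>2) \<le> B\<^sup>2"
      using square_le_if_abs_le[OF 1(3)[of m i]] by (intro AE_I2) simp
  qed auto
  show ?thesis by (rule char_gauss_limit[OF char_gauss_comb _ lim]) (rule 1(1))
qed

text \<open>The Fourier coefficient \<open>1 / (2 * pi) * \<integral> cas (n * t) * X i t \<omega> dt\<close> over one period, written as the
limit of Riemann sums since these are finite combinations of the process.\<close>

definition Z :: "3 \<Rightarrow> int \<Rightarrow> 'w \<Rightarrow> real" where
  "Z i n \<omega> = lim (\<lambda>m. (\<Sum>k<m. cas (of_int n * (2 * pi * real k / real m)) * X i (2 * pi * real k / real m) \<omega>) / real m)"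

lemma has_spectrum_Z: "has_spectrum (Z i n) (\<lambda>j k. if j = i \<and> k = n then 1 else 0)"
proof -
  define \<tau> where "\<tau> = (\<lambda>(m::nat) (k::nat). 2 * pi * real k / real m)"
  define ls where "ls = (\<lambda>m. map (\<lambda>k. (cas (of_int n * \<tau> m k) / real m, i, \<tau> m k)) [0..<m])"
  have sl: "(\<Sum>k\<leftarrow>[0..<m]. g k) = (\<Sum>k<m. g k)" for g :: "nat \<Rightarrow> real" and m
    by (simp add: interv_sum_list_conv_sum_set_nat atLeast0LessThan)
  have c: "comb (ls m) \<omega> = (\<Sum>k<m. cas (of_int n * \<tau> m k) * X i (\<tau> m k) \<omega>) / real m" for m \<omega>
    unfolding comb_def ls_def by (simp add: comp_def sl sum_divide_distrib)
  have s: "spec (ls m) j p = (if j = i then (\<Sum>k<m. cas (of_int n * \<tau> m k) * cas (of_int p * \<tau> m k)) / real m else 0)" for m j p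
    unfolding spec_def ls_def by (simp add: comp_def sl sum_divide_distrib)
  show ?thesis unfolding has_spectrum_def
  proof (intro exI[of _ ls] exI[of _ 4] conjI ballI allI)
    fix \<omega> assume \<omega>: "\<omega> \<in> space M"
    have "continuous_on UNIV (\<lambda>t. cas (of_int n * t) * X i t \<omega>)"
      unfolding cas_def by (intro continuous_intros cont[OF \<omega>])
    then have co: "continuous_on {0..2 * pi} (\<lambda>t. cas (of_int n * t) * X i t \<omega>)" by (rule continuous_on_subset) auto
    obtain G where G: "\<And>x. x \<in> {0..2 * pi} \<Longrightarrow> (G has_vector_derivative cas (of_int n * x) * X i x \<omega>) (at x within {0..2 * pi})"
      using antiderivative_continuous[OF co] by blast
    have l: "(\<lambda>m. comb (ls m) \<omega>) \<longlonglongrightarrow> (G (2 * pi) - G 0) / (2 * pi)"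
      unfolding c \<tau>_def
      by (rule Riemann_sums_converge[OF co]) (use G in \<open>auto simp: has_real_derivative_iff_has_vector_derivative\<close>)
    have "Z i n \<omega> = (G (2 * pi) - G 0) / (2 * pi)"
      unfolding Z_def by (rule limI[OF l[unfolded c \<tau>_def]])
    then show "(\<lambda>m. comb (ls m) \<omega>) \<longlonglongrightarrow> Z i n \<omega>" using l by simp
  next
    fix j p
    show "(\<lambda>m. spec (ls m) j p) \<longlonglongrightarrow> (if j = i \<and> p = n then 1 else 0)"
      unfolding s \<tau>_def using cas_orthonormal[of n p] by (cases "j = i"; cases "p = n") simp_all
  next
    fix m j p
    have "\<bar>\<Sum>k<m. cas (of_int n * \<tau> m k) * cas (of_int p * \<tau> m k)\<bar> \<le> (\<Sum>k<m. 4)"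
    proof (rule order_trans[OF sum_abs], rule sum_mono)
      fix k
      show "\<bar>cas (of_int n * \<tau> m k) * cas (of_int p * \<tau> m k)\<bar> \<le> 4" by (rule abs_cas_mult_le)
    qed
    then show "\<bar>spec (ls m) j p\<bar> \<le> 4" unfolding s by (cases "m = 0") (auto simp: field_simps)
  qed
qed

lemma spectral_energy_Z: "spectral_energy (\<lambda>j k. if j = i \<and> k = n then 1 else 0) = pmf difference_pmf n"
proof -
  have "measure_pmf.expectation difference_pmf (\<lambda>k. (if j = i \<and> k = n then 1 else 0 :: real)\<^sup>2) = (if j = i then pmf difference_pmf n else 0)" for j
  proof (cases "j = i")
    case True
    have "(\<lambda>k. (if j = i \<and> k = n then 1 else 0 :: real)\<^sup>2) = indicator {n}" using True by (auto simp: indicator_def)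
    then show ?thesis using True by (simp add: measure_pmf_single)
  qed simp
  then show ?thesis unfolding spectral_energy_def by simp
qed

text \<open>Pythagoras' theorem: a functional with vanishing \<open>(i, n)\<close> component is uncorrelated with \<open>Z i n\<close>.\<close>

lemma spectral_energy_orthogonal:
  assumes c: "\<And>i n. \<bar>c i n\<bar> \<le> B" and 0: "c i n = 0"
  shows "spectral_energy (\<lambda>j k. s * (if j = i \<and> k = n then 1 else 0) + r * c j k) =
    s\<^sup>2 * pmf difference_pmf n + r\<^sup>2 * spectral_energy c"
proof -
  have eq: "(s * (if j = i \<and> k = n then 1 else 0) + r * c j k)\<^sup>2 =
      s\<^sup>2 * (if j = i \<and> k = n then 1 else 0)\<^sup>2 + r\<^sup>2 * (c j k)\<^sup>2" for j k
    using 0 by (auto simp: power2_eq_square)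
  have i: "integrable (measure_pmf difference_pmf) (\<lambda>k. (if j = i \<and> k = n then 1 else 0 :: real)\<^sup>2)" for j
    by (rule integrable_pmf_bounded[of _ 1]) simp
  have i': "integrable (measure_pmf difference_pmf) (\<lambda>k. (c j k)\<^sup>2)" for j
    by (rule integrable_pmf_bounded[of _ "B\<^sup>2"]) (simp add: square_le_if_abs_le[OF c])
  have "spectral_energy (\<lambda>j k. s * (if j = i \<and> k = n then 1 else 0) + r * c j k) =
      s\<^sup>2 * spectral_energy (\<lambda>j k. if j = i \<and> k = n then 1 else 0) + r\<^sup>2 * spectral_energy c"
    unfolding spectral_energy_def eq sum_distrib_left sum.distrib[symmetric] using i i' by (intro sum.cong) auto
  then show ?thesis unfolding spectral_energy_Z .
qed

lemma measurable_has_spectrum: "has_spectrum S c \<Longrightarrow> S \<in> borel_measurable M"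
  using has_spectrum_imp_char_gauss unfolding char_gauss_def by blast

lemma measurable_Z[measurable]: "Z i n \<in> borel_measurable M"
  by (rule measurable_has_spectrum[OF has_spectrum_Z])

lemma char_gauss_Z: "char_gauss (Z i n) (pmf difference_pmf n)"
  using has_spectrum_imp_char_gauss[OF has_spectrum_Z] unfolding spectral_energy_Z .

end

section \<open>Conditioning on finitely many Fourier coefficients\<close>

context circle_process
begin

text \<open>A weight of total mass \<open>p\<close> that does not affect the law of any functional whose spectrum vanishes on
\<open>J\<close>. The weights of interest are indicators of events that depend on the Fourier coefficients with
indices in \<open>J\<close> only, but the definition speaks of one-dimensional characteristic functions, so that
no joint laws are required.\<close>

definition blind_weight :: "('w \<Rightarrow> real) \<Rightarrow> real \<Rightarrow> (3 \<times> int) set \<Rightarrow> bool" where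
  "blind_weight W p J \<longleftrightarrow> W \<in> borel_measurable M \<and> (\<forall>\<omega>. 0 \<le> W \<omega> \<and> W \<omega> \<le> 1) \<and>
     (\<forall>S c. has_spectrum S c \<longrightarrow> (\<forall>(i, n)\<in>J. c i n = 0) \<longrightarrow>
        (CLINT \<omega>|M. W \<omega> * iexp (S \<omega>)) = p * exp (- spectral_energy c / 2))"

lemma blind_weight_one: "blind_weight (\<lambda>_. 1) 1 {}"
proof -
  have "(CLINT \<omega>|M. iexp (S \<omega>)) = exp (- spectral_energy c / 2)" if "has_spectrum S c" for S c
  proof -
    have "\<forall>s. (CLINT \<omega>|M. iexp (s * S \<omega>)) = exp (- spectral_energy c * s\<^sup>2 / 2)"
      using has_spectrum_imp_char_gauss[OF that] unfolding char_gauss_def by blast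
    from this[rule_format, of 1] show ?thesis by simp
  qed
  then show ?thesis unfolding blind_weight_def by simp
qed

lemma blind_weight_char_Z:
  assumes W: "blind_weight W p J" and "(i, n) \<notin> J"
  shows "(CLINT \<omega>|M. W \<omega> * iexp (s * Z i n \<omega>)) = p * (CLINT \<omega>|M. iexp (s * Z i n \<omega>))"
proof -
  have "has_spectrum (\<lambda>\<omega>. s * Z i n \<omega>) (\<lambda>j k. s * (if j = i \<and> k = n then 1 else 0))"
    by (rule has_spectrum_scale[OF has_spectrum_Z])
  moreover have "\<forall>(j, k)\<in>J. s * (if j = i \<and> k = n then 1 else 0) = 0" using assms(2) by auto
  ultimately have "(CLINT \<omega>|M. W \<omega> * iexp (s * Z i n \<omega>)) =
      p * exp (- spectral_energy (\<lambda>j k. s * (if j = i \<and> k = n then 1 else 0)) / 2)"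
    using W unfolding blind_weight_def by blast
  also have "spectral_energy (\<lambda>j k. s * (if j = i \<and> k = n then 1 else 0)) = s\<^sup>2 * pmf difference_pmf n"
    using spectral_energy_orthogonal[of "\<lambda>_ _. 0" 0 i n s 0] by (simp add: spectral_energy_def)
  finally show ?thesis using char_gauss_Z[of i n] unfolding char_gauss_def by (simp add: mult.commute)
qed

lemma blind_weight_law_Z:
  assumes W: "blind_weight W p J" and "(i, n) \<notin> J" and [measurable]: "\<phi> \<in> borel_measurable borel"
  shows "(\<integral>\<^sup>+\<omega>. ennreal (W \<omega>) * \<phi> (Z i n \<omega>) \<partial>M) = ennreal p * (\<integral>\<^sup>+\<omega>. \<phi> (Z i n \<omega>) \<partial>M)"
  using W unfolding blind_weight_def
  by (intro weighted_law[where B = 1] blind_weight_char_Z[OF assms(1,2)]) auto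

lemma blind_weight_expectation: "blind_weight W p J \<Longrightarrow> expectation W = p"
proof -
  assume W: "blind_weight W p J"
  then have "(CLINT \<omega>|M. W \<omega> * iexp 0) = p * exp (- spectral_energy (\<lambda>i n. 0) / 2)"
    unfolding blind_weight_def using has_spectrum_zero by blast
  then have "complex_of_real (expectation W) = complex_of_real p" by (simp add: spectral_energy_def)
  then show ?thesis using of_real_eq_iff by blast
qed

text \<open>The weight \<open>W * (2 + cos (S + \<theta>))\<close> is nonnegative, and its effect on the characteristic function
of \<open>Z i n\<close> involves only the functionals \<open>s * Z i n\<close> and \<open>s * Z i n \<plusminus> S\<close>, whose spectra vanish on
\<open>J\<close>. As \<open>Z i n\<close> and \<open>S\<close> are uncorrelated, that effect is a constant factor, and
\<open>weighted_law\<close> applies.\<close>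

lemma blind_weight_tilted:
  assumes W: "blind_weight W p J" and J: "(i, n) \<notin> J" and S: "has_spectrum S c"
    and c: "\<forall>(i, n)\<in>insert (i, n) J. c i n = 0" and A: "A \<in> sets borel"
  shows "expectation (\<lambda>\<omega>. W \<omega> * (2 + cos (S \<omega> + \<theta>)) * indicator A (Z i n \<omega>)) =
     p * (2 + cos \<theta> * exp (- spectral_energy c / 2)) * prob (Z i n -` A \<inter> space M)"
proof -
  have [measurable]: "W \<in> borel_measurable M" "S \<in> borel_measurable M" "A \<in> sets borel"
    using W A measurable_has_spectrum[OF S] unfolding blind_weight_def by auto
  have W01: "0 \<le> W \<omega>" "W \<omega> \<le> 1" for \<omega> using W unfolding blind_weight_def by auto
  have cb: "0 \<le> 2 + cos x" "2 + cos x \<le> 3" for x :: real using cos_ge_minus_one[of x] cos_le_one[of x] by linarith+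
  define q where "q = exp (- spectral_energy c / 2)"
  let ?k = "p * (2 + cos \<theta> * q)"
  obtain B where B: "\<And>i n. \<bar>c i n\<bar> \<le> B" using has_spectrum_bounded[OF S] by blast
  have char: "(CLINT \<omega>|M. (W \<omega> * (2 + cos (S \<omega> + \<theta>))) * iexp (s * Z i n \<omega>)) = ?k * (CLINT \<omega>|M. iexp (s * Z i n \<omega>))" for s
  proof -
    let ?g = "exp (- pmf difference_pmf n * s\<^sup>2 / 2)"
    have shift: "(CLINT \<omega>|M. W \<omega> * iexp (s * Z i n \<omega> + r * S \<omega>)) = p * (?g * q)" if r: "r\<^sup>2 = 1" for r
    proof -
      have "has_spectrum (\<lambda>\<omega>. s * Z i n \<omega> + r * S \<omega>) (\<lambda>j k. s * (if j = i \<and> k = n then 1 else 0) + r * c j k)"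
        by (intro has_spectrum_add has_spectrum_scale has_spectrum_Z S)
      moreover have "\<forall>(j, k)\<in>J. s * (if j = i \<and> k = n then 1 else 0) + r * c j k = 0" using J c by auto
      ultimately have "(CLINT \<omega>|M. W \<omega> * iexp (s * Z i n \<omega> + r * S \<omega>)) =
          p * exp (- spectral_energy (\<lambda>j k. s * (if j = i \<and> k = n then 1 else 0) + r * c j k) / 2)"
        using W unfolding blind_weight_def by blast
      also have "spectral_energy (\<lambda>j k. s * (if j = i \<and> k = n then 1 else 0) + r * c j k) =
          s\<^sup>2 * pmf difference_pmf n + spectral_energy c"
        using spectral_energy_orthogonal[where c = c and B = B and i = i and n = n and s = s and r = r, OF B] c r
        by simp
      also have "exp (- (s\<^sup>2 * pmf difference_pmf n + spectral_energy c) / 2) = ?g * q"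
        unfolding q_def by (simp add: exp_add[symmetric] field_simps)
      finally show ?thesis by simp
    qed
    have int: "integrable M (\<lambda>\<omega>. complex_of_real (W \<omega>) * iexp (f \<omega>))" if [measurable]: "f \<in> borel_measurable M" for f
      using W01 by (intro integrable_const_bound[of _ 1]) (auto simp: norm_mult)
    \<comment> \<open>Expanding the cosine turns the tilt into shifts of the exponent by \<open>S\<close> and \<open>- S\<close>.\<close>
    have pw: "(W \<omega> * (2 + cos (S \<omega> + \<theta>))) * iexp (s * Z i n \<omega>) =
        2 * (W \<omega> * iexp (s * Z i n \<omega>)) + (iexp \<theta> / 2) * (W \<omega> * iexp (s * Z i n \<omega> + 1 * S \<omega>)) +
        (iexp (- \<theta>) / 2) * (W \<omega> * iexp (s * Z i n \<omega> + (- 1) * S \<omega>))" for \<omega>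
    proof -
      have cosx: "complex_of_real (cos x) = (iexp x + iexp (- x)) / 2" for x :: real
        by (simp add: cos_of_real[symmetric] cos_exp_eq)
      have key: "c = (a + b) / 2 \<Longrightarrow> w * (2 + c) * f = 2 * (w * f) + (1 / 2) * w * (a * f) + (1 / 2) * w * (b * f)"
        for a b c w f :: complex by (hypsubst, simp add: field_simps)
      have "complex_of_real (W \<omega> * (2 + cos (S \<omega> + \<theta>))) * iexp (s * Z i n \<omega>) =
        complex_of_real (W \<omega>) * (2 + complex_of_real (cos (S \<omega> + \<theta>))) * iexp (s * Z i n \<omega>)" by simp
      also note key[OF cosx, of "complex_of_real (W \<omega>)" "S \<omega> + \<theta>" "iexp (s * Z i n \<omega>)"]
      also have "iexp (S \<omega> + \<theta>) * iexp (s * Z i n \<omega>) = iexp \<theta> * iexp (s * Z i n \<omega> + 1 * S \<omega>)"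
        by (simp add: exp_add[symmetric] algebra_simps)
      also have "iexp (- (S \<omega> + \<theta>)) * iexp (s * Z i n \<omega>) = iexp (- \<theta>) * iexp (s * Z i n \<omega> + (- 1) * S \<omega>)"
        by (simp add: exp_add[symmetric] algebra_simps)
      finally show ?thesis by (simp add: algebra_simps)
    qed
    have "(CLINT \<omega>|M. (W \<omega> * (2 + cos (S \<omega> + \<theta>))) * iexp (s * Z i n \<omega>)) =
        2 * (CLINT \<omega>|M. W \<omega> * iexp (s * Z i n \<omega>)) + (iexp \<theta> / 2) * (CLINT \<omega>|M. W \<omega> * iexp (s * Z i n \<omega> + 1 * S \<omega>)) +
        (iexp (- \<theta>) / 2) * (CLINT \<omega>|M. W \<omega> * iexp (s * Z i n \<omega> + (- 1) * S \<omega>))"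
    proof -
      have i: "integrable M (\<lambda>\<omega>. W \<omega> * iexp (s * Z i n \<omega>))" "integrable M (\<lambda>\<omega>. W \<omega> * iexp (s * Z i n \<omega> + 1 * S \<omega>))"
        "integrable M (\<lambda>\<omega>. W \<omega> * iexp (s * Z i n \<omega> + (- 1) * S \<omega>))"
        by (rule int, measurable)+
      show ?thesis unfolding pw
        by (subst Bochner_Integration.integral_add, intro Bochner_Integration.integrable_add integrable_mult_right i,
            intro integrable_mult_right i,
            subst Bochner_Integration.integral_add, intro integrable_mult_right i, intro integrable_mult_right i)
          (simp only: integral_mult_right_zero)
    qed
    also have "\<dots> = 2 * (p * ?g) + (iexp \<theta> / 2) * (p * (?g * q)) + (iexp (- \<theta>) / 2) * (p * (?g * q))"
      using blind_weight_char_Z[OF W J, of s] shift[of 1] shift[of "- 1"] char_gauss_Z[of i n]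
      unfolding char_gauss_def by simp
    also have "\<dots> = p * (2 + (iexp \<theta> + iexp (- \<theta>)) / 2 * q) * ?g" by (simp add: algebra_simps)
    also have "(iexp \<theta> + iexp (- \<theta>)) / 2 = cos \<theta>"
      by (simp add: cos_of_real[symmetric] cos_exp_eq)
    finally show ?thesis using char_gauss_Z[of i n] unfolding char_gauss_def by simp
  qed
  have "(\<integral>\<^sup>+\<omega>. ennreal (W \<omega> * (2 + cos (S \<omega> + \<theta>))) * indicator A (Z i n \<omega>) \<partial>M) =
      ennreal ?k * (\<integral>\<^sup>+\<omega>. indicator A (Z i n \<omega>) \<partial>M)"
  proof (rule weighted_law[where B = 3, OF _ _ _ _ _ char])
    show "0 \<le> W \<omega> * (2 + cos (S \<omega> + \<theta>))" for \<omega> using W01 cb by simp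
    have "W \<omega> * (2 + cos (S \<omega> + \<theta>)) \<le> 1 * 3" for \<omega> using W01 cb by (intro mult_mono) auto
    then show "W \<omega> * (2 + cos (S \<omega> + \<theta>)) \<le> 3" for \<omega> by simp
  qed measurable
  also have "(\<integral>\<^sup>+\<omega>. indicator A (Z i n \<omega>) \<partial>M) = (\<integral>\<^sup>+\<omega>. indicator (Z i n -` A \<inter> space M) \<omega> \<partial>M)"
    by (intro nn_integral_cong) (auto simp: indicator_def)
  also have "\<dots> = ennreal (prob (Z i n -` A \<inter> space M))" by (simp add: emeasure_eq_measure)
  also have "(\<integral>\<^sup>+\<omega>. ennreal (W \<omega> * (2 + cos (S \<omega> + \<theta>))) * indicator A (Z i n \<omega>) \<partial>M) =
      (\<integral>\<^sup>+\<omega>. ennreal (W \<omega> * (2 + cos (S \<omega> + \<theta>)) * indicator A (Z i n \<omega>)) \<partial>M)"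
    by (intro nn_integral_cong) (auto simp: indicator_def)
  finally have nn: "(\<integral>\<^sup>+\<omega>. ennreal (W \<omega> * (2 + cos (S \<omega> + \<theta>)) * indicator A (Z i n \<omega>)) \<partial>M) =
      ennreal ?k * ennreal (prob (Z i n -` A \<inter> space M))" .
  have p: "p \<ge> 0" using blind_weight_expectation[OF W] W01 by (metis Bochner_Integration.integral_nonneg)
  have "q \<le> 1" "0 \<le> q"
    using has_spectrum_imp_char_gauss[OF S] unfolding q_def char_gauss_def by auto
  then have "\<bar>cos \<theta> * q\<bar> \<le> 1 * 1" unfolding abs_mult by (intro mult_mono) auto
  then have k: "?k \<ge> 0" using p by (intro mult_nonneg_nonneg) auto
  have "expectation (\<lambda>\<omega>. W \<omega> * (2 + cos (S \<omega> + \<theta>)) * indicator A (Z i n \<omega>)) = enn2real (ennreal ?k * ennreal (prob (Z i n -` A \<inter> space M)))"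
    unfolding nn[symmetric] using W01 cb by (intro integral_eq_nn_integral AE_I2 mult_nonneg_nonneg) auto
  also have "\<dots> = ?k * prob (Z i n -` A \<inter> space M)" using k by (simp add: ennreal_mult[symmetric])
  finally show ?thesis unfolding q_def .
qed

text \<open>Taking linear combinations of the identity \<open>blind_weight_tilted\<close> for the phases \<open>\<theta> = 0\<close>, \<open>pi\<close> and
\<open>- pi / 2\<close> isolates the constant, the cosine and the sine part of the new characteristic function.\<close>

lemma blind_weight_insert:
  assumes W: "blind_weight W p J" and J: "(i, n) \<notin> J" and A: "A \<in> sets borel"
  shows "blind_weight (\<lambda>\<omega>. W \<omega> * indicator A (Z i n \<omega>)) (p * prob (Z i n -` A \<inter> space M)) (insert (i, n) J)"
  unfolding blind_weight_def
proof (intro conjI allI impI)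
  have [measurable]: "W \<in> borel_measurable M" "A \<in> sets borel" using W A unfolding blind_weight_def by auto
  have W01: "0 \<le> W \<omega>" "W \<omega> \<le> 1" for \<omega> using W unfolding blind_weight_def by auto
  show "(\<lambda>\<omega>. W \<omega> * indicator A (Z i n \<omega>)) \<in> borel_measurable M" by measurable
  show "0 \<le> W \<omega> * indicator A (Z i n \<omega>)" "W \<omega> * indicator A (Z i n \<omega>) \<le> 1" for \<omega> using W01 by (auto simp: indicator_def)
  fix S c assume S: "has_spectrum S c" and c: "\<forall>(i, n)\<in>insert (i, n) J. c i n = 0"
  have [measurable]: "S \<in> borel_measurable M" using measurable_has_spectrum[OF S] .
  define V where "V = (\<lambda>\<omega>. W \<omega> * indicator A (Z i n \<omega>))"
  have [measurable]: "V \<in> borel_measurable M" unfolding V_def by measurable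
  have V01: "\<bar>V \<omega>\<bar> \<le> 1" for \<omega> unfolding V_def using W01 by (auto simp: indicator_def)
  let ?P = "p * prob (Z i n -` A \<inter> space M)"
  let ?q = "exp (- spectral_energy c / 2)"
  have iV: "integrable M V" using V01 by (intro integrable_const_bound[of _ 1]) auto
  have it: "integrable M (\<lambda>\<omega>. V \<omega> * cos (S \<omega> + \<theta>))" for \<theta>
  proof (rule integrable_const_bound[of _ 1])
    have "\<bar>V \<omega>\<bar> * \<bar>cos (S \<omega> + \<theta>)\<bar> \<le> 1 * 1" for \<omega> using V01 by (intro mult_mono) auto
    then show "AE \<omega> in M. norm (V \<omega> * cos (S \<omega> + \<theta>)) \<le> 1" by (simp add: abs_mult)
  qed measurable
  have t: "2 * expectation V + expectation (\<lambda>\<omega>. V \<omega> * cos (S \<omega> + \<theta>)) = ?P * (2 + cos \<theta> * ?q)" for \<theta>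
  proof -
    have "expectation (\<lambda>\<omega>. W \<omega> * (2 + cos (S \<omega> + \<theta>)) * indicator A (Z i n \<omega>)) =
        expectation (\<lambda>\<omega>. 2 * V \<omega> + V \<omega> * cos (S \<omega> + \<theta>))"
      unfolding V_def by (intro Bochner_Integration.integral_cong) (auto simp: algebra_simps)
    also have "\<dots> = 2 * expectation V + expectation (\<lambda>\<omega>. V \<omega> * cos (S \<omega> + \<theta>))"
      using iV it by simp
    finally show ?thesis using blind_weight_tilted[OF W J S c A, of \<theta>] by (simp add: mult_ac)
  qed
  \<comment> \<open>The cosine terms for the phases \<open>0\<close> and \<open>pi\<close> cancel.\<close>
  have "cos (S \<omega> + pi) = - cos (S \<omega> + 0)" for \<omega> by simp
  then have "expectation (\<lambda>\<omega>. V \<omega> * cos (S \<omega> + pi)) = - expectation (\<lambda>\<omega>. V \<omega> * cos (S \<omega> + 0))"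
    by simp
  then have EV: "expectation V = ?P" using t[of 0] t[of pi] by (simp add: algebra_simps)
  have C: "expectation (\<lambda>\<omega>. V \<omega> * cos (S \<omega>)) = ?P * ?q" using t[of 0] EV by (simp add: algebra_simps)
  have "cos (S \<omega> + - (pi / 2)) = sin (S \<omega>)" for \<omega> by (simp add: cos_diff)
  then have D: "expectation (\<lambda>\<omega>. V \<omega> * sin (S \<omega>)) = 0" using t[of "- (pi / 2)"] EV by (simp add: algebra_simps)
  have "(CLINT \<omega>|M. V \<omega> * iexp (S \<omega>)) = (CLINT \<omega>|M. complex_of_real (V \<omega> * cos (S \<omega>)) + \<i> * complex_of_real (V \<omega> * sin (S \<omega>)))"
    by (intro Bochner_Integration.integral_cong) (auto simp: cis_conv_exp[symmetric] complex_eq_iff)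
  also have "\<dots> = complex_of_real (expectation (\<lambda>\<omega>. V \<omega> * cos (S \<omega>))) + \<i> * complex_of_real (expectation (\<lambda>\<omega>. V \<omega> * sin (S \<omega>)))"
  proof -
    have "integrable M (\<lambda>\<omega>. V \<omega> * cos (S \<omega>))" using it[of 0] by simp
    moreover have "integrable M (\<lambda>\<omega>. V \<omega> * sin (S \<omega>))" using it[of "- (pi / 2)"] by (simp add: cos_diff)
    ultimately show ?thesis
      by (subst Bochner_Integration.integral_add) (auto simp del: of_real_mult)
  qed
  finally have "(CLINT \<omega>|M. V \<omega> * iexp (S \<omega>)) = ?P * ?q" unfolding C D by simp
  then show "(CLINT \<omega>|M. (W \<omega> * indicator A (Z i n \<omega>)) * iexp (S \<omega>)) = ?P * exp (- spectral_energy c / 2)"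
    unfolding V_def by simp
qed

lemma blind_weight_boxes:
  assumes "finite J" "\<delta> > 0"
  shows "\<exists>p>0. blind_weight (\<lambda>\<omega>. \<Prod>(i, n)\<in>J. indicator {\<alpha> i n - \<delta><..<\<alpha> i n + \<delta>} (Z i n \<omega>)) p J"
  using assms(1)
proof (induction J rule: finite_induct)
  case empty
  show ?case using blind_weight_one by (intro exI[of _ 1]) simp
next
  case (insert x J)
  obtain i n where x: "x = (i, n)" by (cases x)
  let ?A = "{\<alpha> i n - \<delta><..<\<alpha> i n + \<delta>}"
  obtain p where p: "p > 0" "blind_weight (\<lambda>\<omega>. \<Prod>(i, n)\<in>J. indicator {\<alpha> i n - \<delta><..<\<alpha> i n + \<delta>} (Z i n \<omega>)) p J"
    using insert.IH by blast
  have "prob {\<omega> \<in> space M. Z i n \<omega> \<in> ?A} > 0"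
    by (rule char_gauss_interval_pos[OF char_gauss_Z pmf_difference_pos assms(2)])
  also have "{\<omega> \<in> space M. Z i n \<omega> \<in> ?A} = Z i n -` ?A \<inter> space M" by auto
  finally have pos: "p * prob (Z i n -` ?A \<inter> space M) > 0" using p(1) by simp
  have "(i, n) \<notin> J" using insert.hyps x by simp
  from blind_weight_insert[OF p(2) this, of ?A] show ?case
    using pos insert.hyps unfolding x by (intro exI[of _ "p * prob (Z i n -` ?A \<inter> space M)"]) (simp add: mult.commute)
qed

end

section \<open>The process is close to any trigonometric polynomial with positive probability\<close>

lemma abs_cas_diff_le: "\<bar>cas x - cas y\<bar> \<le> 2 * \<bar>x - y\<bar>"
proof -
  have onorm: "onorm (\<lambda>h. a * h) \<le> 1" if "\<bar>a\<bar> \<le> 1" for a :: real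
    using that by (intro onorm_le) (simp add: abs_mult mult_left_le_one_le)
  have "norm (cos x - cos y) \<le> 1 * norm (x - y)"
  proof (rule differentiable_bound[of UNIV cos "\<lambda>z h. - sin z * h"])
    show "(cos has_derivative (\<lambda>h. - sin z * h)) (at z within UNIV)" for z :: real
      using DERIV_cos[of z] unfolding has_field_derivative_def .
    show "onorm (\<lambda>h. - sin z * h) \<le> 1" for z :: real by (rule onorm) simp
  qed auto
  then have c: "\<bar>cos x - cos y\<bar> \<le> \<bar>x - y\<bar>" by simp
  have "norm (sin x - sin y) \<le> 1 * norm (x - y)"
  proof (rule differentiable_bound[of UNIV sin "\<lambda>z h. cos z * h"])
    show "(sin has_derivative (\<lambda>h. cos z * h)) (at z within UNIV)" for z :: real
      using DERIV_sin[of z] unfolding has_field_derivative_def .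
    show "onorm (\<lambda>h. cos z * h) \<le> 1" for z :: real by (rule onorm) simp
  qed auto
  then have s: "\<bar>sin x - sin y\<bar> \<le> \<bar>x - y\<bar>" by simp
  have "cas x - cas y = (cos x - cos y) + (sin x - sin y)" by (simp add: cas_def)
  then show ?thesis using c s abs_triangle_ineq[of "cos x - cos y" "sin x - sin y"] by simp
qed

lemma cas_periodic: "cas (of_int n * (t + 2 * pi)) = cas (of_int n * t)"
  unfolding cas_def distrib_left cos_add sin_add
  using sin_int_2pin[of n] cos_int_2pin[of n] by (simp add: mult.commute)

text \<open>The Lipschitz estimate is applied directly and, around the other side of the circle, after shifting
one of the arguments by a period.\<close>

lemma abs_cas_diff_arc_le:
  assumes "\<bar>s - t\<bar> \<le> 2 * pi"
  shows "\<bar>cas (of_int n * s) - cas (of_int n * t)\<bar> \<le> 2 * \<bar>of_int n\<bar> * arc_dist s t"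
proof -
  have le: "\<bar>cas (of_int n * s) - cas (of_int n * t)\<bar> \<le> 2 * \<bar>of_int n\<bar> * \<bar>s - t\<bar>" for s t
    using abs_cas_diff_le[of "of_int n * s" "of_int n * t"]
    by (simp add: abs_mult[symmetric] right_diff_distrib mult.assoc)
  have "\<bar>cas (of_int n * s) - cas (of_int n * t)\<bar> \<le> 2 * \<bar>of_int n\<bar> * (2 * pi - \<bar>s - t\<bar>)"
  proof (cases "s \<le> t")
    case True
    then have "\<bar>s + 2 * pi - t\<bar> = 2 * pi - \<bar>s - t\<bar>" using assms by simp
    then show ?thesis using le[of "s + 2 * pi" t] unfolding cas_periodic by simp
  next
    case False
    then have "\<bar>s - (t + 2 * pi)\<bar> = 2 * pi - \<bar>s - t\<bar>" using assms by simp
    then show ?thesis using le[of s "t + 2 * pi"] unfolding cas_periodic by simp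
  qed
  then show ?thesis using le[of s t] unfolding arc_dist_def min_def by simp
qed

lemma sqrt_power_sixteenth: "sqrt ((1/16) ^ m) = (1/4) ^ m"
proof -
  have "(1/16 :: real) ^ m = ((1/4) ^ m)\<^sup>2"
    by (simp add: power_mult[symmetric] power2_eq_square power_mult_distrib[symmetric])
  then show ?thesis by simp
qed

lemma arc_Lipschitz_if_dense:
  fixes f :: "real \<Rightarrow> real"
  assumes Q: "Q \<subseteq> {0..2 * pi}" "{0..2 * pi} \<subseteq> closure Q" and f: "continuous_on {0..2 * pi} f"
    and le: "\<And>s t. s \<in> Q \<Longrightarrow> t \<in> Q \<Longrightarrow> \<bar>f s - f t\<bar> \<le> \<epsilon> * arc_dist s t"
    and st: "s \<in> {0..2 * pi}" "t \<in> {0..2 * pi}"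
  shows "\<bar>f s - f t\<bar> \<le> \<epsilon> * arc_dist s t"
proof -
  have "s \<in> closure Q" "t \<in> closure Q" using st Q(2) by auto
  then obtain u v where u: "\<And>n. u n \<in> Q" "u \<longlonglongrightarrow> s" and v: "\<And>n. v n \<in> Q" "v \<longlonglongrightarrow> t"
    unfolding closure_sequential by blast
  have mem: "u n \<in> {0..2 * pi}" "v n \<in> {0..2 * pi}" for n using Q(1) u(1) v(1) by blast+
  have ul: "(\<lambda>n. f (u n)) \<longlonglongrightarrow> f s" "(\<lambda>n. f (v n)) \<longlonglongrightarrow> f t"
    using continuous_on_tendsto_compose[OF f u(2) st(1)] continuous_on_tendsto_compose[OF f v(2) st(2)] mem
    by (simp_all add: always_eventually)
  show ?thesis
  proof (rule LIMSEQ_le)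
    show "(\<lambda>n. \<bar>f (u n) - f (v n)\<bar>) \<longlonglongrightarrow> \<bar>f s - f t\<bar>" by (intro tendsto_intros ul)
    show "(\<lambda>n. \<epsilon> * arc_dist (u n) (v n)) \<longlonglongrightarrow> \<epsilon> * arc_dist s t"
      unfolding arc_dist_def by (intro tendsto_intros u v)
    show "\<exists>N. \<forall>n\<ge>N. \<bar>f (u n) - f (v n)\<bar> \<le> \<epsilon> * arc_dist (u n) (v n)" using le u(1) v(1) by blast
  qed
qed

context circle_process
begin

definition partial_sum :: "3 \<Rightarrow> nat \<Rightarrow> real \<Rightarrow> 'w \<Rightarrow> real" where
  "partial_sum i m t \<omega> = (\<Sum>n\<in>{- int m..int m}. Z i n \<omega> * cas (of_int n * t))"

lemma measurable_partial_sum[measurable]: "partial_sum i m t \<in> borel_measurable M"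
  unfolding partial_sum_def[abs_def] by measurable

text \<open>The remainder after the terms with \<open>\<bar>n\<bar> \<le> m\<close> has the spectrum of the evaluation at \<open>t\<close> cut off to
\<open>\<bar>n\<bar> > m\<close>. Hence its standard deviation decays geometrically in \<open>m\<close>, and the remainders are almost
surely summable.\<close>

lemma AE_partial_sums_converge: "AE \<omega> in M. (\<lambda>m. partial_sum i m t \<omega>) \<longlonglongrightarrow> X i t \<omega>"
proof -
  define S where "S = (\<lambda>m \<omega>. X i t \<omega> - partial_sum i m t \<omega>)"
  have [measurable]: "S m \<in> borel_measurable M" for m unfolding S_def by measurable
  define K :: real where "K = 2 * sqrt (exp 30)"
  have le: "(\<integral>\<^sup>+\<omega>. ennreal \<bar>S m \<omega>\<bar> \<partial>M) \<le> ennreal (K * (1/4) ^ m)" for m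
  proof -
    define c where "c = (\<lambda>j k. (if j = i then cas (of_int k * t) else 0) +
        (\<Sum>n\<in>{- int m..int m}. - cas (of_int n * t) * (if j = i \<and> k = n then 1 else 0 :: real)))"
    have "has_spectrum (\<lambda>\<omega>. X i t \<omega> + (\<Sum>n\<in>{- int m..int m}. - cas (of_int n * t) * Z i n \<omega>)) c"
      unfolding c_def by (intro has_spectrum_add has_spectrum_sum has_spectrum_scale has_spectrum_X has_spectrum_Z) auto
    then have hs: "has_spectrum (S m) c"
      unfolding S_def partial_sum_def by (simp add: sum_negf mult.commute)
    have c: "c j k = (if j = i \<and> \<bar>k\<bar> > int m then cas (of_int k * t) else 0)" for j k
    proof -
      have "(\<Sum>n\<in>{- int m..int m}. - cas (of_int n * t) * (if j = i \<and> k = n then 1 else 0 :: real)) =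
          (\<Sum>n\<in>{- int m..int m}. if k = n then (if j = i then - cas (of_int n * t) else 0) else 0)"
        by (intro sum.cong) auto
      then show ?thesis unfolding c_def by (auto simp: sum.delta)
    qed
    have "spectral_energy c = measure_pmf.expectation difference_pmf (\<lambda>k. (c i k)\<^sup>2)"
    proof -
      have single: "measure_pmf.expectation difference_pmf (\<lambda>k. (c j k)\<^sup>2) = (if j = i then measure_pmf.expectation difference_pmf (\<lambda>k. (c i k)\<^sup>2) else 0)" for j
        unfolding c by auto
      have "spectral_energy c = (\<Sum>j\<in>UNIV. if j = i then measure_pmf.expectation difference_pmf (\<lambda>k. (c i k)\<^sup>2) else 0)"
        unfolding spectral_energy_def by (rule sum.cong[OF refl single])
      also have "\<dots> = measure_pmf.expectation difference_pmf (\<lambda>k. (c i k)\<^sup>2)" by simp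
      finally show ?thesis .
    qed
    also have "\<dots> \<le> measure_pmf.expectation difference_pmf (\<lambda>k. 4 * indicator {k. \<bar>k\<bar> > int m} k)"
    proof (rule integral_mono)
      show "integrable (measure_pmf difference_pmf) (\<lambda>k. (c i k)\<^sup>2)"
        using abs_cas_le square_le_if_abs_le[OF abs_cas_le] by (intro integrable_pmf_bounded[of _ 4]) (auto simp: c)
      show "integrable (measure_pmf difference_pmf) (\<lambda>k. 4 * indicator {k. \<bar>k\<bar> > int m} k :: real)"
        by (intro integrable_pmf_bounded[of _ 4]) (auto simp: indicator_def)
      show "(c i k)\<^sup>2 \<le> 4 * indicator {k. \<bar>k\<bar> > int m} k" for k
        using square_le_if_abs_le[OF abs_cas_le, of "of_int k * t"] by (auto simp: c indicator_def)
    qed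
    also have "\<dots> = 4 * measure_pmf.prob difference_pmf {k. \<bar>k\<bar> > int m}" by simp
    also have "\<dots> \<le> 4 * (exp 30 * (1/16) ^ m)"
      by (intro mult_left_mono difference_prob_le) auto
    finally have "sqrt (spectral_energy c) \<le> sqrt (4 * (exp 30 * (1/16) ^ m))" by (rule real_sqrt_le_mono)
    also have "\<dots> = K * (1/4) ^ m"
      unfolding K_def real_sqrt_mult sqrt_power_sixteenth by simp
    finally have "sqrt (spectral_energy c) \<le> K * (1/4) ^ m" .
    then show ?thesis
      using char_gauss_nn_integral_abs_le[OF has_spectrum_imp_char_gauss[OF hs]] by (meson ennreal_leI order_trans)
  qed
  have "(\<integral>\<^sup>+\<omega>. suminf (\<lambda>m. ennreal \<bar>S m \<omega>\<bar>) \<partial>M) = suminf (\<lambda>m. \<integral>\<^sup>+\<omega>. ennreal \<bar>S m \<omega>\<bar> \<partial>M)"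
    by (rule nn_integral_suminf) measurable
  also have "\<dots> \<le> suminf (\<lambda>m. ennreal (K * (1/4) ^ m))" by (intro suminf_le le) auto
  also have "\<dots> = ennreal (K * (1 / (1 - 1/4)))"
    by (intro suminf_ennreal_eq sums_mult geometric_sums) (auto simp: K_def)
  finally have "(\<integral>\<^sup>+\<omega>. suminf (\<lambda>m. ennreal \<bar>S m \<omega>\<bar>) \<partial>M) \<noteq> \<infinity>" by (auto simp: top_unique)
  then have "AE \<omega> in M. suminf (\<lambda>m. ennreal \<bar>S m \<omega>\<bar>) \<noteq> \<infinity>" by (intro nn_integral_noteq_infinite) measurable
  then show ?thesis
  proof eventually_elim
    case (elim \<omega>)
    then have "summable (\<lambda>m. \<bar>S m \<omega>\<bar>)" by (intro summable_suminf_not_top) auto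
    then have "(\<lambda>m. \<bar>S m \<omega>\<bar>) \<longlonglongrightarrow> 0" by (rule summable_LIMSEQ_zero)
    then have "(\<lambda>m. S m \<omega>) \<longlonglongrightarrow> 0" by (rule tendsto_rabs_zero_cancel)
    then have "(\<lambda>m. X i t \<omega> - S m \<omega>) \<longlonglongrightarrow> X i t \<omega> - 0" by (intro tendsto_intros)
    then show ?case unfolding S_def by simp
  qed
qed

text \<open>A bound, up to the factor 2, for the Lipschitz constants of the terms of frequency \<open>m\<close> in the Fourier
series of the process. It takes values in \<open>ennreal\<close> to allow summation over \<open>m\<close> before finiteness is
known.\<close>

definition layer :: "nat \<Rightarrow> 'w \<Rightarrow> ennreal" where
  "layer m \<omega> = (\<Sum>i\<in>(UNIV :: 3 set). ennreal (real m) * (ennreal \<bar>Z i (int m) \<omega>\<bar> + ennreal \<bar>Z i (- int m) \<omega>\<bar>))"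

lemma measurable_layer[measurable]: "layer m \<in> borel_measurable M"
  unfolding layer_def[abs_def] by measurable

lemma blind_weight_layer:
  assumes W: "blind_weight W p (UNIV \<times> {- int N..int N})" and m: "N < m"
  shows "(\<integral>\<^sup>+\<omega>. ennreal (W \<omega>) * layer m \<omega> \<partial>M) \<le> ennreal p * ennreal (6 * sqrt (exp 30) * (1/2) ^ m)"
proof -
  have [measurable]: "W \<in> borel_measurable M" using W unfolding blind_weight_def by blast
  have z: "(\<integral>\<^sup>+\<omega>. ennreal (W \<omega>) * ennreal \<bar>Z i n \<omega>\<bar> \<partial>M) \<le> ennreal p * ennreal (sqrt (exp 30) * (1/4) ^ m)"
    if n: "nat \<bar>n\<bar> = m" for i n
  proof -
    have "(i, n) \<notin> UNIV \<times> {- int N..int N}" using n m by auto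
    then have "(\<integral>\<^sup>+\<omega>. ennreal (W \<omega>) * ennreal \<bar>Z i n \<omega>\<bar> \<partial>M) = ennreal p * (\<integral>\<^sup>+\<omega>. ennreal \<bar>Z i n \<omega>\<bar> \<partial>M)"
      by (intro blind_weight_law_Z[OF W]) auto
    also have "\<dots> \<le> ennreal p * ennreal (sqrt (pmf difference_pmf n))"
      by (intro mult_left_mono char_gauss_nn_integral_abs_le char_gauss_Z) auto
    also have "\<dots> \<le> ennreal p * ennreal (sqrt (exp 30) * (1/4) ^ m)"
    proof (intro mult_left_mono ennreal_leI)
      have "pmf difference_pmf n \<le> exp 30 * (1/16) ^ m"
        using difference_prob_le[of "{n}" m] n by (simp add: measure_pmf_single)
      then have "sqrt (pmf difference_pmf n) \<le> sqrt (exp 30 * (1/16) ^ m)" by (rule real_sqrt_le_mono)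
      also have "\<dots> = sqrt (exp 30) * (1/4) ^ m" unfolding real_sqrt_mult sqrt_power_sixteenth ..
      finally show "sqrt (pmf difference_pmf n) \<le> sqrt (exp 30) * (1/4) ^ m" .
    qed auto
    finally show ?thesis .
  qed
  let ?b = "ennreal p * ennreal (sqrt (exp 30) * (1/4) ^ m)"
  have "(\<integral>\<^sup>+\<omega>. ennreal (W \<omega>) * layer m \<omega> \<partial>M) = (\<integral>\<^sup>+\<omega>. (\<Sum>i\<in>UNIV. ennreal (real m) *
      (ennreal (W \<omega>) * ennreal \<bar>Z i (int m) \<omega>\<bar> + ennreal (W \<omega>) * ennreal \<bar>Z i (- int m) \<omega>\<bar>)) \<partial>M)"
    unfolding layer_def sum_distrib_left by (intro nn_integral_cong sum.cong) (auto simp: algebra_simps)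
  also have "\<dots> = (\<Sum>i\<in>UNIV. ennreal (real m) * ((\<integral>\<^sup>+\<omega>. ennreal (W \<omega>) * ennreal \<bar>Z i (int m) \<omega>\<bar> \<partial>M) +
      (\<integral>\<^sup>+\<omega>. ennreal (W \<omega>) * ennreal \<bar>Z i (- int m) \<omega>\<bar> \<partial>M)))"
    by (subst nn_integral_sum) (auto simp: nn_integral_cmult nn_integral_add)
  also have "\<dots> \<le> (\<Sum>i\<in>(UNIV :: 3 set). ennreal (real m) * (?b + ?b))"
    by (intro sum_mono mult_left_mono add_mono z) auto
  also have "\<dots> = ennreal p * ennreal (6 * sqrt (exp 30) * (real m * (1/4) ^ m))"
  proof -
    have "(\<Sum>i\<in>(UNIV :: 3 set). ennreal (real m) * (?b + ?b)) = ennreal 6 * (ennreal (real m) * ?b)"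
      by (simp add: mult_2[symmetric] mult_ac)
    also have "\<dots> = ennreal p * (ennreal 6 * (ennreal (real m) * ennreal (sqrt (exp 30) * (1/4) ^ m)))"
      by (simp only: mult_ac)
    also have "ennreal 6 * (ennreal (real m) * ennreal (sqrt (exp 30) * (1/4) ^ m)) = ennreal (6 * (real m * (sqrt (exp 30) * (1/4) ^ m)))"
      by (subst ennreal_mult[symmetric], simp, simp, subst ennreal_mult[symmetric]) auto
    finally show ?thesis by (simp add: mult_ac)
  qed
  also have "\<dots> \<le> ennreal p * ennreal (6 * sqrt (exp 30) * (1/2) ^ m)"
  proof (intro mult_left_mono ennreal_leI)
    have "real m \<le> 2 ^ m" by (simp add: of_nat_less_two_power less_imp_le)
    then have "real m * (1/4) ^ m \<le> 2 ^ m * (1/4) ^ m" by (intro mult_right_mono) auto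
    also have "\<dots> = (1/2 :: real) ^ m" by (simp add: power_mult_distrib[symmetric])
    finally show "real m * (1/4) ^ m \<le> (1/2) ^ m" .
  qed auto
  finally show ?thesis .
qed

text \<open>Choose \<open>N\<close> such that the expected Lipschitz constant of the part of the series beyond \<open>N\<close> is small.
The coefficients up to \<open>N\<close> are within \<open>\<delta>\<close> of those of the polynomial with positive probability
\<open>p\<close>, and conditioning on this event does not change the expectation of the tail. By Markov's
inequality the tail is small on a part of the event that has positive probability.\<close>

theorem close_to_trigonometric_polynomial:
  fixes \<alpha> :: "3 \<Rightarrow> int \<Rightarrow> real" and N0 :: nat
  assumes \<epsilon>: "\<epsilon> > 0"
  shows "\<exists>E\<in>sets M. prob E > 0 \<and> (\<forall>\<omega>\<in>E. \<forall>i. \<forall>s\<in>{0..2 * pi}. \<forall>t\<in>{0..2 * pi}.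
     \<bar>(X i s \<omega> - (\<Sum>n\<in>{- int N0..int N0}. \<alpha> i n * cas (of_int n * s))) -
      (X i t \<omega> - (\<Sum>n\<in>{- int N0..int N0}. \<alpha> i n * cas (of_int n * t)))\<bar> \<le> \<epsilon> * arc_dist s t)"
proof -
  \<comment> \<open>Half of \<open>\<epsilon>\<close> is spent on the frequencies up to \<open>N\<close>, and half on the others, for which
    \<open>layer\<close> is off by a factor 2.\<close>
  define \<eta> where "\<eta> = \<epsilon> / 4"
  have \<eta>: "\<eta> > 0" using \<epsilon> by (simp add: \<eta>_def)
  define K :: real where "K = 6 * sqrt (exp 30)"
  have K: "K > 0" by (simp add: K_def)
  obtain N1 where N1: "(1/2) ^ N1 < \<eta> / K" using real_arch_pow_inv[of "\<eta> / K" "1/2"] \<eta> K by auto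
  define N where "N = max N0 N1"
  have N: "N0 \<le> N" "K * (1/2) ^ N < \<eta>"
  proof -
    have "(1/2 :: real) ^ N \<le> (1/2) ^ N1" unfolding N_def by (intro power_decreasing) auto
    then have "(1/2) ^ N < \<eta> / K" using N1 by linarith
    then show "K * (1/2) ^ N < \<eta>" using K by (simp add: field_simps)
  qed (simp add: N_def)
  define \<beta> where "\<beta> = (\<lambda>i n. if n \<in> {- int N0..int N0} then \<alpha> i n else 0)"
  \<comment> \<open>\<open>D\<close> bounds the sum of the Lipschitz constants of the low frequencies; adding 1 keeps it positive
    for \<open>N = 0\<close>.\<close>
  define D where "D = (\<Sum>n\<in>{- int N..int N}. 2 * \<bar>real_of_int n\<bar>) + 1"
  have D: "D > 0" unfolding D_def by (intro add_nonneg_pos sum_nonneg) auto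
  define \<delta> where "\<delta> = \<epsilon> / (2 * D)"
  have \<delta>: "\<delta> > 0" using \<epsilon> D by (simp add: \<delta>_def)
  let ?J = "(UNIV :: 3 set) \<times> {- int N..int N}"
  define W where "W = (\<lambda>\<omega>. \<Prod>(i, n)\<in>?J. indicator {\<beta> i n - \<delta><..<\<beta> i n + \<delta>} (Z i n \<omega>) :: real)"
  obtain p where p: "p > 0" "blind_weight W p ?J"
    using blind_weight_boxes[of ?J \<delta> \<beta>] \<delta> unfolding W_def by auto
  have W_meas[measurable]: "W \<in> borel_measurable M" using p(2) unfolding blind_weight_def by blast
  have W01: "W \<omega> = (if \<forall>(i, n)\<in>?J. \<bar>Z i n \<omega> - \<beta> i n\<bar> < \<delta> then 1 else 0)" for \<omega>
  proof -
    have "W \<omega> = (\<Prod>x\<in>?J. if \<bar>Z (fst x) (snd x) \<omega> - \<beta> (fst x) (snd x)\<bar> < \<delta> then 1 else 0)"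
      unfolding W_def case_prod_unfold by (intro prod.cong) (auto simp: indicator_def abs_less_iff)
    also have "\<dots> = (if \<forall>(i, n)\<in>?J. \<bar>Z i n \<omega> - \<beta> i n\<bar> < \<delta> then 1 else 0)"
    proof (cases "\<forall>(i, n)\<in>?J. \<bar>Z i n \<omega> - \<beta> i n\<bar> < \<delta>")
      case True
      then have "(\<Prod>x\<in>?J. if \<bar>Z (fst x) (snd x) \<omega> - \<beta> (fst x) (snd x)\<bar> < \<delta> then 1 else 0 :: real) = (\<Prod>x\<in>?J. 1)"
        by (intro prod.cong) auto
      then show ?thesis using True by simp
    next
      case False
      then have "(\<Prod>x\<in>?J. if \<bar>Z (fst x) (snd x) \<omega> - \<beta> (fst x) (snd x)\<bar> < \<delta> then 1 else 0 :: real) = 0"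
        by (intro prod_zero) auto
      then show ?thesis unfolding if_not_P[OF False] .
    qed
    finally show ?thesis .
  qed
  define T where "T = (\<lambda>\<omega>. suminf (\<lambda>m. layer (m + Suc N) \<omega>))"
  have [measurable]: "T \<in> borel_measurable M" unfolding T_def by measurable
  have "(\<integral>\<^sup>+\<omega>. ennreal (W \<omega>) * T \<omega> \<partial>M) = (\<integral>\<^sup>+\<omega>. suminf (\<lambda>m. ennreal (W \<omega>) * layer (m + Suc N) \<omega>) \<partial>M)"
    unfolding T_def by (simp add: ennreal_suminf_cmult)
  also have "\<dots> = suminf (\<lambda>m. \<integral>\<^sup>+\<omega>. ennreal (W \<omega>) * layer (m + Suc N) \<omega> \<partial>M)"
    by (rule nn_integral_suminf) measurable
  also have "\<dots> \<le> suminf (\<lambda>m. ennreal p * ennreal (K * (1/2) ^ (m + Suc N)))"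
    unfolding K_def by (intro suminf_le blind_weight_layer[OF p(2)]) auto
  also have "\<dots> = ennreal p * suminf (\<lambda>m. ennreal (K * (1/2) ^ (m + Suc N)))"
    by (rule ennreal_suminf_cmult)
  also have "suminf (\<lambda>m. ennreal (K * (1/2) ^ (m + Suc N))) = ennreal (K * (1/2) ^ N)"
  proof (rule suminf_ennreal_eq)
    have "(\<lambda>m. (K * (1/2) ^ Suc N) * (1/2) ^ m) sums ((K * (1/2) ^ Suc N) * (1 / (1 - 1/2)))"
      by (intro sums_mult geometric_sums) auto
    then show "(\<lambda>m. K * (1/2) ^ (m + Suc N)) sums (K * (1/2) ^ N)" by (simp add: power_add mult_ac)
  qed (use K in auto)
  finally have WT: "(\<integral>\<^sup>+\<omega>. ennreal (W \<omega>) * T \<omega> \<partial>M) \<le> ennreal (p * (K * (1/2) ^ N))"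
    using p(1) K by (simp add: ennreal_mult)
  define F where "F = {\<omega> \<in> space M. W \<omega> = 1 \<and> T \<omega> < ennreal \<eta>}"
  have F[measurable]: "F \<in> sets M" unfolding F_def by measurable
  have "prob F > 0"
  proof (rule ccontr)
    assume "\<not> prob F > 0"
    then have "emeasure M F = 0" by (simp add: emeasure_eq_measure zero_less_measure_iff)
    then have "AE \<omega> in M. \<omega> \<notin> F" using AE_not_in[of F M] F by (auto simp: null_sets_def)
    have "(\<integral>\<^sup>+\<omega>. ennreal \<eta> * ennreal (W \<omega>) \<partial>M) \<le> (\<integral>\<^sup>+\<omega>. ennreal (W \<omega>) * T \<omega> \<partial>M)"
    proof (rule nn_integral_mono_AE)
      show "AE \<omega> in M. ennreal \<eta> * ennreal (W \<omega>) \<le> ennreal (W \<omega>) * T \<omega>"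
        using AE_space \<open>AE \<omega> in M. \<omega> \<notin> F\<close>
      proof eventually_elim
        case (elim \<omega>)
        have "W \<omega> = 0 \<or> W \<omega> = 1" unfolding W01 by simp
        then show ?case using elim unfolding F_def by (auto simp: not_less)
      qed
    qed
    also have "(\<integral>\<^sup>+\<omega>. ennreal \<eta> * ennreal (W \<omega>) \<partial>M) = ennreal \<eta> * ennreal p"
    proof -
      have "integrable M W" by (rule integrable_const_bound[of _ 1]) (auto simp: W01)
      then have "(\<integral>\<^sup>+\<omega>. ennreal (W \<omega>) \<partial>M) = ennreal p"
        using blind_weight_expectation[OF p(2)] by (subst nn_integral_eq_integral) (auto simp: W01)
      then show ?thesis by (subst nn_integral_cmult) auto
    qed
    finally have "ennreal (\<eta> * p) \<le> ennreal (p * (K * (1/2) ^ N))"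
      using WT \<eta> p(1) by (simp add: ennreal_mult)
    then have "\<eta> * p \<le> p * (K * (1/2) ^ N)" using p(1) K by (simp add: ennreal_le_iff)
    then show False using N(2) p(1) by (simp add: mult.commute)
  qed
  obtain Q where Q: "countable Q" "Q \<subseteq> {0..2 * pi}" "{0..2 * pi} \<subseteq> closure Q" using separable[of "{0..2 * pi}"] by metis
  have "AE \<omega> in M. \<forall>t\<in>Q. \<forall>i\<in>UNIV. (\<lambda>m. partial_sum i m t \<omega>) \<longlonglongrightarrow> X i t \<omega>"
    using Q(1) AE_partial_sums_converge by (intro AE_ball_countable' AE_finite_allI) auto
  then obtain G where G: "G \<in> null_sets M"
    "{\<omega> \<in> space M. \<not> (\<forall>t\<in>Q. \<forall>i\<in>UNIV. (\<lambda>m. partial_sum i m t \<omega>) \<longlonglongrightarrow> X i t \<omega>)} \<subseteq> G"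
    by (rule AE_E[unfolded null_sets_def[symmetric]]) (auto simp: null_sets_def)
  have "prob (F - G) = prob F" using G(1) F by (intro measure_Diff_null_set) auto
  moreover have "F - G \<in> sets M" using G(1) F by auto
  moreover have "\<bar>(X i s \<omega> - (\<Sum>n\<in>{- int N0..int N0}. \<alpha> i n * cas (of_int n * s))) -
      (X i t \<omega> - (\<Sum>n\<in>{- int N0..int N0}. \<alpha> i n * cas (of_int n * t)))\<bar> \<le> \<epsilon> * arc_dist s t"
    if \<omega>: "\<omega> \<in> F - G" and st: "s \<in> {0..2 * pi}" "t \<in> {0..2 * pi}" for \<omega> i s t
  proof -
    let ?p = "\<lambda>u. \<Sum>n\<in>{- int N0..int N0}. \<alpha> i n * cas (of_int n * u)"
    have \<omega>M: "\<omega> \<in> space M" and W1: "W \<omega> = 1" and T\<eta>: "T \<omega> < ennreal \<eta>" using \<omega> unfolding F_def by auto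
    have conv: "(\<lambda>m. partial_sum i m u \<omega>) \<longlonglongrightarrow> X i u \<omega>" if "u \<in> Q" for u
      using G(2) \<omega> \<omega>M that by blast
    have Z\<beta>: "\<bar>Z i n \<omega> - \<beta> i n\<bar> \<le> \<delta>" if "n \<in> {- int N..int N}" for n
    proof -
      have "\<forall>(i, n)\<in>?J. \<bar>Z i n \<omega> - \<beta> i n\<bar> < \<delta>" using W1 unfolding W01 by (auto split: if_splits)
      then have "\<bar>Z i n \<omega> - \<beta> i n\<bar> < \<delta>" using that by blast
      then show ?thesis by simp
    qed
    have tail: "(\<Sum>n\<in>{- int (N + j)..int (N + j)} - {- int N..int N}. \<bar>Z i n \<omega>\<bar> * \<bar>real_of_int n\<bar>) \<le> \<eta>" for j
    proof -
      have "ennreal (\<Sum>n\<in>{- int (N + j)..int (N + j)} - {- int N..int N}. \<bar>Z i n \<omega>\<bar> * \<bar>real_of_int n\<bar>) \<le>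
          (\<Sum>k<j. layer (k + Suc N) \<omega>)"
      proof (induction j)
        case (Suc j)
        let ?m = "int (N + Suc j)"
        have set: "{- ?m..?m} - {- int N..int N} = insert ?m (insert (- ?m) ({- int (N + j)..int (N + j)} - {- int N..int N}))"
          by auto
        have "(\<Sum>n\<in>{- ?m..?m} - {- int N..int N}. \<bar>Z i n \<omega>\<bar> * \<bar>real_of_int n\<bar>) =
            real (N + Suc j) * (\<bar>Z i ?m \<omega>\<bar> + \<bar>Z i (- ?m) \<omega>\<bar>) +
            (\<Sum>n\<in>{- int (N + j)..int (N + j)} - {- int N..int N}. \<bar>Z i n \<omega>\<bar> * \<bar>real_of_int n\<bar>)"
          unfolding set by (subst sum.insert, simp, simp, subst sum.insert, simp, simp) (simp add: algebra_simps)
        then have "ennreal (\<Sum>n\<in>{- ?m..?m} - {- int N..int N}. \<bar>Z i n \<omega>\<bar> * \<bar>real_of_int n\<bar>) =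
            ennreal (real (N + Suc j)) * (ennreal \<bar>Z i ?m \<omega>\<bar> + ennreal \<bar>Z i (- ?m) \<omega>\<bar>) +
            ennreal (\<Sum>n\<in>{- int (N + j)..int (N + j)} - {- int N..int N}. \<bar>Z i n \<omega>\<bar> * \<bar>real_of_int n\<bar>)"
          by (simp only: ennreal_plus ennreal_mult' sum_nonneg mult_nonneg_nonneg abs_ge_zero add_nonneg_nonneg of_nat_0_le_iff)
        also have "\<dots> \<le> layer (N + Suc j) \<omega> + (\<Sum>k<j. layer (k + Suc N) \<omega>)"
        proof (rule add_mono[OF _ Suc.IH])
          show "ennreal (real (N + Suc j)) * (ennreal \<bar>Z i ?m \<omega>\<bar> + ennreal \<bar>Z i (- ?m) \<omega>\<bar>) \<le> layer (N + Suc j) \<omega>"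
            unfolding layer_def by (rule member_le_sum) auto
        qed
        finally show ?case by (simp add: add.commute)
      qed simp
      also have "\<dots> \<le> T \<omega>" unfolding T_def by (intro sum_le_suminf) auto
      also have "\<dots> \<le> ennreal \<eta>" using T\<eta> by simp
      finally show ?thesis using \<eta> by (simp add: ennreal_le_iff)
    qed
    have "\<bar>(X i s \<omega> - ?p s) - (X i t \<omega> - ?p t)\<bar> \<le> \<epsilon> * arc_dist s t" if stQ: "s \<in> Q" "t \<in> Q" for s t
    proof -
      have stI: "s \<in> {0..2 * pi}" "t \<in> {0..2 * pi}" using stQ Q(2) by auto
      then have st2: "\<bar>s - t\<bar> \<le> 2 * pi" by auto
      have arc0: "0 \<le> arc_dist s t" using stI by (rule arc_dist_nonneg)
      have fin: "\<bar>(partial_sum i (N + j) s \<omega> - ?p s) - (partial_sum i (N + j) t \<omega> - ?p t)\<bar> \<le> \<epsilon> * arc_dist s t" for j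
      proof -
        let ?A = "{- int (N + j)..int (N + j)}" and ?B = "{- int N..int N}"
        have p: "?p u = (\<Sum>n\<in>?A. \<beta> i n * cas (of_int n * u))" for u
          using N(1) unfolding \<beta>_def by (intro sum.mono_neutral_cong_left) auto
        have "(partial_sum i (N + j) s \<omega> - ?p s) - (partial_sum i (N + j) t \<omega> - ?p t) =
            (\<Sum>n\<in>?A. (Z i n \<omega> - \<beta> i n) * (cas (of_int n * s) - cas (of_int n * t)))"
          unfolding p partial_sum_def sum_subtractf[symmetric] by (intro sum.cong) (auto simp: algebra_simps)
        also have "\<bar>\<dots>\<bar> \<le> (\<Sum>n\<in>?A. \<bar>Z i n \<omega> - \<beta> i n\<bar> * (2 * \<bar>of_int n\<bar> * arc_dist s t))"
          by (rule order_trans[OF sum_abs], unfold abs_mult, intro sum_mono mult_left_mono abs_cas_diff_arc_le[OF st2]) auto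
        also have "\<dots> = (\<Sum>n\<in>?B. \<bar>Z i n \<omega> - \<beta> i n\<bar> * (2 * \<bar>of_int n\<bar> * arc_dist s t)) +
            (\<Sum>n\<in>?A - ?B. \<bar>Z i n \<omega> - \<beta> i n\<bar> * (2 * \<bar>of_int n\<bar> * arc_dist s t))"
          by (subst sum.subset_diff[of ?B ?A]) auto
        also have "(\<Sum>n\<in>?B. \<bar>Z i n \<omega> - \<beta> i n\<bar> * (2 * \<bar>of_int n\<bar> * arc_dist s t)) \<le>
            (\<Sum>n\<in>?B. \<delta> * (2 * \<bar>of_int n\<bar> * arc_dist s t))"
          using Z\<beta> arc0 by (intro sum_mono mult_right_mono) auto
        also have "(\<Sum>n\<in>?B. \<delta> * (2 * \<bar>of_int n\<bar> * arc_dist s t)) = \<delta> * (D - 1) * arc_dist s t"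
          unfolding D_def by (simp add: sum_distrib_left sum_distrib_right mult_ac)
        also have "\<delta> * (D - 1) * arc_dist s t \<le> \<epsilon> / 2 * arc_dist s t"
          using D \<epsilon> arc0 unfolding \<delta>_def by (intro mult_right_mono) (auto simp: field_simps)
        also have "(\<Sum>n\<in>?A - ?B. \<bar>Z i n \<omega> - \<beta> i n\<bar> * (2 * \<bar>of_int n\<bar> * arc_dist s t)) =
            2 * (\<Sum>n\<in>?A - ?B. \<bar>Z i n \<omega>\<bar> * \<bar>real_of_int n\<bar>) * arc_dist s t"
          unfolding sum_distrib_left sum_distrib_right using N(1)
          by (intro sum.cong) (auto simp: \<beta>_def)
        also have "\<dots> \<le> 2 * \<eta> * arc_dist s t"
          using tail[of j] arc0 by (intro mult_right_mono) auto
        finally show ?thesis by (simp add: \<eta>_def algebra_simps)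
      qed
      have "(\<lambda>j. partial_sum i (N + j) u \<omega>) \<longlonglongrightarrow> X i u \<omega>" if "u \<in> Q" for u
        using LIMSEQ_ignore_initial_segment[OF conv[OF that], of N] by (simp add: add.commute)
      then have "(\<lambda>j. \<bar>(partial_sum i (N + j) s \<omega> - ?p s) - (partial_sum i (N + j) t \<omega> - ?p t)\<bar>)
          \<longlonglongrightarrow> \<bar>(X i s \<omega> - ?p s) - (X i t \<omega> - ?p t)\<bar>"
        using stQ by (intro tendsto_intros) auto
      then show ?thesis using fin by (intro LIMSEQ_le_const2) auto
    qed
    moreover have "continuous_on {0..2 * pi} (\<lambda>u. X i u \<omega> - ?p u)"
      unfolding cas_def by (intro continuous_intros continuous_on_subset[OF cont[OF \<omega>M]]) auto
    ultimately show ?thesis using arc_Lipschitz_if_dense[OF Q(2,3), of "\<lambda>u. X i u \<omega> - ?p u"] st by blast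
  qed
  ultimately show ?thesis using \<open>prob F > 0\<close> by (intro bexI[of _ "F - G"]) auto
qed

end

section \<open>Approximation by trigonometric polynomials\<close>

definition trig_poly :: "(real \<Rightarrow> real) \<Rightarrow> bool" where
  "trig_poly p \<longleftrightarrow> (\<exists>(N::nat) a. \<forall>t. p t = (\<Sum>n\<in>{- int N..int N}. a n * cas (of_int n * t)))"

lemma trig_poly_sum_le:
  assumes "\<And>t. p t = (\<Sum>n\<in>{- int N..int N}. a n * cas (of_int n * t))" "N \<le> K"
  shows "p t = (\<Sum>n\<in>{- int K..int K}. (if n \<in> {- int N..int N} then a n else 0) * cas (of_int n * t))"
  unfolding assms(1) using assms(2) by (intro sum.mono_neutral_cong_left) auto

lemma trig_poly_add:
  assumes "trig_poly p" "trig_poly q"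
  shows "trig_poly (\<lambda>t. p t + q t)"
proof -
  obtain N a where p: "\<And>t. p t = (\<Sum>n\<in>{- int N..int N}. a n * cas (of_int n * t))"
    using assms(1) unfolding trig_poly_def by blast
  obtain K b where q: "\<And>t. q t = (\<Sum>n\<in>{- int K..int K}. b n * cas (of_int n * t))"
    using assms(2) unfolding trig_poly_def by blast
  show ?thesis unfolding trig_poly_def
  proof (intro exI allI)
    fix t
    show "p t + q t = (\<Sum>n\<in>{- int (max N K)..int (max N K)}. ((if n \<in> {- int N..int N} then a n else 0) +
        (if n \<in> {- int K..int K} then b n else 0)) * cas (of_int n * t))"
      unfolding distrib_right sum.distrib
      using trig_poly_sum_le[OF p, of "max N K" t] trig_poly_sum_le[OF q, of "max N K" t] by simp
  qed
qed

lemma trig_poly_scale: "trig_poly p \<Longrightarrow> trig_poly (\<lambda>t. c * p t)"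
proof -
  assume "trig_poly p"
  then obtain N a where p: "\<And>t. p t = (\<Sum>n\<in>{- int N..int N}. a n * cas (of_int n * t))"
    unfolding trig_poly_def by blast
  then show ?thesis unfolding trig_poly_def
    by (intro exI[of _ N] exI[of _ "\<lambda>n. c * a n"]) (simp add: sum_distrib_left mult.assoc)
qed

lemma trig_poly_cas: "trig_poly (\<lambda>t. cas (of_int k * t))"
  unfolding trig_poly_def
proof (intro exI allI)
  fix t
  have "(\<Sum>n\<in>{- int (nat \<bar>k\<bar>)..int (nat \<bar>k\<bar>)}. (if n = k then 1 else 0) * cas (of_int n * t)) =
      (\<Sum>n\<in>{- int (nat \<bar>k\<bar>)..int (nat \<bar>k\<bar>)}. if n = k then cas (of_int n * t) else 0)"
    by (intro sum.cong) auto
  moreover have "- \<bar>k\<bar> \<le> k" "k \<le> \<bar>k\<bar>" by auto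
  ultimately show "cas (of_int k * t) = (\<Sum>n\<in>{- int (nat \<bar>k\<bar>)..int (nat \<bar>k\<bar>)}. (if n = k then 1 else 0) * cas (of_int n * t))"
    by simp
qed

lemma trig_poly_sum: "finite K \<Longrightarrow> (\<And>k. k \<in> K \<Longrightarrow> trig_poly (p k)) \<Longrightarrow> trig_poly (\<lambda>t. \<Sum>k\<in>K. p k t)"
proof (induction K rule: finite_induct)
  case empty
  show ?case using trig_poly_scale[OF trig_poly_cas[of 0], of 0] by simp
next
  case (insert k K)
  then show ?case using trig_poly_add[of "p k"] by simp
qed

lemma trig_poly_cos: "trig_poly (\<lambda>t. cos (of_int k * t))"
proof -
  have "cos (of_int k * t) = 1 / 2 * cas (of_int k * t) + 1 / 2 * cas (of_int (- k) * t)" for t :: real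
    by (simp add: cas_def field_simps)
  then show ?thesis by (simp only:) (intro trig_poly_add trig_poly_scale trig_poly_cas)
qed

lemma trig_poly_sin: "trig_poly (\<lambda>t. sin (of_int k * t))"
proof -
  have "sin (of_int k * t) = 1 / 2 * cas (of_int k * t) + (- 1 / 2) * cas (of_int (- k) * t)" for t :: real
    by (simp add: cas_def field_simps)
  then show ?thesis by (simp only:) (intro trig_poly_add trig_poly_scale trig_poly_cas)
qed

lemma trig_poly_const: "trig_poly (\<lambda>t. c)"
  using trig_poly_scale[OF trig_poly_cos[of 0], of c] by simp

lemma trig_poly_mult:
  assumes "trig_poly p" "trig_poly q"
  shows "trig_poly (\<lambda>t. p t * q t)"
proof -
  obtain N a where p: "\<And>t. p t = (\<Sum>n\<in>{- int N..int N}. a n * cas (of_int n * t))"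
    using assms(1) unfolding trig_poly_def by blast
  obtain K b where q: "\<And>t. q t = (\<Sum>n\<in>{- int K..int K}. b n * cas (of_int n * t))"
    using assms(2) unfolding trig_poly_def by blast
  have cc: "cas (of_int n * t) * cas (of_int m * t) = cos (of_int (n - m) * t) + sin (of_int (n + m) * t)" for n m :: int and t
    by (simp only: cas_mult of_int_diff of_int_add left_diff_distrib distrib_right)
  have "p t * q t = (\<Sum>n\<in>{- int N..int N}. \<Sum>m\<in>{- int K..int K}. (a n * b m) * (cos (of_int (n - m) * t) + sin (of_int (n + m) * t)))" for t
    unfolding p q sum_product cc[symmetric] by (intro sum.cong) (auto simp: mult_ac)
  then show ?thesis
    by (simp only:) (intro trig_poly_sum trig_poly_scale trig_poly_add trig_poly_cos trig_poly_sin finite_atLeastAtMost_int)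
qed

text \<open>Polynomials in \<open>cos t\<close> and \<open>sin t\<close> are trigonometric polynomials, as the latter form an algebra.\<close>

lemma real_polynomial_function_cis:
  "real_polynomial_function (g :: complex \<Rightarrow> real) \<Longrightarrow> trig_poly (\<lambda>t. g (cis t))"
proof (induction rule: real_polynomial_function.induct)
  case (linear h)
  have "h (cis t) = cos t * h 1 + sin t * h \<i>" for t
  proof -
    have "h (cis t) = h (cos t *\<^sub>R 1 + sin t *\<^sub>R \<i>)" by (intro arg_cong[of _ _ h]) (simp add: complex_eq_iff)
    then show ?thesis using linear by (simp add: linear_add linear_scale bounded_linear.linear)
  qed
  then show ?case
    using trig_poly_add[OF trig_poly_scale[OF trig_poly_cos[of 1], of "h 1"] trig_poly_scale[OF trig_poly_sin[of 1], of "h \<i>"]]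
    by (simp add: mult.commute)
qed (auto intro: trig_poly_const trig_poly_add trig_poly_mult)

text \<open>The Stone-Weierstrass theorem on the unit circle. A function on \<open>{0..2 * pi}\<close> with equal values at
the end points descends to a continuous function on the circle, because the circle is a quotient
of the interval under the closed map \<open>cis\<close>.\<close>

lemma trig_poly_approx:
  fixes g :: "real \<Rightarrow> real"
  assumes g: "continuous_on {0..2 * pi} g" "g 0 = g (2 * pi)" and e: "e > 0"
  shows "\<exists>q. trig_poly q \<and> (\<forall>t\<in>{0..2 * pi}. \<bar>g t - q t\<bar> < e)"
proof -
  let ?S = "sphere (0 :: complex) 1"
  define G where "G = (\<lambda>z. g (Arg2pi z))"
  have G: "G (cis t) = g t" if "t \<in> {0..2 * pi}" for t
  proof (cases "t = 2 * pi")
    case True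
    moreover have "Arg2pi 1 = 0" using Arg2pi_unique[of 1 0 1] by simp
    ultimately show ?thesis using g(2) by (simp add: G_def)
  next
    case False
    then have "Arg2pi (cis t) = t" using that by (intro Arg2pi_unique[of 1]) (auto simp: cis_conv_exp)
    then show ?thesis by (simp add: G_def)
  qed
  have "continuous_on ?S G"
  proof -
    have q: "continuous_on {0..2 * pi} (G \<circ> cis)"
      using continuous_on_eq[OF g(1), of "G \<circ> cis"] G by simp
    have img: "cis ` {0..2 * pi} = ?S"
    proof (intro equalityI subsetI)
      fix z assume "z \<in> ?S"
      then have "z = cis (Arg2pi z)" using Arg2pi_eq[of z] by (simp add: cis_conv_exp)
      moreover have "Arg2pi z \<in> {0..2 * pi}" using Arg2pi_ge_0[of z] Arg2pi_lt_2pi[of z] by simp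
      ultimately show "z \<in> cis ` {0..2 * pi}" by blast
    qed auto
    show ?thesis
      unfolding continuous_on_closed_invariant
    proof (intro allI impI)
      fix B :: "real set" assume B: "closed B"
      have "closed {t \<in> {0..2 * pi}. (G \<circ> cis) t \<in> B}"
        using continuous_closed_preimage[OF q _ B] by (simp add: vimage_def Int_def conj_commute)
      then have "compact {t \<in> {0..2 * pi}. (G \<circ> cis) t \<in> B}"
        by (rule compact_Int_closed[OF compact_Icc[of 0 "2 * pi"], THEN subst[of _ _ compact, rotated]]) auto
      then have "compact (cis ` {t \<in> {0..2 * pi}. (G \<circ> cis) t \<in> B})"
        by (intro compact_continuous_image continuous_intros)
      moreover have "cis ` {t \<in> {0..2 * pi}. (G \<circ> cis) t \<in> B} = G -` B \<inter> ?S"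
        unfolding img[symmetric] by auto
      ultimately show "\<exists>A. closed A \<and> A \<inter> ?S = G -` B \<inter> ?S"
        by (intro exI[of _ "G -` B \<inter> ?S"]) (auto simp: compact_imp_closed)
    qed
  qed
  then obtain h where h: "real_polynomial_function h" "\<And>z. z \<in> ?S \<Longrightarrow> \<bar>G z - h z\<bar> < e"
    using Stone_Weierstrass_real_polynomial_function[OF compact_sphere _ e] by metis
  have "\<bar>g t - h (cis t)\<bar> < e" if "t \<in> {0..2 * pi}" for t using h(2)[of "cis t"] G[OF that] by simp
  then show ?thesis using real_polynomial_function_cis[OF h(1)] by blast
qed

lemma trig_poly_antiderivative:
  assumes "trig_poly q"
  shows "\<exists>c p. trig_poly p \<and> (\<forall>t. (p has_real_derivative (q t - c)) (at t))"
proof -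
  obtain N a where q: "\<And>t. q t = (\<Sum>n\<in>{- int N..int N}. a n * cas (of_int n * t))"
    using assms unfolding trig_poly_def by blast
  define p where "p = (\<lambda>t. \<Sum>n\<in>{- int N..int N}. (if n = 0 then 0 else a n / of_int n) * (sin (of_int n * t) + (- 1) * cos (of_int n * t)))"
  have "trig_poly p" unfolding p_def
    by (intro trig_poly_sum trig_poly_scale trig_poly_add trig_poly_cos trig_poly_sin finite_atLeastAtMost_int)
  moreover have "(p has_real_derivative (q t - a 0)) (at t)" for t
  proof -
    have "(p has_real_derivative (\<Sum>n\<in>{- int N..int N}. (if n = 0 then 0 else a n) * cas (of_int n * t))) (at t)"
      unfolding p_def
    proof (rule DERIV_sum)
      fix n
      show "((\<lambda>t. (if n = 0 then 0 else a n / of_int n) * (sin (of_int n * t) + - 1 * cos (of_int n * t))) has_real_derivative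
         (if n = 0 then 0 else a n) * cas (of_int n * t)) (at t)"
        by (cases "n = 0") (auto intro!: derivative_eq_intros simp: cas_def algebra_simps)
    qed
    also have "(\<Sum>n\<in>{- int N..int N}. (if n = 0 then 0 else a n) * cas (of_int n * t)) = q t - a 0"
    proof -
      have "q t = a 0 * cas (of_int 0 * t) + (\<Sum>n\<in>{- int N..int N} - {0}. a n * cas (of_int n * t))"
        unfolding q by (rule sum.remove) auto
      also have "(\<Sum>n\<in>{- int N..int N} - {0}. a n * cas (of_int n * t)) =
          (\<Sum>n\<in>{- int N..int N}. (if n = 0 then 0 else a n) * cas (of_int n * t))"
        by (intro sum.mono_neutral_cong_left) auto
      finally show ?thesis by (simp add: cas_def)
    qed
    finally show ?thesis .
  qed
  ultimately show ?thesis by blast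
qed

lemma trig_poly_periodic: "trig_poly p \<Longrightarrow> p 0 = p (2 * pi)"
proof -
  have "cas (of_int n * (2 * pi)) = 1" for n :: int
    using sin_int_2pin[of n] cos_int_2pin[of n] by (simp add: cas_def mult.commute)
  then show "trig_poly p \<Longrightarrow> p 0 = p (2 * pi)" unfolding trig_poly_def by (auto simp: cas_def)
qed

text \<open>Approximate the derivative uniformly and integrate. The constant term of the approximating
polynomial has to be removed to make its antiderivative periodic; it is small because \<open>g'\<close> has
mean zero.\<close>

theorem trig_poly_Lipschitz_approx:
  fixes g g' :: "real \<Rightarrow> real"
  assumes der: "\<And>t. t \<in> {0..2 * pi} \<Longrightarrow> (g has_real_derivative g' t) (at t within {0..2 * pi})"
    and g': "continuous_on {0..2 * pi} g'" "g' 0 = g' (2 * pi)" and per: "g 0 = g (2 * pi)" and e: "e > 0"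
  shows "\<exists>p. trig_poly p \<and> (\<forall>s\<in>{0..2 * pi}. \<forall>t\<in>{0..2 * pi}. \<bar>(g s - p s) - (g t - p t)\<bar> \<le> e * arc_dist s t)"
proof -
  let ?I = "{0..2 * pi}"
  obtain q where q: "trig_poly q" "\<And>t. t \<in> ?I \<Longrightarrow> \<bar>g' t - q t\<bar> < e / 2"
    using trig_poly_approx[OF g', of "e / 2"] e by auto
  obtain c p where p: "trig_poly p" "\<And>t. (p has_real_derivative (q t - c)) (at t)"
    using trig_poly_antiderivative[OF q(1)] by blast
  define u where "u = (\<lambda>t. g t - p t)"
  have u: "(u has_real_derivative (g' t - q t + c)) (at t within ?I)" if "t \<in> ?I" for t
    unfolding u_def by (rule derivative_eq_intros der[OF that] DERIV_subset[OF p(2)] subset_UNIV refl)+ simp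
  have u0: "u 0 = u (2 * pi)" using per trig_poly_periodic[OF p(1)] by (simp add: u_def)
  have "\<exists>x\<in>?I. u (2 * pi) - u 0 = (\<lambda>h. (g' x - q x + c) * h) (2 * pi - 0)"
    by (rule mvt_very_simple) (use u in \<open>auto simp: has_field_derivative_def\<close>)
  then obtain x where x: "x \<in> ?I" "(g' x - q x + c) * (2 * pi) = 0" using u0 by auto
  then have "g' x - q x + c = 0" by simp
  then have "\<bar>c\<bar> < e / 2" using q(2)[OF x(1)] by linarith
  then have b: "\<bar>g' t - q t + c\<bar> \<le> e" if "t \<in> ?I" for t using q(2)[OF that] by linarith
  have le: "\<bar>u s - u t\<bar> \<le> e * \<bar>s - t\<bar>" if "s \<in> ?I" "t \<in> ?I" for s t
  proof -
    have "norm (u s - u t) \<le> e * norm (s - t)"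
    proof (rule differentiable_bound[of ?I u "\<lambda>x h. (g' x - q x + c) * h"])
      fix x assume x: "x \<in> ?I"
      show "(u has_derivative (\<lambda>h. (g' x - q x + c) * h)) (at x within ?I)"
        using u[OF x] unfolding has_field_derivative_def .
      show "onorm (\<lambda>h. (g' x - q x + c) * h) \<le> e"
        using b[OF x] by (intro onorm_le) (simp add: abs_mult mult_right_mono)
    qed (use that in auto)
    then show ?thesis by simp
  qed
  have "\<bar>u s - u t\<bar> \<le> e * arc_dist s t" if st: "s \<in> ?I" "t \<in> ?I" for s t
  proof -
    have wrap: "\<bar>u s - u t\<bar> \<le> e * (2 * pi - \<bar>s - t\<bar>)" if st: "s \<in> ?I" "t \<in> ?I" "s \<le> t" for s t
    proof -
      have "\<bar>u s - u t\<bar> \<le> \<bar>u s - u 0\<bar> + \<bar>u (2 * pi) - u t\<bar>" using u0 by linarith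
      also have "\<dots> \<le> e * \<bar>s - 0\<bar> + e * \<bar>2 * pi - t\<bar>" using st by (intro add_mono le) auto
      finally show ?thesis using st by (simp add: algebra_simps)
    qed
    have "\<bar>u s - u t\<bar> \<le> e * (2 * pi - \<bar>s - t\<bar>)"
      using wrap[of s t] wrap[of t s] st by (cases "s \<le> t") (auto simp: abs_minus_commute)
    then show ?thesis using le[OF st] unfolding arc_dist_def min_def by simp
  qed
  then show ?thesis using p(1) unfolding u_def by blast
qed

section \<open>The random knot\<close>

abbreviation unit_circle :: "real \<Rightarrow> real ^ 2" where
  "unit_circle t \<equiv> vector [cos t, sin t]"

lemma norm_unit_circle_diff: "(norm (unit_circle s - unit_circle t))\<^sup>2 = 2 - 2 * cos (s - t)"
proof -
  have "(norm (unit_circle s - unit_circle t))\<^sup>2 = (cos s - cos t)\<^sup>2 + (sin s - sin t)\<^sup>2"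
    unfolding power2_norm_eq_inner inner_vec_def by (simp add: sum_2 power2_eq_square)
  also have "\<dots> = ((cos s)\<^sup>2 + (sin s)\<^sup>2) + ((cos t)\<^sup>2 + (sin t)\<^sup>2) - 2 * (cos s * cos t + sin s * sin t)"
    by (simp only: power2_eq_square algebra_simps)
  also have "\<dots> = 2 - 2 * cos (s - t)" by (simp add: cos_diff)
  finally show ?thesis .
qed

text \<open>Points of the list may coincide; their coefficients are added up to obtain a combination over a
finite set of points.\<close>

lemma gaussian_rv_list:
  fixes \<xi> :: "'w \<Rightarrow> 'a \<Rightarrow> real ^ 'n" and u :: "'b \<Rightarrow> 'a"
  assumes "gaussian_field M \<xi>"
  shows "gaussian_rv M (\<lambda>\<omega>. \<Sum>(a, i, t)\<leftarrow>l. a * \<xi> \<omega> (u t) $ i)"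
proof -
  have "(\<Sum>(a, i, t)\<leftarrow>l. a * \<xi> \<omega> (u t) $ i) =
      (\<Sum>p\<in>A. (\<Sum>(a, i, t)\<leftarrow>l. if (u t, i) = p then a else 0) * \<xi> \<omega> (fst p) $ snd p)"
    if "finite A" "(\<lambda>(a, i, t). (u t, i)) ` set l \<subseteq> A" for A \<omega>
    using that
  proof (induction l)
    case (Cons x l)
    obtain a i t where x: "x = (a, i, t)" by (cases x)
    have "(\<Sum>p\<in>A. (if (u t, i) = p then a else 0) * \<xi> \<omega> (fst p) $ snd p) =
        (\<Sum>p\<in>A. if (u t, i) = p then a * \<xi> \<omega> (fst p) $ snd p else 0)"
      by (intro sum.cong) auto
    also have "\<dots> = a * \<xi> \<omega> (u t) $ i" using Cons.prems x by (subst sum.delta') auto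
    finally show ?case using Cons x by (simp add: distrib_right sum.distrib)
  qed simp
  note eq = this[OF finite_imageI[OF finite_set] order_refl]
  show ?thesis
    unfolding eq by (rule assms[unfolded gaussian_field_def, THEN spec, THEN spec, THEN mp]) simp
qed

text \<open>Covariances of other coordinates than the first are transported along the equality of the laws, and
different coordinates are uncorrelated by independence.\<close>

lemma smooth_gaussian_field_cov:
  fixes \<xi> :: "'w \<Rightarrow> real ^ 2 \<Rightarrow> real ^ 3"
  assumes M: "prob_space M" and \<xi>: "smooth_gaussian_field M \<xi>"
  shows "integrable M (\<lambda>\<omega>. \<xi> \<omega> u $ i * \<xi> \<omega> v $ j)"
    and "integral\<^sup>L M (\<lambda>\<omega>. \<xi> \<omega> u $ i * \<xi> \<omega> v $ j) = (if i = j then exp (- (norm (u - v))\<^sup>2) else 0)"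
proof -
  interpret prob_space M by (rule M)
  have g: "gaussian_field M \<xi>" and c: "centered_field M \<xi>" and iid: "coords_iid M \<xi>"
    and cov: "\<And>u v. expectation (\<lambda>\<omega>. \<xi> \<omega> u $ 1 * \<xi> \<omega> v $ 1) = exp (- (norm (u - v))\<^sup>2)"
    using \<xi> unfolding smooth_gaussian_field_def by auto
  let ?P = "Pi\<^sub>M (UNIV :: (real ^ 2) set) (\<lambda>_. borel :: real measure)"
  have gr: "gaussian_rv M (\<lambda>\<omega>. \<xi> \<omega> u $ i)" for u i
    using gaussian_rv_list[OF g, where u = "\<lambda>x. x" and l = "[(1, i, u)]"] by simp
  have meas[measurable]: "(\<lambda>\<omega>. \<xi> \<omega> u $ i) \<in> borel_measurable M" for u i
    using gr unfolding gaussian_rv_def by blast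
  have int: "integrable M (\<lambda>\<omega>. \<xi> \<omega> u $ i)" and 0: "expectation (\<lambda>\<omega>. \<xi> \<omega> u $ i) = 0" for u i
    using c unfolding centered_field_def by auto
  have sq: "integrable M (\<lambda>\<omega>. (\<xi> \<omega> u $ i)\<^sup>2)" for u i by (rule gaussian_rv_imp_char_gauss(1)[OF gr 0])
  show ii: "integrable M (\<lambda>\<omega>. \<xi> \<omega> u $ i * \<xi> \<omega> v $ j)" for u v i j
  proof (rule Bochner_Integration.integrable_bound)
    show "integrable M (\<lambda>\<omega>. (\<xi> \<omega> u $ i)\<^sup>2 + (\<xi> \<omega> v $ j)\<^sup>2)" by (intro Bochner_Integration.integrable_add sq)
    have "\<bar>x * y\<bar> \<le> x\<^sup>2 + y\<^sup>2" for x y :: real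
    proof -
      have "0 \<le> (\<bar>x\<bar> - \<bar>y\<bar>)\<^sup>2" by simp
      then have "2 * \<bar>x * y\<bar> \<le> x\<^sup>2 + y\<^sup>2" by (simp add: power2_diff abs_mult)
      moreover have "0 \<le> \<bar>x * y\<bar>" by simp
      ultimately show ?thesis by linarith
    qed
    then show "AE \<omega> in M. norm (\<xi> \<omega> u $ i * \<xi> \<omega> v $ j) \<le> norm ((\<xi> \<omega> u $ i)\<^sup>2 + (\<xi> \<omega> v $ j)\<^sup>2)" by simp
  qed measurable
  have indep: "indep_vars (\<lambda>_. ?P) (\<lambda>i \<omega> u. \<xi> \<omega> u $ i) (UNIV :: 3 set)"
    and id: "\<And>i j. distr M ?P (\<lambda>\<omega> u. \<xi> \<omega> u $ i) = distr M ?P (\<lambda>\<omega> u. \<xi> \<omega> u $ j)"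
    using iid unfolding coords_iid_def by auto
  have mP: "(\<lambda>\<omega> u. \<xi> \<omega> u $ i) \<in> measurable M ?P" for i
    by (rule measurable_PiM_single') auto
  show "expectation (\<lambda>\<omega>. \<xi> \<omega> u $ i * \<xi> \<omega> v $ j) = (if i = j then exp (- (norm (u - v))\<^sup>2) else 0)"
  proof (cases "i = j")
    case True
    have "(\<lambda>w. w u * w v) \<in> borel_measurable ?P" by measurable
    then have "expectation (\<lambda>\<omega>. \<xi> \<omega> u $ k * \<xi> \<omega> v $ k) = integral\<^sup>L (distr M ?P (\<lambda>\<omega> u. \<xi> \<omega> u $ k)) (\<lambda>w. w u * w v)" for k
      using mP by (subst integral_distr) auto
    then have "expectation (\<lambda>\<omega>. \<xi> \<omega> u $ i * \<xi> \<omega> v $ i) = expectation (\<lambda>\<omega>. \<xi> \<omega> u $ 1 * \<xi> \<omega> v $ 1)"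
      using id[of i 1] by simp
    then show ?thesis using True cov by simp
  next
    case False
    have "indep_vars (\<lambda>_. borel) (\<lambda>k. (\<lambda>w. w (if k = i then u else v)) \<circ> (\<lambda>\<omega> u. \<xi> \<omega> u $ k)) (UNIV :: 3 set)"
      by (rule indep_vars_compose[OF indep]) measurable
    then have "indep_vars (\<lambda>_. borel) (\<lambda>k \<omega>. \<xi> \<omega> (if k = i then u else v) $ k) {i, j}"
      unfolding comp_def by (rule indep_vars_subset) simp
    then have "expectation (\<lambda>\<omega>. \<Prod>k\<in>{i, j}. \<xi> \<omega> (if k = i then u else v) $ k) =
        (\<Prod>k\<in>{i, j}. expectation (\<lambda>\<omega>. \<xi> \<omega> (if k = i then u else v) $ k))"
      using int by (intro indep_vars_lebesgue_integral) auto
    then show ?thesis using False 0 by simp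
  qed
qed

lemma circle_process_smooth_gaussian_field:
  fixes \<xi> :: "'w \<Rightarrow> real ^ 2 \<Rightarrow> real ^ 3"
  assumes M: "prob_space M" and \<xi>: "smooth_gaussian_field M \<xi>"
  shows "circle_process M (\<lambda>i t \<omega>. circle_curve (\<xi> \<omega>) t $ i)"
proof -
  interpret prob_space M by (rule M)
  have g: "gaussian_field M \<xi>" and c: "centered_field M \<xi>" and sm: "\<And>\<omega>. \<omega> \<in> space M \<Longrightarrow> C_infinity (\<xi> \<omega>)"
    using \<xi> unfolding smooth_gaussian_field_def by auto
  show ?thesis
  proof
    show "gaussian_rv M (\<lambda>\<omega>. \<Sum>(a, i, t)\<leftarrow>l. a * circle_curve (\<xi> \<omega>) t $ i)" for l
      unfolding circle_curve_def by (rule gaussian_rv_list[OF g])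
    from this[of "[(1, i, t)]" for i t]
    show "(\<lambda>\<omega>. circle_curve (\<xi> \<omega>) t $ i) \<in> borel_measurable M" for i t
      unfolding gaussian_rv_def by simp
    show "integrable M (\<lambda>\<omega>. circle_curve (\<xi> \<omega>) t $ i)" "expectation (\<lambda>\<omega>. circle_curve (\<xi> \<omega>) t $ i) = 0" for i t
      using c unfolding centered_field_def circle_curve_def by auto
    show "integrable M (\<lambda>\<omega>. circle_curve (\<xi> \<omega>) s $ i * circle_curve (\<xi> \<omega>) t $ j)" for i s j t
      unfolding circle_curve_def by (rule smooth_gaussian_field_cov(1)[OF M \<xi>])
    show "expectation (\<lambda>\<omega>. circle_curve (\<xi> \<omega>) s $ i * circle_curve (\<xi> \<omega>) t $ j) = (if i = j then exp (2 * cos (s - t) - 2) else 0)" for i s j t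
      unfolding circle_curve_def smooth_gaussian_field_cov(2)[OF M \<xi>] norm_unit_circle_diff by simp
    fix i \<omega> assume "\<omega> \<in> space M"
    then have "Ck 0 (\<xi> \<omega>)" using sm unfolding C_infinity_def by blast
    then have "continuous_on UNIV (\<xi> \<omega>)" by simp
    moreover have "continuous_on UNIV unit_circle"
      by (subst continuous_on_componentwise) (auto simp: Basis_vec_def inner_axis forall_2 vector_2 intro!: continuous_intros)
    ultimately have "continuous_on UNIV (\<lambda>t. \<xi> \<omega> (unit_circle t))" by (rule continuous_on_compose2) auto
    then show "continuous_on UNIV (\<lambda>t. circle_curve (\<xi> \<omega>) t $ i)"
      unfolding circle_curve_def by (intro continuous_intros)
  qed
qed

lemma trig_poly_approx_of_smooth_param:
  assumes f: "smooth_closed_param f" and e: "e > 0"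
  shows "\<exists>(N::nat) \<alpha>. \<forall>i. \<forall>s\<in>{0..2 * pi}. \<forall>t\<in>{0..2 * pi}.
    \<bar>(f s $ i - (\<Sum>n\<in>{- int N..int N}. \<alpha> i n * cas (of_int n * s))) -
     (f t $ i - (\<Sum>n\<in>{- int N..int N}. \<alpha> i n * cas (of_int n * t)))\<bar> \<le> e * arc_dist s t"
proof -
  let ?I = "{0..2 * pi}"
  obtain f' f'' where f: "\<And>t. t \<in> ?I \<Longrightarrow> (f has_vector_derivative f' t) (at t within ?I)"
    and f2: "\<And>t. t \<in> ?I \<Longrightarrow> (f' has_vector_derivative f'' t) (at t within ?I)"
    and ends: "f 0 = f (2 * pi)" "f' 0 = f' (2 * pi)"
    using f unfolding smooth_closed_param_def by blast
  have cf': "continuous_on ?I f'"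
    unfolding continuous_on_eq_continuous_within using has_vector_derivative_continuous[OF f2] by blast
  have "\<exists>p. trig_poly p \<and> (\<forall>s\<in>?I. \<forall>t\<in>?I. \<bar>(f s $ i - p s) - (f t $ i - p t)\<bar> \<le> e * arc_dist s t)" for i
  proof (rule trig_poly_Lipschitz_approx)
    show "((\<lambda>t. f t $ i) has_real_derivative f' t $ i) (at t within ?I)" if "t \<in> ?I" for t
      using bounded_linear.has_vector_derivative[OF bounded_linear_vec_nth f[OF that]]
      by (simp add: has_real_derivative_iff_has_vector_derivative)
    show "continuous_on ?I (\<lambda>t. f' t $ i)" by (intro continuous_intros cf')
  qed (use ends e in auto)
  then obtain p where p: "\<And>i. trig_poly (p i)"
    "\<And>i s t. s \<in> ?I \<Longrightarrow> t \<in> ?I \<Longrightarrow> \<bar>(f s $ i - p i s) - (f t $ i - p i t)\<bar> \<le> e * arc_dist s t" by metis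
  have "\<forall>i. \<exists>N a. \<forall>t. p i t = (\<Sum>n\<in>{- int N..int N}. a n * cas (of_int n * t))"
    using p(1) unfolding trig_poly_def by blast
  then obtain N a where Na: "\<And>i t. p i t = (\<Sum>n\<in>{- int (N i)..int (N i)}. a i n * cas (of_int n * t))" by metis
  define K where "K = Max (range N)"
  have NK: "N i \<le> K" for i unfolding K_def by (intro Max_ge) auto
  show ?thesis
  proof (intro exI allI ballI)
    fix i s t assume st: "s \<in> ?I" "t \<in> ?I"
    show "\<bar>(f s $ i - (\<Sum>n\<in>{- int K..int K}. (if n \<in> {- int (N i)..int (N i)} then a i n else 0) * cas (of_int n * s))) -
     (f t $ i - (\<Sum>n\<in>{- int K..int K}. (if n \<in> {- int (N i)..int (N i)} then a i n else 0) * cas (of_int n * t)))\<bar> \<le> e * arc_dist s t"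
      using p(2)[OF st, of i] unfolding trig_poly_sum_le[OF Na NK, symmetric] .
  qed
qed

theorem theorem1p2:
  fixes M :: "'w measure" and \<xi> :: "'w \<Rightarrow> real ^ 2 \<Rightarrow> real ^ 3" and f :: "real \<Rightarrow> real ^ 3"
  assumes "prob_space M"
    and "smooth_gaussian_field M \<xi>"
    and "smooth_closed_param f"
  shows "{\<omega> \<in> space M. same_knot_type (circle_curve (\<xi> \<omega>)) f} \<in> sets M \<and>
         measure M {\<omega> \<in> space M. same_knot_type (circle_curve (\<xi> \<omega>)) f} > 0"
proof -
  interpret circle_process M "\<lambda>i t \<omega>. circle_curve (\<xi> \<omega>) t $ i"
    by (rule circle_process_smooth_gaussian_field[OF assms(1,2)])
  let ?I = "{0..2 * pi}"
  let ?K = "{\<omega> \<in> space M. same_knot_type (circle_curve (\<xi> \<omega>)) f}"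
  have closed: "circle_curve (\<xi> \<omega>) 0 = circle_curve (\<xi> \<omega>) (2 * pi)" for \<omega>
    by (simp add: circle_curve_def)
  have ccont: "continuous_on ?I (circle_curve (\<xi> \<omega>))" if "\<omega> \<in> space M" for \<omega>
  proof -
    have "continuous_on ?I (\<lambda>t. circle_curve (\<xi> \<omega>) t $ i)" for i
      using cont[OF that] by (rule continuous_on_subset) auto
    then have "continuous_on ?I (\<lambda>t. \<chi> i. circle_curve (\<xi> \<omega>) t $ i)" by (rule continuous_on_vec_lambda)
    then show ?thesis by simp
  qed
  have "simple_closed_curve f" using assms(3) by (rule smooth_closed_param_simple)
  moreover have "(\<lambda>\<omega>. circle_curve (\<xi> \<omega>) t) \<in> borel_measurable M" for t
  proof -
    have "(\<lambda>\<omega>. circle_curve (\<xi> \<omega>) t \<bullet> b) \<in> borel_measurable M" if b: "b \<in> Basis" for b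
    proof -
      obtain i where "b = axis i 1" using b by (auto simp: Basis_vec_def)
      then show ?thesis using meas[where i = i and t = t] by (simp add: inner_axis)
    qed
    then show ?thesis by (subst borel_measurable_euclidean_space) blast
  qed
  ultimately have sets: "?K \<in> sets M" using ccont closed by (intro measurable_knot_type)
  obtain \<epsilon> where \<epsilon>: "\<epsilon> > 0" "\<And>g. g 0 = g (2 * pi) \<Longrightarrow>
      (\<And>s t. s \<in> ?I \<Longrightarrow> t \<in> ?I \<Longrightarrow> norm ((g s - f s) - (g t - f t)) \<le> \<epsilon> * arc_dist s t) \<Longrightarrow> same_knot_type g f"
    using knot_type_stable[OF assms(3)] by blast
  \<comment> \<open>Two approximations in each of the three coordinates.\<close>
  define e where "e = \<epsilon> / 6"
  have e: "e > 0" using \<epsilon>(1) by (simp add: e_def)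
  obtain N :: nat and \<alpha> where p: "\<And>i s t. s \<in> ?I \<Longrightarrow> t \<in> ?I \<Longrightarrow>
    \<bar>(f s $ i - (\<Sum>n\<in>{- int N..int N}. \<alpha> i n * cas (of_int n * s))) -
     (f t $ i - (\<Sum>n\<in>{- int N..int N}. \<alpha> i n * cas (of_int n * t)))\<bar> \<le> e * arc_dist s t"
    using trig_poly_approx_of_smooth_param[OF assms(3) e] by blast
  obtain E where E: "E \<in> sets M" "prob E > 0"
    and close: "\<And>\<omega> i s t. \<omega> \<in> E \<Longrightarrow> s \<in> ?I \<Longrightarrow> t \<in> ?I \<Longrightarrow>
     \<bar>(circle_curve (\<xi> \<omega>) s $ i - (\<Sum>n\<in>{- int N..int N}. \<alpha> i n * cas (of_int n * s))) -
      (circle_curve (\<xi> \<omega>) t $ i - (\<Sum>n\<in>{- int N..int N}. \<alpha> i n * cas (of_int n * t)))\<bar> \<le> e * arc_dist s t"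
    using close_to_trigonometric_polynomial[OF e, where ?N0.0 = N and \<alpha> = \<alpha>] by blast
  have "E \<subseteq> ?K"
  proof
    fix \<omega> assume \<omega>: "\<omega> \<in> E"
    have "same_knot_type (circle_curve (\<xi> \<omega>)) f"
    proof (rule \<epsilon>(2)[OF closed])
      fix s t assume st: "s \<in> ?I" "t \<in> ?I"
      let ?d = "(circle_curve (\<xi> \<omega>) s - f s) - (circle_curve (\<xi> \<omega>) t - f t)"
      have "norm ?d \<le> (\<Sum>i\<in>UNIV. \<bar>?d $ i\<bar>)" by (rule norm_le_l1_cart)
      also have "\<dots> \<le> (\<Sum>i\<in>(UNIV :: 3 set). 2 * e * arc_dist s t)"
      proof (rule sum_mono)
        fix i :: 3
        show "\<bar>?d $ i\<bar> \<le> 2 * e * arc_dist s t"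
          using p[OF st, of i] close[OF \<omega> st, of i] unfolding vector_minus_component by linarith
      qed
      also have "\<dots> = \<epsilon> * arc_dist s t" by (simp add: e_def)
      finally show "norm ?d \<le> \<epsilon> * arc_dist s t" .
    qed
    then show "\<omega> \<in> ?K" using \<omega> E(1) sets.sets_into_space by blast
  qed
  then have "prob E \<le> prob ?K" using sets by (rule finite_measure_mono)
  then show ?thesis using sets E(2) by simp
qed

end
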